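(* Let $\mathcal W$ be the even part of $W(m,n;\underline t)$ over a field of characteristic $p>3$, with $m,n\ge3$ and $\underline t=(t_1,\dots,t_m)\in\mathbb N^m$. Then the outer derivation algebra $\mathrm{Der_{out}}(\mathcal W)=\mathrm{Der}(\mathcal W)/\mathrm{ad}\,\mathcal W$ is an abelian Lie algebra of dimension $\sum_{i=1}^m t_i-m$.
   Context: $\mathbb F$ is a field of characteristic $p>3$; $m,n\ge 3$; $\pi_i=p^{t_i}-1$. $Y_0=\{1,\dots,m\}$, $Y_1=\{m+1,\dots,m+n\}$, $Y=Y_0\cup Y_1$, $\tau(r)=\bar0$ on $Y_0$, $\bar1$ on $Y_1$. $\mathfrak A=\mathfrak A(m,n;\underline t)$ is the supercommutative superalgebra with basis $x^{(\alpha)}x^u$ ($\alpha\in\mathbb N_0^m$, $\alpha_i\le\pi_i$; $u$ an increasing sequence in $Y_1$, $x^u$ the product of odd generators $x_k$, $k\in u$), with divided-power multiplication $x^{(\alpha)}x^{(\beta)}=\prod_i\binom{\alpha_i+\beta_i}{\alpha_i}x^{(\alpha+\beta)}$ (zero if some index exceeds $\pi_i$), anticommuting $x_k$, parity $|u|\bmod 2$. $D_i$ ($i\in Y_0$) sends $x^{(\alpha)}x^u\mapsto x^{(\alpha-\varepsilon_i)}x^u$, $D_k$ ($k\in Y_1$) is the odd partial derivative $\partial/\partial x_k$. $W=W(m,n;\underline t)=\{\sum_{r\in Y} f_rD_r:f_r\in\mathfrak A\}$ with bracket $[fD_r,gD_s]=fD_r(g)D_s-(-1)^{\mathrm p(fD_r)\mathrm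 p(gD_s)}gD_s(f)D_r$, parity of $x^{(\alpha)}x^uD_r$ being $|u|+\tau(r)$. $\mathcal W=W_{\bar0}$ is the even part, a Lie algebra; $\mathrm{ad}\,\mathcal W$ is its ideal of inner derivations in $\mathrm{Der}(\mathcal W)$. *)

theory Defs
  imports Main "HOL.Vector_Spaces" "HOL-Computational_Algebra.Primes" "HOL-Library.Function_Algebras"
begin

text \<open>Index sets. Even variables are indexed by Y0 = {1..m}, odd ones by Y1 = {m+1..m+n}.\<close>

definition Y0 :: "nat \<Rightarrow> nat set" where "Y0 m = {1..m}"
definition Y1 :: "nat \<Rightarrow> nat \<Rightarrow> nat set" where "Y1 m n = {m+1..m+n}"
definition Yall :: "nat \<Rightarrow> nat \<Rightarrow> nat set" where "Yall m n = Y0 m \<union> Y1 m n"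

definition tau :: "nat \<Rightarrow> nat \<Rightarrow> nat \<Rightarrow> nat" where
  "tau m n r = (if r \<in> Y1 m n then 1 else 0)"

text \<open>Basis monomials x^(alpha) x^u of the divided power superalgebra A(m,n;t):
  alpha is an exponent vector supported on {1..m} with alpha i \<le> pi_i = p^(t i) - 1,
  and u is a (finite) subset of Y1 (an increasing sequence = its set of entries).\<close>
definition abasis :: "nat \<Rightarrow> nat \<Rightarrow> nat \<Rightarrow> (nat \<Rightarrow> nat) \<Rightarrow> ((nat \<Rightarrow> nat) \<times> nat set) set" where
  "abasis p m n t = {(\<alpha>, u). (\<forall>i. \<alpha> i \<le> (if i \<in> Y0 m then p ^ t i - 1 else 0)) \<and> u \<subseteq> Y1 m n}"

text \<open>Elements of A are coefficient functions on the basis (zero off the basis).\<close>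
definition Acar :: "nat \<Rightarrow> nat \<Rightarrow> nat \<Rightarrow> (nat \<Rightarrow> nat) \<Rightarrow> (((nat \<Rightarrow> nat) \<times> nat set) \<Rightarrow> 'a::field) set" where
  "Acar p m n t = {f. \<forall>b. b \<notin> abasis p m n t \<longrightarrow> f b = 0}"

definition dpcoef :: "nat \<Rightarrow> (nat \<Rightarrow> nat) \<Rightarrow> (nat \<Rightarrow> nat) \<Rightarrow> 'a::field" where
  "dpcoef m \<alpha> \<beta> = (\<Prod>i\<in>Y0 m. of_nat ((\<alpha> i + \<beta> i) choose \<alpha> i))"

text \<open>Sign of x^u x^v = sign * x^(u \<union> v) for disjoint u, v (number of inversions).\<close>
definition osign :: "nat set \<Rightarrow> nat set \<Rightarrow> 'a::field" where
  "osign u v = (- 1) ^ card {(a, b). a \<in> u \<and> b \<in> v \<and> b < a}"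

definition amul :: "nat \<Rightarrow> nat \<Rightarrow> nat \<Rightarrow> (nat \<Rightarrow> nat) \<Rightarrow>
    (((nat \<Rightarrow> nat) \<times> nat set) \<Rightarrow> 'a::field) \<Rightarrow> (((nat \<Rightarrow> nat) \<times> nat set) \<Rightarrow> 'a) \<Rightarrow>
    (((nat \<Rightarrow> nat) \<times> nat set) \<Rightarrow> 'a)" where
  "amul p m n t f g = (\<lambda>(\<gamma>, w). if (\<gamma>, w) \<in> abasis p m n t then
      (\<Sum>(x, y) \<in> {(x, y). x \<in> abasis p m n t \<and> y \<in> abasis p m n t \<and>
                      fst x + fst y = \<gamma> \<and> snd x \<union> snd y = w \<and> snd x \<inter> snd y = {}}.
          f x * g y * dpcoef m (fst x) (fst y) * osign (snd x) (snd y))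
     else 0)"

text \<open>The partial derivatives D_r: for r in Y0, x^(alpha) x^u \<mapsto> x^(alpha - e_r) x^u;
  for r in Y1, the odd (left) derivative d/dx_r.\<close>
definition aD :: "nat \<Rightarrow> nat \<Rightarrow> nat \<Rightarrow> (nat \<Rightarrow> nat) \<Rightarrow> nat \<Rightarrow>
    (((nat \<Rightarrow> nat) \<times> nat set) \<Rightarrow> 'a::field) \<Rightarrow> (((nat \<Rightarrow> nat) \<times> nat set) \<Rightarrow> 'a)" where
  "aD p m n t r f = (\<lambda>(\<alpha>, u). if (\<alpha>, u) \<in> abasis p m n t then
      (if r \<in> Y0 m then f (\<alpha>(r := \<alpha> r + 1), u)
       else if r \<in> Y1 m n \<and> r \<notin> u then (- 1) ^ card {j \<in> u. j < r} * f (\<alpha>, insert r u)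
       else 0)
     else 0)"

text \<open>Elements of W: sum_r f_r D_r, represented as r \<mapsto> f_r (zero for r outside Y).\<close>
type_synonym 'a welem = "nat \<Rightarrow> ((nat \<Rightarrow> nat) \<times> nat set) \<Rightarrow> 'a"

definition Wcar :: "nat \<Rightarrow> nat \<Rightarrow> nat \<Rightarrow> (nat \<Rightarrow> nat) \<Rightarrow> ('a::field) welem set" where
  "Wcar p m n t = {X. \<forall>r. (r \<notin> Yall m n \<longrightarrow> X r = 0) \<and> X r \<in> Acar p m n t}"

text \<open>The even part: x^(alpha) x^u D_r has parity |u| + tau(r).\<close>
definition Weven :: "nat \<Rightarrow> nat \<Rightarrow> nat \<Rightarrow> (nat \<Rightarrow> nat) \<Rightarrow> ('a::field) welem set" where
  "Weven p m n t = {X \<in> Wcar p m n t. \<forall>r \<alpha> u. odd (card u + tau m n r) \<longrightarrow> X r (\<alpha>, u) = 0}"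

text \<open>The bracket of W restricted to even elements (the sign (-1)^(p p) is +1):
  [sum_r f_r D_r, sum_s g_s D_s] = sum_s (sum_r f_r D_r(g_s) - g_r D_r(f_s)) D_s.\<close>
definition brW :: "nat \<Rightarrow> nat \<Rightarrow> nat \<Rightarrow> (nat \<Rightarrow> nat) \<Rightarrow> ('a::field) welem \<Rightarrow> 'a welem \<Rightarrow> 'a welem" where
  "brW p m n t X Y = (\<lambda>s. if s \<in> Yall m n then
      (\<Sum>r\<in>Yall m n. amul p m n t (X r) (aD p m n t r (Y s)) - amul p m n t (Y r) (aD p m n t r (X s)))
     else 0)"

definition wsmul :: "'a::field \<Rightarrow> 'a welem \<Rightarrow> 'a welem" where
  "wsmul c X = (\<lambda>r b. c * X r b)"

text \<open>Derivations of the Lie algebra Weven, as linear maps Weven \<rightarrow> Weven (extended by 0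
  outside Weven, so that they form a vector space of functions).\<close>
definition DerW :: "nat \<Rightarrow> nat \<Rightarrow> nat \<Rightarrow> (nat \<Rightarrow> nat) \<Rightarrow> (('a::field) welem \<Rightarrow> 'a welem) set" where
  "DerW p m n t = {D.
     (\<forall>x \<in> Weven p m n t. D x \<in> Weven p m n t) \<and>
     (\<forall>x \<in> Weven p m n t. \<forall>y \<in> Weven p m n t. D (x + y) = D x + D y) \<and>
     (\<forall>c. \<forall>x \<in> Weven p m n t. D (wsmul c x) = wsmul c (D x)) \<and>
     (\<forall>x \<in> Weven p m n t. \<forall>y \<in> Weven p m n t.
        D (brW p m n t x y) = brW p m n t (D x) y + brW p m n t x (D y)) \<and>
     (\<forall>x. x \<notin> Weven p m n t \<longrightarrow> D x = 0)}"

definition adW :: "nat \<Rightarrow> nat \<Rightarrow> nat \<Rightarrow> (nat \<Rightarrow> nat) \<Rightarrow> (('a::field) welem \<Rightarrow> 'a welem) set" where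
  "adW p m n t = {(\<lambda>y. if y \<in> Weven p m n t then brW p m n t x y else 0) | x. x \<in> Weven p m n t}"

definition escale :: "'a::field \<Rightarrow> ('a welem \<Rightarrow> 'a welem) \<Rightarrow> ('a welem \<Rightarrow> 'a welem)" where
  "escale c D = (\<lambda>x. wsmul c (D x))"

end

theory Submission
  imports Defs "HOL-Algebra.Exponent"
begin

text \<open>
  Write the algebra as a sum of weight spaces for the torus spanned by the elements \<open>x_r D_r\<close> and
  let \<open>\<phi>\<close> be a derivation. Subtracting inner derivations, one may assume successively that

  \<^item> \<open>\<phi>\<close> kills the torus (the weight-zero values of \<open>\<phi>\<close> on the torus commute with every weight
    vector, and the centre is trivial), so that \<open>\<phi>\<close> preserves weights;
  \<^item> \<open>\<phi>\<close> kills every \<open>D_i\<close> with \<open>i\<close> even: the equations \<open>[D_i, X] = \<phi>(D_i)\<close> are solvable up to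
    multiples of \<open>x_i^(pi_i)\<close> by a Poincare lemma for divided powers, and the remaining
    obstruction is excluded by weights and by bracketing with \<open>x_a x_b D_j\<close>;
  \<^item> \<open>\<phi>\<close> kills \<open>x_a D_b\<close> and \<open>x_a x_b D_j\<close> for distinct odd \<open>a\<close>, \<open>b\<close> and even \<open>j\<close>.

  Then \<open>\<phi>\<close> commutes with the \<open>D_i\<close>, so it is determined by the constant terms of its values, and
  weights together with a few brackets show that on \<open>x^(\<alpha>) D_i\<close> the constant term is
  \<open>c(\<alpha>) D_i\<close>, where \<open>c(\<alpha>) = 0\<close> whenever \<open>x^(\<alpha>)\<close> is up to a nonzero scalar a product of two
  nonconstant monomials. The exceptions are the \<open>\<alpha>\<close> equal to a power \<open>p^e\<close> at a single index \<open>k\<close>.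
  Subtracting the derivations \<open>(ad D_k)^(p^e)\<close> with \<open>1 \<le> e < t_k\<close> kills all \<open>x^(\<alpha>) D_i\<close>; the
  resulting derivation is zero because the remaining basis vectors are obtained from elements
  already killed. These powers are linearly independent modulo inner derivations and commute with
  each other, which gives the dimension and the commutativity.
\<close>

section \<open>Binomial coefficients modulo a prime\<close>

text \<open>The obstacle is that weights are elements of the field, so an even exponent is seen only
  modulo \<open>p\<close>. As \<open>pi i\<close> is \<open>-1\<close> there,
  \<open>x_i^(pi_i) x_a D_a\<close> has the same weight as \<open>D_i\<close>, and weights alone
  often leave several candidates for a value. The remaining ones are tested by bracketing with the
  elements \<open>x_a x_b D_j\<close>, \<open>a\<close> and \<open>b\<close> odd: these turn an
  unwanted family of coefficients \<open>z_a\<close> into \<open>z_a + z_b = 0\<close> for all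
  pairs, and three odd indices in odd characteristic then give \<open>z_a = 0\<close>.

  The exponents \<open>p^e\<close> stand out because the binomials of \<open>p^e\<close> over
  \<open>b\<close> with \<open>0 < b < p^e\<close> vanish modulo \<open>p\<close>. Hence the divided
  power of exponent \<open>p^e\<close> is no product of lower powers of the same variable, which
  leaves a free parameter for a derivation there; the same vanishing makes the \<open>p^e\<close>-th
  power of \<open>ad D_k\<close> a derivation. For \<open>e = 0\<close> this power is inner and for
  \<open>e \<ge> t_k\<close> it is zero, so each \<open>k\<close> contributes \<open>t_k - 1\<close>
  outer derivations.\<close>

lemma prime_dvd_prime_power_choose:
  fixes p :: nat
  assumes "prime p" "0 < k" "k < p ^ e"
  shows "p dvd (p ^ e choose k)"
proof (rule ccontr)
  assume n: "\<not> p dvd (p ^ e choose k)"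
  \<comment> \<open>By this absorption identity all of \<open>p ^ e\<close> must divide
    \<open>k\<close> once \<open>p\<close> does not divide the binomial.\<close>
  have "k * (p ^ e choose k) = p ^ e * ((p ^ e - 1) choose (k - 1))"
    using times_binomial_minus1_eq[of k "p ^ e"] assms by simp
  then have "p ^ e dvd k * (p ^ e choose k)" by simp
  then have "p ^ e dvd k"
    using n assms(1) coprime_dvd_mult_left_iff[of "p ^ e" "p ^ e choose k" k]
    by (metis coprime_commute coprime_power_right_iff prime_imp_coprime_nat
        coprime_power_left_iff)
  with assms show False by (simp add: nat_dvd_not_less)
qed

text \<open>The \<open>p\<close>-adic valuation of the binomial is that of \<open>q\<close>, the
  count behind Sylow's theorem. For \<open>q > 1\<close> it splits the divided power with exponent
  \<open>p ^ e * q\<close> into two nontrivial factors.\<close>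

lemma not_dvd_choose_prime_power:
  fixes p :: nat
  assumes "prime p" "\<not> p dvd q"
  shows "\<not> p dvd (p ^ e * q choose p ^ e)"
proof -
  have q: "q > 0" using assms(2) by (cases q) auto
  have p0: "p > 0" using assms(1) prime_gt_0_nat by blast
  have "multiplicity p (p ^ e * q choose p ^ e) = multiplicity p q"
    using const_p_fac q assms(1) by blast
  also have "\<dots> = 0" using assms(2) by (rule not_dvd_imp_multiplicity_0)
  finally have m0: "multiplicity p (p ^ e * q choose p ^ e) = 0" .
  have "(p ^ e * q choose p ^ e) \<noteq> 0"
    using q p0 by simp
  with m0 assms(1) show ?thesis
    by (metis multiplicity_eq_zero_iff not_prime_unit)
qed

text \<open>Pascal's rule in the symmetric form that matches the two summands of a product
  rule.\<close>

lemma choose_pascal: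
  fixes a b :: nat
  assumes "a + b > 0"
  shows "(a + b choose a) =
    (if a > 0 then (a - 1 + b choose (a - 1)) else 0) + (if b > 0 then (a + (b - 1) choose a) else 0)"
proof (cases a)
  case 0 then show ?thesis using assms by simp
next
  case (Suc a')
  then show ?thesis by (cases b) auto
qed

text \<open>The inductive step of the Leibniz rule for iterated derivations: differentiating term
  \<open>j\<close> of level \<open>N\<close> feeds the terms \<open>j + 1\<close> and
  \<open>j\<close> of the next level.\<close>

lemma pascal_sum:
  fixes g :: "nat \<Rightarrow> 'b::comm_ring_1"
  shows "(\<Sum>j\<le>N. of_nat (N choose j) * (g (Suc j) + g j)) = (\<Sum>j\<le>Suc N. of_nat (Suc N choose j) * g j)"
proof -
  have "(\<Sum>j\<le>Suc N. of_nat (Suc N choose j) * g j) =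
      g 0 + (\<Sum>j\<le>N. of_nat (Suc N choose Suc j) * g (Suc j))"
    by (subst sum.atMost_Suc_shift) simp
  also have "\<dots> = (\<Sum>j\<le>N. of_nat (N choose j) * g (Suc j)) + (g 0 + (\<Sum>j\<le>N. of_nat (N choose Suc j) * g (Suc j)))"
    by (simp add: algebra_simps sum.distrib)
  also have "g 0 + (\<Sum>j\<le>N. of_nat (N choose Suc j) * g (Suc j)) = (\<Sum>j\<le>Suc N. of_nat (N choose j) * g j)"
    unfolding sum.atMost_Suc_shift by simp
  also have "\<dots> = (\<Sum>j\<le>N. of_nat (N choose j) * g j)" by (simp add: binomial_eq_0)
  finally show ?thesis by (simp add: algebra_simps sum.distrib)
qed

lemma add3_eq_0: "a + b + c = 0 \<Longrightarrow> a = - b + - (c :: 'b::ab_group_add)"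
proof -
  assume "a + b + c = 0"
  moreover have "a = (a + b + c) + (- b + - c)" by simp
  ultimately show ?thesis by simp
qed

definition sn :: "nat \<Rightarrow> nat \<Rightarrow> nat \<Rightarrow> nat" where "sn j k = (\<lambda>i. if i = j then k else 0)"

lemma sn_apply [simp]: "sn j k j = k" "i \<noteq> j \<Longrightarrow> sn j k i = 0" by (simp_all add: sn_def)

lemma sn_0 [simp]: "sn j 0 = (\<lambda>_. 0)" by (simp add: sn_def)

lemma sn_upd [simp]: "(sn j k)(j := l) = sn j l" by (auto simp: sn_def)

lemma sn_pos: "(0 < sn j k i) = (i = j \<and> 0 < k)" by (simp add: sn_def)

lemma sn_eq_0 [simp]: "sn j k = (\<lambda>_. 0) \<longleftrightarrow> k = 0"
  by (auto simp: sn_def fun_eq_iff)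

abbreviation zr :: "nat \<Rightarrow> nat" where "zr \<equiv> (\<lambda>_. 0)"

lemma zr_add [simp]: "zr + \<beta> = \<beta>" "\<beta> + zr = \<beta>"
  by (auto simp: plus_fun_def)

lemma sn_add: "sn j k + \<beta> = \<beta>(j := \<beta> j + k)" "\<beta> + sn j k = \<beta>(j := \<beta> j + k)"
  by (auto simp: fun_eq_iff sn_def)

section \<open>The superalgebra\<close>

definition ninv :: "nat set \<Rightarrow> nat set \<Rightarrow> nat" where
  "ninv u v = card {(a, b). a \<in> u \<and> b \<in> v \<and> b < a}"

text \<open>\<open>nlt\<close> and \<open>ngt\<close> count the transpositions that bring
  \<open>x_r\<close> to its place from the front, respectively the back, of
  \<open>x^u\<close>.\<close>

definition nlt :: "nat \<Rightarrow> nat set \<Rightarrow> nat" where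
  "nlt r u = card {j \<in> u. j < r}"

definition ngt :: "nat \<Rightarrow> nat set \<Rightarrow> nat" where
  "ngt r u = card {j \<in> u. r < j}"

lemma osign_ninv: "osign u v = (- 1) ^ ninv u v"
  by (simp add: osign_def ninv_def)

lemma finite_ninv: "finite u \<Longrightarrow> finite v \<Longrightarrow> finite {(a, b). a \<in> u \<and> b \<in> v \<and> b < (a::nat)}"
  by (rule finite_subset[of _ "u \<times> v"]) auto

lemma ninv_Un_left:
  assumes "finite u" "finite v" "finite w" "u \<inter> v = {}"
  shows "ninv (u \<union> v) w = ninv u w + ninv v w"
proof -
  have "{(a, b). a \<in> u \<union> v \<and> b \<in> w \<and> b < a} =
      {(a, b). a \<in> u \<and> b \<in> w \<and> b < a} \<union> {(a, b). a \<in> v \<and> b \<in> w \<and> b < a}" by auto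
  then show ?thesis unfolding ninv_def using assms
    by (simp add: card_Un_disjoint finite_ninv disjoint_iff)
qed

lemma ninv_Un_right:
  assumes "finite u" "finite v" "finite w" "u \<inter> v = {}"
  shows "ninv w (u \<union> v) = ninv w u + ninv w v"
proof -
  have "{(a, b). a \<in> w \<and> b \<in> u \<union> v \<and> b < a} =
      {(a, b). a \<in> w \<and> b \<in> u \<and> b < a} \<union> {(a, b). a \<in> w \<and> b \<in> v \<and> b < a}" by auto
  then show ?thesis unfolding ninv_def using assms
    by (simp add: card_Un_disjoint finite_ninv disjoint_iff)
qed

lemma ninv_single_left: "ninv {r} v = nlt r v"
  unfolding ninv_def nlt_def
  by (rule bij_betw_same_card[of snd]) (auto simp: bij_betw_def inj_on_def image_iff)

lemma ninv_single_right: "ninv v {r} = ngt r v"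
  unfolding ninv_def ngt_def
  by (rule bij_betw_same_card[of fst]) (auto simp: bij_betw_def inj_on_def image_iff)

text \<open>Each pair of \<open>u \<times> v\<close> is an inversion in exactly one of the two
  orders; this yields the sign of supercommutativity.\<close>

lemma ninv_swap:
  assumes "finite u" "finite v" "u \<inter> v = {}"
  shows "ninv u v + ninv v u = card u * card v"
proof -
  have s: "ninv v u = card {(a, b). a \<in> u \<and> b \<in> v \<and> a < b}"
    unfolding ninv_def
    by (rule bij_betw_same_card[of prod.swap]) (auto simp: bij_betw_def inj_on_def image_iff)
  have "u \<times> v = {(a, b). a \<in> u \<and> b \<in> v \<and> b < a} \<union> {(a, b). a \<in> u \<and> b \<in> v \<and> a < b}"
    using assms(3) by (auto simp: disjoint_iff) (metis nat_neq_iff)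
  moreover have f2: "finite {(a, b). a \<in> u \<and> b \<in> v \<and> a < b}"
    by (rule finite_subset[of _ "u \<times> v"]) (use assms in auto)
  moreover have "{(a, b). a \<in> u \<and> b \<in> v \<and> b < a} \<inter> {(a, b). a \<in> u \<and> b \<in> v \<and> a < b} = {}" by auto
  ultimately have "card (u \<times> v) = card {(a, b). a \<in> u \<and> b \<in> v \<and> b < a} + card {(a, b). a \<in> u \<and> b \<in> v \<and> a < b}"
    using card_Un_disjoint[OF finite_ninv[OF assms(1,2)] f2] by argo
  then have "card (u \<times> v) = ninv u v + ninv v u"
    unfolding s unfolding ninv_def .
  then show ?thesis by (simp add: card_cartesian_product)
qed

lemma ninv_empty [simp]: "ninv {} v = 0" "ninv u {} = 0"
  by (simp_all add: ninv_def)

lemma nlt_Un: "finite u \<Longrightarrow> finite v \<Longrightarrow> u \<inter> v = {} \<Longrightarrow> nlt r (u \<union> v) = nlt r u + nlt r v"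
  using ninv_Un_right[of u v "{r}"] by (simp add: ninv_single_left)

lemma nlt_Diff_same: "nlt r (u - {r}) = nlt r u"
  unfolding nlt_def by (rule arg_cong[of _ _ card]) auto

lemma nlt_ngt:
  assumes "finite u" "r \<in> u"
  shows "nlt r u + ngt r u + 1 = card u"
proof -
  have "u = insert r ({j \<in> u. j < r} \<union> {j \<in> u. r < j})" using assms by auto
  then have "card u = card (insert r ({j \<in> u. j < r} \<union> {j \<in> u. r < j}))" by simp
  also have "\<dots> = Suc (card {j \<in> u. j < r} + card {j \<in> u. r < j})"
    using assms by (subst card_insert_disjoint) (auto intro!: card_Un_disjoint)
  finally show ?thesis by (simp add: nlt_def ngt_def)
qed

lemma nlt_ngt_notin:
  assumes "finite u" "r \<notin> u"
  shows "nlt r u + ngt r u = card u"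
proof -
  have "u = {j \<in> u. j < r} \<union> {j \<in> u. r < j}" using assms by auto (metis nat_neq_iff)
  then have "card u = card ({j \<in> u. j < r} \<union> {j \<in> u. r < j})" by simp
  also have "\<dots> = card {j \<in> u. j < r} + card {j \<in> u. r < j}"
    using assms by (auto intro!: card_Un_disjoint)
  finally show ?thesis by (simp add: nlt_def ngt_def)
qed

definition sc :: "'a::field \<Rightarrow> ('b \<Rightarrow> 'a) \<Rightarrow> 'b \<Rightarrow> 'a" where
  "sc c f = (\<lambda>b. c * f b)"

lemma sc_apply [simp]: "sc c f b = c * f b" by (simp add: sc_def)

lemma sc_simps [simp]:
  "sc c (sc d f) = sc (c * d) f" "sc 1 f = f" "sc 0 f = 0" "sc c 0 = 0"
  by (auto simp: fun_eq_iff algebra_simps)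

lemma sc_add: "sc c (f + g) = sc c f + sc c g" "sc (c + d) f = sc c f + sc d f"
  and sc_diff: "sc c (f - g) = sc c f - sc c g" "sc (c - d) f = sc c f - sc d f"
  and sc_minus: "sc c (- f) = - sc c f" "sc (- c) f = - sc c f"
  by (auto simp: fun_eq_iff algebra_simps)

lemma sc_sum: "sc c (sum f I) = (\<Sum>i\<in>I. sc c (f i))"
  using sum_comp_morphism[of "sc c" f I] by (simp add: sc_add(1) comp_def)

section \<open>Truncated monomials and linear induction\<close>

locale even_W =
  fixes p m n :: nat and t :: "nat \<Rightarrow> nat" and ty :: "'a::field itself"
  assumes char_p: "CHAR('a) = p" and prime_p: "prime p" and p_gt: "p > 3"
    and m_ge: "m \<ge> 3" and n_ge: "n \<ge> 3" and t_ge: "\<And>i. i \<in> {1..m} \<Longrightarrow> t i \<ge> 1"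
begin

abbreviation B :: "((nat \<Rightarrow> nat) \<times> nat set) set" where "B \<equiv> abasis p m n t"
abbreviation A :: "(((nat \<Rightarrow> nat) \<times> nat set) \<Rightarrow> 'a) set" where "A \<equiv> Acar p m n t"
abbreviation Y where "Y \<equiv> Yall m n"
abbreviation E where "E \<equiv> Y0 m"
abbreviation Od where "Od \<equiv> Y1 m n"
abbreviation D :: "nat \<Rightarrow> (((nat \<Rightarrow> nat) \<times> nat set) \<Rightarrow> 'a) \<Rightarrow> (((nat \<Rightarrow> nat) \<times> nat set) \<Rightarrow> 'a)"
  where "D r \<equiv> aD p m n t r"
abbreviation mul :: "(((nat \<Rightarrow> nat) \<times> nat set) \<Rightarrow> 'a) \<Rightarrow> (((nat \<Rightarrow> nat) \<times> nat set) \<Rightarrow> 'a) \<Rightarrow>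
    (((nat \<Rightarrow> nat) \<times> nat set) \<Rightarrow> 'a)" (infixl "\<odot>" 70)
  where "f \<odot> g \<equiv> amul p m n t f g"
abbreviation pi :: "nat \<Rightarrow> nat" where "pi i \<equiv> p ^ t i - 1"

lemma p_pos [simp]: "p > 0" using p_gt by simp

lemma finite_Y [simp]: "finite Y" "finite E" "finite Od"
  by (auto simp: Yall_def Y0_def Y1_def)

lemma E_Od: "E \<inter> Od = {}" "i \<in> E \<Longrightarrow> i \<notin> Od" "i \<in> Od \<Longrightarrow> i \<notin> E"
  by (auto simp: Y0_def Y1_def)

lemma Y_iff: "r \<in> Y \<longleftrightarrow> r \<in> E \<or> r \<in> Od" by (auto simp: Yall_def)

lemma in_B: "(\<alpha>, u) \<in> B \<longleftrightarrow> (\<forall>i. \<alpha> i \<le> (if i \<in> E then pi i else 0)) \<and> u \<subseteq> Od"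
  by (simp add: abasis_def)

lemma finite_Od_sub: "u \<subseteq> Od \<Longrightarrow> finite u"
  by (rule finite_subset[of u Od]) (simp_all add: Y1_def)

lemma B_finite: "(\<alpha>, u) \<in> B \<Longrightarrow> finite u"
  by (simp add: in_B finite_Od_sub)

lemma finite_B [simp]: "finite B"
proof -
  let ?N = "Max ((\<lambda>i. pi i) ` E \<union> {0})"
  have "B \<subseteq> {\<alpha>. \<forall>i. (i \<in> E \<longrightarrow> \<alpha> i \<in> {..?N}) \<and> (i \<notin> E \<longrightarrow> \<alpha> i = 0)} \<times> Pow Od"
  proof
    fix x assume x: "x \<in> B"
    obtain \<alpha> u where xe: "x = (\<alpha>, u)" by (cases x)
    have a: "(\<alpha>, u) \<in> B" using x xe by simp
    have "\<alpha> i \<le> ?N" if "i \<in> E" for i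
      by (rule order_trans[of _ "pi i"]) (use a that in \<open>auto simp: in_B intro!: Max_ge dest: spec[of _ i]\<close>)
    then show "x \<in> {\<alpha>. \<forall>i. (i \<in> E \<longrightarrow> \<alpha> i \<in> {..?N}) \<and> (i \<notin> E \<longrightarrow> \<alpha> i = 0)} \<times> Pow Od"
      using a unfolding xe by (auto simp: in_B split: if_splits)
  qed
  moreover have "finite ({\<alpha>. \<forall>i. (i \<in> E \<longrightarrow> \<alpha> i \<in> {..?N}) \<and> (i \<notin> E \<longrightarrow> \<alpha> i = 0)} \<times> Pow Od)"
    by (intro finite_cartesian_product finite_set_of_finite_funs) auto
  ultimately show ?thesis by (rule finite_subset)
qed

lemma B_down: "(\<alpha>, u) \<in> B \<Longrightarrow> (\<And>i. \<beta> i \<le> \<alpha> i) \<Longrightarrow> v \<subseteq> Od \<Longrightarrow> (\<beta>, v) \<in> B"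
  unfolding in_B by (meson order_trans)

text \<open>Zero off the basis, so that a product that leaves the truncated range needs no case of
  its own.\<close>

definition mon :: "((nat \<Rightarrow> nat) \<times> nat set) \<Rightarrow> ((nat \<Rightarrow> nat) \<times> nat set) \<Rightarrow> 'a" where
  "mon b = (\<lambda>c. if c = b \<and> b \<in> B then 1 else 0)"

lemma mon_A [simp]: "mon b \<in> A" by (auto simp: mon_def Acar_def)
lemma mon_notin [simp]: "b \<notin> B \<Longrightarrow> mon b = 0" by (auto simp: mon_def fun_eq_iff)

lemma A_add [simp]: "f \<in> A \<Longrightarrow> g \<in> A \<Longrightarrow> f + g \<in> A"
  and A_diff [simp]: "f \<in> A \<Longrightarrow> g \<in> A \<Longrightarrow> f - g \<in> A"
  and A_sc [simp]: "f \<in> A \<Longrightarrow> sc c f \<in> A"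
  and A_0 [simp]: "0 \<in> A"
  and A_uminus [simp]: "f \<in> A \<Longrightarrow> - f \<in> A"
  unfolding Acar_def by simp_all

lemma A_sum [simp]: "(\<And>i. i \<in> I \<Longrightarrow> f i \<in> A) \<Longrightarrow> (\<Sum>i\<in>I. f i) \<in> A"
  by (induction I rule: infinite_finite_induct) auto

lemma sum_apply': "(\<Sum>i\<in>I. f i) x = (\<Sum>i\<in>I. f i x)"
  by (induction I rule: infinite_finite_induct) auto

lemma A_expand:
  assumes "f \<in> A" shows "f = (\<Sum>b\<in>B. sc (f b) (mon b))"
proof
  fix c
  have "(\<Sum>b\<in>B. sc (f b) (mon b)) c = (\<Sum>b\<in>B. if b = c then f b else 0)"
    unfolding sum_apply' by (rule sum.cong) (auto simp: mon_def)
  also have "\<dots> = (if c \<in> B then f c else 0)" by simp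
  also have "\<dots> = f c" using assms unfolding Acar_def by (cases c) simp
  finally show "f c = (\<Sum>b\<in>B. sc (f b) (mon b)) c" by simp
qed

text \<open>The set \<open>S\<close> carries a support condition on \<open>f\<close>, such as a
  fixed parity, over to the monomials.\<close>

lemma A_induct_on [consumes 2, case_names zero mon add sc]:
  assumes f: "f \<in> A" and S: "\<And>b. f b \<noteq> 0 \<Longrightarrow> b \<in> S"
    and z: "P 0" and mon: "\<And>b. b \<in> S \<Longrightarrow> b \<in> B \<Longrightarrow> P (mon b)"
    and add: "\<And>f g. f \<in> A \<Longrightarrow> g \<in> A \<Longrightarrow> P f \<Longrightarrow> P g \<Longrightarrow> P (f + g)"
    and sc: "\<And>c f. f \<in> A \<Longrightarrow> P f \<Longrightarrow> P (sc c f)"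
  shows "P f"
proof -
  let ?g = "\<lambda>b. sc (f b) (mon b)"
  have "C \<subseteq> B \<longrightarrow> P (sum ?g C) \<and> sum ?g C \<in> A" if "finite C" for C
  proof (rule finite_induct[where P = "\<lambda>C. C \<subseteq> B \<longrightarrow> P (sum ?g C) \<and> sum ?g C \<in> A", OF that])
    show "{} \<subseteq> B \<longrightarrow> P (sum ?g {}) \<and> sum ?g {} \<in> A" unfolding sum.empty using z A_0 by blast
  next
    fix b C assume insert: "finite C" "b \<notin> C" "C \<subseteq> B \<longrightarrow> P (sum ?g C) \<and> sum ?g C \<in> A"
    show "insert b C \<subseteq> B \<longrightarrow> P (sum ?g (insert b C)) \<and> sum ?g (insert b C) \<in> A"
    proof
    assume "insert b C \<subseteq> B"
    then have bC: "b \<in> B" "C \<subseteq> B" by auto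
    have "P (sc (f b) (mon b))" (is "P ?x")
    proof (cases "f b = 0")
      case True then show ?thesis using z by simp
    next
      case False then show ?thesis by (intro sc mon_A mon bC S)
    qed
    moreover have "P (sum ?g C)" "sum ?g C \<in> A" using insert bC by blast+
    ultimately have "P (?x + sum ?g C)" by (intro add A_sc mon_A)
    then show "P (sum ?g (insert b C)) \<and> sum ?g (insert b C) \<in> A"
      unfolding sum.insert[OF insert(1,2)] using \<open>sum ?g C \<in> A\<close> by (intro conjI A_add A_sc mon_A)
    qed
  qed
  from this[of B] show ?thesis using A_expand[OF f] by simp
qed

lemma A_induct [consumes 1, case_names zero mon add sc]:
  assumes f: "f \<in> A" 
    and z: "P 0" and mon: "\<And>b. b \<in> B \<Longrightarrow> P (mon b)"
    and add: "\<And>f g. f \<in> A \<Longrightarrow> g \<in> A \<Longrightarrow> P f \<Longrightarrow> P g \<Longrightarrow> P (f + g)"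
    and sc: "\<And>c f. f \<in> A \<Longrightarrow> P f \<Longrightarrow> P (sc c f)"
  shows "P f"
  by (rule A_induct_on[where S = UNIV and P = P, OF f UNIV_I z mon add sc])

section \<open>The product: bilinearity, associativity, supercommutativity\<close>

lemma mul_A [simp]: "f \<odot> g \<in> A"
  by (auto simp: Acar_def amul_def)
lemma D_A [simp]: "D r f \<in> A"
  by (auto simp: Acar_def aD_def)

lemma mul_add: "(f + g) \<odot> h = f \<odot> h + g \<odot> h" "f \<odot> (g + h) = f \<odot> g + f \<odot> h"
  by (auto simp: amul_def fun_eq_iff algebra_simps sum.distrib[symmetric] case_prod_beta intro!: sum.cong)

lemma mul_sc: "sc c f \<odot> h = sc c (f \<odot> h)" "f \<odot> sc c h = sc c (f \<odot> h)"
  by (auto simp: amul_def fun_eq_iff algebra_simps sum_distrib_left case_prod_beta intro!: sum.cong)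

lemma mul_0 [simp]: "0 \<odot> h = 0" "h \<odot> 0 = 0"
  by (auto simp: amul_def fun_eq_iff)

lemma minus_sc: "- f = sc (- 1) f" by (auto simp: fun_eq_iff)

lemma mul_minus: "(- f) \<odot> h = - (f \<odot> h)" "f \<odot> (- h) = - (f \<odot> h)"
  by (simp_all only: minus_sc mul_sc)

lemma mul_diff: "(f - g) \<odot> h = f \<odot> h - g \<odot> h" "f \<odot> (g - h) = f \<odot> g - f \<odot> h"
  by (simp_all only: diff_conv_add_uminus mul_add mul_minus)

lemma mul_sum: "sum f I \<odot> h = (\<Sum>i\<in>I. f i \<odot> h)" "h \<odot> sum f I = (\<Sum>i\<in>I. h \<odot> f i)"
  by (induction I rule: infinite_finite_induct) (simp_all add: mul_add)

lemma D_add: "D r (f + g) = D r f + D r g"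
  by (auto simp: aD_def fun_eq_iff algebra_simps)
lemma D_sc: "D r (sc c f) = sc c (D r f)"
  by (auto simp: aD_def fun_eq_iff algebra_simps)
lemma D_0 [simp]: "D r 0 = 0"
  by (auto simp: aD_def fun_eq_iff)
lemma D_minus: "D r (- f) = - D r f"
  by (simp only: minus_sc D_sc)
lemma D_diff: "D r (f - g) = D r f - D r g"
  by (simp only: diff_conv_add_uminus D_add D_minus)
lemma mul_mon:
  assumes a: "(\<alpha>, u) \<in> B" and b: "(\<beta>, v) \<in> B"
  shows "mon (\<alpha>, u) \<odot> mon (\<beta>, v) =
    (if u \<inter> v = {} then sc (dpcoef m \<alpha> \<beta> * osign u v) (mon (\<alpha> + \<beta>, u \<union> v)) else 0)"
proof
  fix c :: "(nat \<Rightarrow> nat) \<times> nat set"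
  obtain \<gamma> w where c: "c = (\<gamma>, w)" by (cases c) auto
  let ?S = "{(x, y). x \<in> B \<and> y \<in> B \<and> fst x + fst y = \<gamma> \<and> snd x \<union> snd y = w \<and> snd x \<inter> snd y = {}}"
  have fin: "finite ?S" by (rule finite_subset[of _ "B \<times> B"]) auto
  have "(\<Sum>(x, y)\<in>?S. mon (\<alpha>, u) x * mon (\<beta>, v) y * dpcoef m (fst x) (fst y) * osign (snd x) (snd y))
      = (\<Sum>z\<in>?S. if z = ((\<alpha>, u), (\<beta>, v)) then dpcoef m \<alpha> \<beta> * osign u v else (0::'a))"
    by (rule sum.cong) (use a b in \<open>auto simp: mon_def split: if_splits\<close>)
  also have "\<dots> = (if ((\<alpha>, u), (\<beta>, v)) \<in> ?S then dpcoef m \<alpha> \<beta> * osign u v else 0)"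
    using fin by simp
  finally show "(mon (\<alpha>, u) \<odot> mon (\<beta>, v)) c =
    (if u \<inter> v = {} then sc (dpcoef m \<alpha> \<beta> * osign u v) (mon (\<alpha> + \<beta>, u \<union> v)) else 0) c"
    unfolding c using a b by (auto simp: amul_def mon_def)
qed

text \<open>Both sides are the product over all indices of the same trinomial coefficients.\<close>

lemma dpcoef_assoc:
  "(dpcoef m \<alpha> \<beta> * dpcoef m (\<alpha> + \<beta>) \<gamma> :: 'a) = dpcoef m \<beta> \<gamma> * dpcoef m \<alpha> (\<beta> + \<gamma>)"
proof -
  have "((a + b choose a) * (a + b + c choose (a + b)) :: nat) = (b + c choose b) * (a + (b + c) choose a)" for a b c
    using choose_mult[of a "a + b" "a + b + c"] by (simp add: algebra_simps)
  then have "(of_nat (a + b choose a) * of_nat (a + b + c choose (a + b)) :: 'a)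
      = of_nat (b + c choose b) * of_nat (a + (b + c) choose a)" for a b c
    by (metis of_nat_mult)
  then show ?thesis
    unfolding dpcoef_def by (simp add: prod.distrib[symmetric])
qed

lemma dpcoef_comm: "(dpcoef m \<alpha> \<beta> :: 'a) = dpcoef m \<beta> \<alpha>"
proof -
  have "(a + b choose a) = (b + a choose b)" for a b :: nat
    using binomial_symmetric[of a "a + b"] by (simp add: add.commute)
  then show ?thesis by (simp add: dpcoef_def)
qed

lemma mul_assoc_mon:
  assumes "a \<in> B" "b \<in> B" "c \<in> B"
  shows "mon a \<odot> mon b \<odot> mon c = mon a \<odot> (mon b \<odot> mon c)"
proof -
  obtain \<alpha> u \<beta> v \<gamma> w where e: "a = (\<alpha>, u)" "b = (\<beta>, v)" "c = (\<gamma>, w)" by (cases a, cases b, cases c) auto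
  have s: "u \<subseteq> Od" "v \<subseteq> Od" "w \<subseteq> Od" and f: "finite u" "finite v" "finite w"
    using assms by (auto simp: e in_B finite_Od_sub)
  show ?thesis
  proof (cases "u \<inter> v = {} \<and> u \<inter> w = {} \<and> v \<inter> w = {}")
    case False
    have 1: "mon a \<odot> mon b \<odot> mon c = 0"
    proof (cases "u \<inter> v = {} \<and> (\<alpha> + \<beta>, u \<union> v) \<in> B")
      case True
      then show ?thesis using assms False unfolding e by (auto simp: mul_mon mul_sc)
    next
      case False then show ?thesis using assms unfolding e by (auto simp: mul_mon)
    qed
    have 2: "mon a \<odot> (mon b \<odot> mon c) = 0"
    proof (cases "v \<inter> w = {} \<and> (\<beta> + \<gamma>, v \<union> w) \<in> B")
      case True
      then show ?thesis using assms False unfolding e by (auto simp: mul_mon mul_sc)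
    next
      case False then show ?thesis using assms unfolding e by (auto simp: mul_mon)
    qed
    from 1 2 show ?thesis by simp
  next
    case True
    let ?z = "mon (\<alpha> + \<beta> + \<gamma>, u \<union> v \<union> w)"
    have 1: "mon a \<odot> mon b \<odot> mon c = sc (dpcoef m \<alpha> \<beta> * osign u v * dpcoef m (\<alpha> + \<beta>) \<gamma> * osign (u \<union> v) w) ?z"
    proof (cases "(\<alpha> + \<beta>, u \<union> v) \<in> B")
      case t: True
      then show ?thesis using assms True unfolding e by (auto simp: mul_mon mul_sc Int_Un_distrib2 mult.assoc)
    next
      case False
      \<comment> \<open>Exponents only grow under multiplication: a partial product outside the
        basis takes the whole product with it.\<close>
      then have "(\<alpha> + \<beta> + \<gamma>, u \<union> v \<union> w) \<notin> B" using B_down[of "\<alpha> + \<beta> + \<gamma>" "u \<union> v \<union> w" "\<alpha> + \<beta>" "u \<union> v"] s by auto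
      with False show ?thesis using assms True unfolding e by (auto simp: mul_mon)
    qed
    have 2: "mon a \<odot> (mon b \<odot> mon c) = sc (dpcoef m \<beta> \<gamma> * osign v w * dpcoef m \<alpha> (\<beta> + \<gamma>) * osign u (v \<union> w)) ?z"
    proof (cases "(\<beta> + \<gamma>, v \<union> w) \<in> B")
      case t: True
      then show ?thesis using assms True unfolding e by (auto simp: mul_mon mul_sc Int_Un_distrib mult.assoc add.assoc Un_assoc)
    next
      case False
      then have "(\<alpha> + \<beta> + \<gamma>, u \<union> v \<union> w) \<notin> B" using B_down[of "\<alpha> + \<beta> + \<gamma>" "u \<union> v \<union> w" "\<beta> + \<gamma>" "v \<union> w"] s by auto
      with False show ?thesis using assms True unfolding e by (auto simp: mul_mon)
    qed
    have 3: "(osign u v * osign (u \<union> v) w :: 'a) = osign v w * osign u (v \<union> w)"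
      using f True by (simp add: osign_ninv ninv_Un_left ninv_Un_right power_add[symmetric] algebra_simps)
    have "dpcoef m \<alpha> \<beta> * osign u v * dpcoef m (\<alpha> + \<beta>) \<gamma> * osign (u \<union> v) w
        = (dpcoef m \<alpha> \<beta> * dpcoef m (\<alpha> + \<beta>) \<gamma>) * (osign u v * osign (u \<union> v) w :: 'a)"
      by (simp only: mult_ac)
    also have "\<dots> = dpcoef m \<beta> \<gamma> * osign v w * dpcoef m \<alpha> (\<beta> + \<gamma>) * osign u (v \<union> w)"
      unfolding 3 dpcoef_assoc by (simp only: mult_ac)
    finally show ?thesis unfolding 1 2 by simp
  qed
qed

lemma mul_assoc:
  assumes "f \<in> A" "g \<in> A" "h \<in> A"
  shows "f \<odot> g \<odot> h = f \<odot> (g \<odot> h)"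
proof (rule A_induct[where P = "\<lambda>f. f \<odot> g \<odot> h = f \<odot> (g \<odot> h)", OF assms(1)])
  fix a assume a: "a \<in> B"
  show "mon a \<odot> g \<odot> h = mon a \<odot> (g \<odot> h)"
  proof (rule A_induct[where P = "\<lambda>g. mon a \<odot> g \<odot> h = mon a \<odot> (g \<odot> h)", OF assms(2)])
    fix b assume b: "b \<in> B"
    show "mon a \<odot> mon b \<odot> h = mon a \<odot> (mon b \<odot> h)"
      by (rule A_induct[where P = "\<lambda>h. mon a \<odot> mon b \<odot> h = mon a \<odot> (mon b \<odot> h)", OF assms(3)])
        (simp_all add: mul_assoc_mon a b mul_add mul_sc)
  qed (simp_all add: mul_add mul_sc)
qed (simp_all add: mul_add mul_sc)

lemma mul_comm_mon:
  assumes "a \<in> B" "b \<in> B"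
  shows "mon a \<odot> mon b = sc ((- 1) ^ (card (snd a) * card (snd b))) (mon b \<odot> mon a)"
proof -
  obtain \<alpha> u \<beta> v where e: "a = (\<alpha>, u)" "b = (\<beta>, v)" by (cases a, cases b) auto
  have s: "finite u" "finite v" using assms by (auto simp: e B_finite)
  show ?thesis
  proof (cases "u \<inter> v = {}")
    case True
    have "(osign u v :: 'a) = (- 1) ^ (card u * card v) * osign v u"
      unfolding osign_ninv ninv_swap[OF s True, symmetric] 
      by (simp add: power_add power_mult_distrib[symmetric] mult.assoc)
    then show ?thesis using assms True unfolding e
      by (simp add: mul_mon Int_commute Un_commute add.commute dpcoef_comm[of \<alpha> \<beta>] mult.left_commute)
  next
    case False
    then show ?thesis using assms unfolding e by (simp add: mul_mon Int_commute)
  qed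
qed

text \<open>The twist a factor acquires when \<open>D_r\<close> passes it: the parity automorphism
  for odd \<open>r\<close>, the identity for even \<open>r\<close>. It lets one Leibniz rule serve
  both kinds of index.\<close>

definition sg :: "nat \<Rightarrow> (((nat \<Rightarrow> nat) \<times> nat set) \<Rightarrow> 'a) \<Rightarrow> ((nat \<Rightarrow> nat) \<times> nat set) \<Rightarrow> 'a" where
  "sg r f = (\<lambda>b. if r \<in> Od then (- 1) ^ card (snd b) * f b else f b)"

lemma sg_A [simp]: "f \<in> A \<Longrightarrow> sg r f \<in> A" by (auto simp: sg_def Acar_def)
lemma sg_add: "sg r (f + g) = sg r f + sg r g" by (auto simp: sg_def fun_eq_iff algebra_simps)
lemma sg_sc: "sg r (sc c f) = sc c (sg r f)" by (auto simp: sg_def fun_eq_iff algebra_simps)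
lemma sg_0 [simp]: "sg r 0 = 0" by (auto simp: sg_def fun_eq_iff)
lemma sg_sg [simp]: "sg r (sg r f) = f" 
  by (auto simp: sg_def fun_eq_iff power_mult_distrib[symmetric] mult.assoc[symmetric])
lemma sg_mon: "sg r (mon b) = sc (if r \<in> Od then (- 1) ^ card (snd b) else 1) (mon b)"
  by (auto simp: sg_def fun_eq_iff mon_def)

text \<open>Homogeneity of parity \<open>e\<close> modulo 2. The zero element has both parities,
  which makes the property closed under linear combinations.\<close>

definition par :: "nat \<Rightarrow> (((nat \<Rightarrow> nat) \<times> nat set) \<Rightarrow> 'a) \<Rightarrow> bool" where
  "par e f \<longleftrightarrow> f \<in> A \<and> (\<forall>b. odd (card (snd b) + e) \<longrightarrow> f b = 0)"

text \<open>On monomials this is the sign \<open>(-1)^(|u| |v|)\<close>. The parity is that of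
  \<open>D_r\<close> because the coefficient of \<open>D_r\<close> in an even element has
  it.\<close>

lemma mul_par_comm:
  assumes f: "par (tau m n r) f" and g: "g \<in> A"
  shows "f \<odot> g = sg r g \<odot> f"
proof -
  have "f \<in> A" and z: "\<And>b. odd (card (snd b) + tau m n r) \<Longrightarrow> f b = 0"
    using f unfolding par_def by blast+
  show ?thesis
  proof (rule A_induct_on[where P = "\<lambda>f. f \<odot> g = sg r g \<odot> f" and
        S = "{b. even (card (snd b) + tau m n r)}", OF \<open>f \<in> A\<close>])
    fix a assume a: "a \<in> {b. even (card (snd b) + tau m n r)}" "a \<in> B"
    show "mon a \<odot> g = sg r g \<odot> mon a"
    proof (rule A_induct[where P = "\<lambda>g. mon a \<odot> g = sg r g \<odot> mon a", OF g])
      fix b assume "b \<in> B"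
      then show "mon a \<odot> mon b = sg r (mon b) \<odot> mon a" using a
        by (simp add: mul_comm_mon[of a b] sg_mon mul_sc tau_def power_mult split: if_splits)
    qed (simp_all add: mul_add mul_sc sg_add sg_sc)
  next
    fix b assume "f b \<noteq> 0" then show "b \<in> {b. even (card (snd b) + tau m n r)}" using z by blast
  qed (simp_all add: mul_add mul_sc)
qed

section \<open>The partial derivatives as superderivations\<close>

lemma D_mon_E:
  assumes "r \<in> E" "(\<beta>, v) \<in> B"
  shows "D r (mon (\<beta>, v)) = (if \<beta> r > 0 then mon (\<beta>(r := \<beta> r - 1), v) else 0)"
proof (cases "\<beta> r > 0")
  case True
  have m: "(\<beta>(r := \<beta> r - 1), v) \<in> B" by (rule B_down[of \<beta> v]) (use assms in \<open>auto simp: in_B\<close>)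
  have eq: "(\<alpha>(r := \<alpha> r + 1), u) = (\<beta>, v) \<longleftrightarrow> (\<alpha>, u) = (\<beta>(r := \<beta> r - 1), v)" for \<alpha> u
  proof -
    have "\<alpha>(r := \<alpha> r + 1) = \<beta> \<longleftrightarrow> \<alpha> = \<beta>(r := \<beta> r - 1)"
      using True by (metis Suc_eq_plus1 Suc_pred' diff_add_inverse2 fun_upd_same fun_upd_triv fun_upd_upd)
    then show ?thesis by simp
  qed
  show ?thesis
  proof
    fix c show "D r (mon (\<beta>, v)) c = (if \<beta> r > 0 then mon (\<beta>(r := \<beta> r - 1), v) else 0) c"
      using assms(1) True m assms(2) eq[of "fst c" "snd c"] by (cases c) (simp add: aD_def mon_def)
  qed
next
  case False
  then show ?thesis using assms by (auto simp: aD_def mon_def fun_eq_iff)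
qed

lemma D_mon_O:
  assumes "r \<in> Od" "v \<subseteq> Od"
  shows "D r (mon (\<beta>, v)) = (if r \<in> v then sc ((- 1) ^ nlt r v) (mon (\<beta>, v - {r})) else 0)"
proof -
  have 1: "(\<beta>, v) \<in> B \<longleftrightarrow> (\<beta>, v - {r}) \<in> B" using assms by (auto simp: in_B)
  have 2: "{j \<in> v. j \<noteq> r \<and> j < r} = {j \<in> v. j < r}" by auto
  have 3: "insert r u = v \<and> r \<notin> u \<longleftrightarrow> r \<in> v \<and> u = v - {r}" for u by auto
  show ?thesis
  proof
    fix c show "D r (mon (\<beta>, v)) c = (if r \<in> v then sc ((- 1) ^ nlt r v) (mon (\<beta>, v - {r})) else 0) c"
    proof (cases c)
      case (Pair \<alpha> u)
      have "D r (mon (\<beta>, v)) c = (if r \<notin> u then (- 1) ^ card {j \<in> u. j < r} * mon (\<beta>, v) (\<alpha>, insert r u) else 0)"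
        using assms E_Od(3)[OF assms(1)] unfolding Pair by (auto simp: aD_def mon_def in_B)
      also have "\<dots> = (if r \<in> v \<and> u = v - {r} then (- 1) ^ nlt r v * mon (\<beta>, v) (\<alpha>, v) else 0)"
        using 3[of u] 2 by (auto simp: nlt_def mon_def)
      also have "\<dots> = (if r \<in> v then sc ((- 1) ^ nlt r v) (mon (\<beta>, v - {r})) else 0) c"
        using 1 by (auto simp: Pair mon_def)
      finally show ?thesis .
    qed
  qed
qed

text \<open>As simp rules these would rewrite eta-expanded identities between elements pointwise, after which
  the linearity laws no longer match.\<close>

lemmas pointwise = plus_fun_apply zero_fun_apply minus_apply uminus_apply sc_apply
declare pointwise [simp del]

lemma B_lower: "(\<alpha>, u) \<in> B \<Longrightarrow> k \<le> \<alpha> r \<Longrightarrow> (\<alpha>(r := k), u) \<in> B"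
  by (rule B_down) (auto simp: in_B)

lemma A_out: "f \<in> A \<Longrightarrow> b \<notin> B \<Longrightarrow> f b = 0"
  unfolding Acar_def by blast

lemma D_E_apply: "r \<in> E \<Longrightarrow> f \<in> A \<Longrightarrow> D r f (\<alpha>, u) = f (\<alpha>(r := Suc (\<alpha> r)), u)"
  using A_out[of f "(\<alpha>(r := Suc (\<alpha> r)), u)"] B_lower[of "\<alpha>(r := Suc (\<alpha> r))" u "\<alpha> r" r] by (auto simp: aD_def)

lemma D_O_apply:
  "r \<in> Od \<Longrightarrow> f \<in> A \<Longrightarrow> D r f (\<alpha>, u) = (if r \<in> u then 0 else (- 1) ^ nlt r u * f (\<alpha>, insert r u))"
  using E_Od(3)[of r] unfolding aD_def Acar_def nlt_def by (auto simp: in_B)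

lemma dpcoef_split:
  assumes "r \<in> E"
  shows "dpcoef m \<alpha> \<beta> = (of_nat (\<alpha> r + \<beta> r choose \<alpha> r) * (\<Prod>i\<in>E - {r}. of_nat (\<alpha> i + \<beta> i choose \<alpha> i)) :: 'a)"
  unfolding dpcoef_def using assms by (subst prod.remove[of _ r]) auto

lemma of_nat_choose_prime_power: "0 < k \<Longrightarrow> k < p ^ e \<Longrightarrow> (of_nat (p ^ e choose k) :: 'a) = 0"
  using prime_dvd_prime_power_choose[OF prime_p] by (simp add: of_nat_eq_0_iff_char_dvd char_p)

text \<open>Pascal's rule, except at the truncation. If
  \<open>\<alpha> r + \<beta> r = p ^ t r\<close>, the product is zero although the terms on the
  right may not be; they add up to a multiple of the binomial of \<open>p ^ t r\<close> over
  \<open>\<alpha> r\<close>, which is zero in the field.\<close>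

lemma superder_mon_E:
  assumes r: "r \<in> E" and a: "(\<alpha>, u) \<in> B" and b: "(\<beta>, v) \<in> B"
  shows "D r (mon (\<alpha>, u) \<odot> mon (\<beta>, v)) = D r (mon (\<alpha>, u)) \<odot> mon (\<beta>, v) + mon (\<alpha>, u) \<odot> D r (mon (\<beta>, v))"
proof (cases "u \<inter> v = {}")
  case False
  have "(\<alpha>(r := \<alpha> r - 1), u) \<in> B" "(\<beta>(r := \<beta> r - 1), v) \<in> B"
    using a b by (simp_all add: B_lower)
  then show ?thesis using False a b r by (simp add: mul_mon D_mon_E)
next
  case True
  let ?w = "u \<union> v"
  let ?\<gamma> = "\<alpha> + \<beta>" 
  let ?\<delta> = "?\<gamma>(r := ?\<gamma> r - 1)"
  define d where "d = (\<Prod>i\<in>E - {r}. of_nat (\<alpha> i + \<beta> i choose \<alpha> i) :: 'a)"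
  define K where "K = (osign u v :: 'a)"
  have m1: "(\<alpha>(r := \<alpha> r - 1), u) \<in> B" and m2: "(\<beta>(r := \<beta> r - 1), v) \<in> B"
    using a b by (simp_all add: B_lower)
  have d0: "dpcoef m \<alpha> \<beta> = of_nat (\<alpha> r + \<beta> r choose \<alpha> r) * d"
    using dpcoef_split[OF r] by (simp add: d_def)
  have d1: "dpcoef m (\<alpha>(r := \<alpha> r - 1)) \<beta> = of_nat (\<alpha> r - 1 + \<beta> r choose (\<alpha> r - 1)) * d"
    using dpcoef_split[OF r] by (simp add: d_def)
  have d2: "dpcoef m \<alpha> (\<beta>(r := \<beta> r - 1)) = of_nat (\<alpha> r + (\<beta> r - 1) choose \<alpha> r) * d"
    using dpcoef_split[OF r] by (simp add: d_def)
  have e1: "\<alpha> r > 0 \<Longrightarrow> \<alpha>(r := \<alpha> r - 1) + \<beta> = ?\<delta>" by (auto simp: fun_eq_iff pointwise)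
  have e2: "\<beta> r > 0 \<Longrightarrow> \<alpha> + \<beta>(r := \<beta> r - 1) = ?\<delta>" by (auto simp: fun_eq_iff pointwise)
  have w: "?w \<subseteq> Od" using a b by (auto simp: in_B)
  have R1: "D r (mon (\<alpha>, u)) \<odot> mon (\<beta>, v) =
      sc ((if \<alpha> r > 0 then of_nat (\<alpha> r - 1 + \<beta> r choose (\<alpha> r - 1)) else 0) * d * K) (mon (?\<delta>, ?w))"
    using r a b m1 True e1 d1[simplified] by (simp add: D_mon_E mul_mon K_def)
  have R2: "mon (\<alpha>, u) \<odot> D r (mon (\<beta>, v)) =
      sc ((if \<beta> r > 0 then of_nat (\<alpha> r + (\<beta> r - 1) choose \<alpha> r) else 0) * d * K) (mon (?\<delta>, ?w))"
    using r a b m2 True e2 d2[simplified] by (simp add: D_mon_E mul_mon K_def)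
  have P: "\<alpha> r + \<beta> r > 0 \<Longrightarrow> of_nat (\<alpha> r + \<beta> r choose \<alpha> r) =
     (if \<alpha> r > 0 then of_nat (\<alpha> r - 1 + \<beta> r choose (\<alpha> r - 1)) else 0) +
     (if \<beta> r > 0 then of_nat (\<alpha> r + (\<beta> r - 1) choose \<alpha> r) else (0::'a))"
    using choose_pascal[of "\<alpha> r" "\<beta> r"] by (simp split: if_splits)
  have R: "D r (mon (\<alpha>, u)) \<odot> mon (\<beta>, v) + mon (\<alpha>, u) \<odot> D r (mon (\<beta>, v)) =
      sc (if \<alpha> r + \<beta> r > 0 then of_nat (\<alpha> r + \<beta> r choose \<alpha> r) * d * K else 0) (mon (?\<delta>, ?w))"
    unfolding R1 R2 using P by (auto simp: sc_add(2)[symmetric] ring_distribs)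
  have Lh: "D r (mon (\<alpha>, u) \<odot> mon (\<beta>, v)) = sc (of_nat (\<alpha> r + \<beta> r choose \<alpha> r) * d * K) (D r (mon (?\<gamma>, ?w)))"
    using a b True by (simp add: mul_mon D_sc d0 K_def)
  show ?thesis
  proof (cases "(?\<gamma>, ?w) \<in> B")
    case True
    then show ?thesis unfolding R Lh using r by (auto simp: D_mon_E pointwise)
  next
    case F: False
    have "sc (if \<alpha> r + \<beta> r > 0 then of_nat (\<alpha> r + \<beta> r choose \<alpha> r) * d * K else 0) (mon (?\<delta>, ?w)) = 0"
    proof (cases "(?\<delta>, ?w) \<in> B \<and> \<alpha> r + \<beta> r > 0")
      case True
      have g: "?\<gamma> i \<le> (if i \<in> E then pi i else 0)" if "i \<noteq> r" for i
        using True that unfolding in_B by (metis fun_upd_other)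
      have g2: "?\<gamma> r - 1 \<le> pi r" using True r unfolding in_B by (metis fun_upd_same)
      have "\<not> ?\<gamma> r \<le> pi r"
      proof
        assume "?\<gamma> r \<le> pi r"
        then have "(?\<gamma>, ?w) \<in> B" unfolding in_B using g r w by metis
        with F show False by simp
      qed
      moreover have "p ^ t r > 0" by simp
      ultimately have q: "\<alpha> r + \<beta> r = p ^ t r" using g2 unfolding pointwise by linarith
      have "\<alpha> r \<le> pi r" "\<beta> r \<le> pi r" using a b r by (auto simp: in_B dest: spec[of _ r])
      then have "0 < \<alpha> r" "\<alpha> r < p ^ t r" using q \<open>p ^ t r > 0\<close> by linarith+
      then have "(of_nat (\<alpha> r + \<beta> r choose \<alpha> r) :: 'a) = 0"
        unfolding q by (rule of_nat_choose_prime_power)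
      then show ?thesis by simp
    next
      case False then show ?thesis by auto
    qed
    with F show ?thesis unfolding R Lh by simp
  qed
qed

text \<open>If \<open>r\<close> lies in at most one of \<open>u\<close> and \<open>v\<close>, the
  sign counts agree. If it lies in both, the product is zero and the terms on the right either
  vanish or have opposite signs.\<close>

lemma superder_mon_O:
  assumes r: "r \<in> Od" and a: "(\<alpha>, u) \<in> B" and b: "(\<beta>, v) \<in> B"
  shows "D r (mon (\<alpha>, u) \<odot> mon (\<beta>, v)) =
    D r (mon (\<alpha>, u)) \<odot> mon (\<beta>, v) + sc ((- 1) ^ card u) (mon (\<alpha>, u) \<odot> D r (mon (\<beta>, v)))"
proof -
  have uv: "u \<subseteq> Od" "v \<subseteq> Od" "u \<union> v \<subseteq> Od" and f: "finite u" "finite v" using a b by (auto simp: in_B B_finite)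
  have au: "(\<alpha>, u - {r}) \<in> B" and bv: "(\<beta>, v - {r}) \<in> B" using a b by (auto simp: in_B)
  note D = D_mon_O[OF r uv(1)] D_mon_O[OF r uv(2)] D_mon_O[OF r uv(3)]
  have sp: "ninv u v = ninv (u - {r}) v + nlt r v" if "r \<in> u"
    using ninv_Un_left[of "{r}" "u - {r}" v] f that by (simp add: ninv_single_left insert_absorb)
  have sp2: "ninv u' v = ninv u' (v - {r}) + ngt r u'" if "r \<in> v" "finite u'" for u'
    using ninv_Un_right[of "{r}" "v - {r}" u'] f that by (simp add: ninv_single_right insert_absorb)
  have two: "x + 2 * y = z \<Longrightarrow> (- 1 :: 'a) ^ x = (- 1) ^ z" for x y z :: nat
    by (auto simp: power_add power_mult)
  consider "r \<notin> u" "r \<notin> v" | "r \<in> u" "r \<notin> v" | "r \<notin> u" "r \<in> v" | "r \<in> u" "r \<in> v" by blast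
  then show ?thesis
  proof cases
    case 1
    then show ?thesis using a b D by (simp add: mul_mon D_sc)
  next
    case 2
    have i: "(u - {r}) \<inter> v = {} \<longleftrightarrow> u \<inter> v = {}" and un: "u - {r} \<union> v = u \<union> v - {r}" using 2 by auto
    have s: "osign u v * (- 1) ^ nlt r (u \<union> v) = ((- 1) ^ nlt r u * osign (u - {r}) v :: 'a)" if "u \<inter> v = {}"
      unfolding osign_ninv power_add[symmetric]
      using two[of "nlt r u + ninv (u - {r}) v" "nlt r v" "ninv u v + nlt r (u \<union> v)"] sp[OF 2(1)] nlt_Un[OF f that, of r]
      by simp
    show ?thesis using 2 a b D au i un s by (simp add: mul_mon D_sc mul_sc mult.assoc) (simp add: mult.left_commute)
  next
    case 3
    have i: "u \<inter> (v - {r}) = {} \<longleftrightarrow> u \<inter> v = {}" and un: "u \<union> (v - {r}) = u \<union> v - {r}" using 3 by auto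
    have s: "osign u v * (- 1) ^ nlt r (u \<union> v) = ((- 1) ^ card u * ((- 1) ^ nlt r v * osign u (v - {r})) :: 'a)" if "u \<inter> v = {}"
      unfolding osign_ninv power_add[symmetric]
      using sp2[OF 3(2) f(1)] nlt_Un[OF f that, of r] nlt_ngt_notin[OF f(1) 3(1)]
      by (intro arg_cong[of _ _ "power (- 1)"]) simp
    show ?thesis using 3 a b D bv i un s by (simp add: mul_mon D_sc mul_sc mult.assoc) (simp add: mult.left_commute)
  next
    case 4
    then have n0: "u \<inter> v \<noteq> {}" by auto
    have i: "(u - {r}) \<inter> v = {} \<longleftrightarrow> u \<inter> v = {r}" "u \<inter> (v - {r}) = {} \<longleftrightarrow> u \<inter> v = {r}" using 4 by auto
    have un: "u - {r} \<union> v = u \<union> v" "u \<union> (v - {r}) = u \<union> v" using 4 by auto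
    define I where "I = ninv (u - {r}) (v - {r})"
    have n1: "ninv (u - {r}) v = I + ngt r (u - {r})" using sp2[OF 4(2), of "u - {r}"] f by (simp add: I_def)
    have n2: "ninv u (v - {r}) = I + nlt r (v - {r})"
      using ninv_Un_left[of "{r}" "u - {r}" "v - {r}"] f 4 by (simp add: ninv_single_left insert_absorb I_def)
    have g: "ngt r (u - {r}) = ngt r u" unfolding ngt_def by (rule arg_cong[of _ _ card]) auto
    have s: "((- 1) ^ nlt r u * osign (u - {r}) v :: 'a) = - ((- 1) ^ card u * ((- 1) ^ nlt r v * osign u (v - {r})))"
    proof -
      have "card u + (nlt r v + ninv u (v - {r})) = Suc (nlt r u + ninv (u - {r}) v + 2 * nlt r v)"
        using n1 n2 g nlt_Diff_same[of r v] nlt_ngt[OF f(1) 4(1)] by simp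
      then have "(- 1 :: 'a) ^ (card u + (nlt r v + ninv u (v - {r}))) = (- 1) ^ Suc (nlt r u + ninv (u - {r}) v + 2 * nlt r v)"
        by (simp only:)
      then show ?thesis unfolding osign_ninv power_add[symmetric] by (simp add: power_add power_mult)
    qed
    have s': "(- 1) ^ nlt r u * (dpcoef m \<alpha> \<beta> * osign (u - {r}) v) = - ((- 1) ^ card u * ((- 1) ^ nlt r v * (dpcoef m \<alpha> \<beta> * osign u (v - {r}))) :: 'a)"
      using arg_cong[OF s, of "\<lambda>z. dpcoef m \<alpha> \<beta> * z"] by (simp add: mult.left_commute)
    show ?thesis using 4 a b D au bv i un n0 s' by (simp add: mul_mon D_sc mul_sc mult.assoc sc_minus)
  qed
qed

lemma superder:
  assumes r: "r \<in> Y" and f: "f \<in> A" and g: "g \<in> A"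
  shows "D r (f \<odot> g) = D r f \<odot> g + sg r f \<odot> D r g"
proof (rule A_induct[where P = "\<lambda>f. D r (f \<odot> g) = D r f \<odot> g + sg r f \<odot> D r g", OF f])
  fix a assume a: "a \<in> B"
  show "D r (mon a \<odot> g) = D r (mon a) \<odot> g + sg r (mon a) \<odot> D r g"
  proof (rule A_induct[where P = "\<lambda>g. D r (mon a \<odot> g) = D r (mon a) \<odot> g + sg r (mon a) \<odot> D r g", OF g])
    fix b assume "b \<in> B"
    then show "D r (mon a \<odot> mon b) = D r (mon a) \<odot> mon b + sg r (mon a) \<odot> D r (mon b)"
      using a r superder_mon_E[of r "fst a" "snd a" "fst b" "snd b"]
        superder_mon_O[of r "fst a" "snd a" "fst b" "snd b"]
      by (auto simp: Y_iff sg_mon mul_sc E_Od)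
  qed (simp_all add: mul_add mul_sc sg_add sg_sc D_add D_sc sc_add(1) algebra_simps)
qed (simp_all add: mul_add mul_sc sg_add sg_sc D_add D_sc sc_add(1) algebra_simps)

lemma nlt_insert: "finite u \<Longrightarrow> r \<notin> u \<Longrightarrow> nlt s (insert r u) = nlt s u + (if r < s then 1 else 0)"
proof -
  assume a: "finite u" "r \<notin> u"
  have "{j \<in> insert r u. j < s} = (if r < s then insert r {j \<in> u. j < s} else {j \<in> u. j < s})" by auto
  then show ?thesis using a by (simp add: nlt_def)
qed

lemma D_comm:
  assumes r: "r \<in> Y" and s: "s \<in> Y" and f: "f \<in> A"
  shows "D r (D s f) = (if r \<in> Od \<and> s \<in> Od then - D s (D r f) else D s (D r f))"
proof
  fix b :: "(nat \<Rightarrow> nat) \<times> nat set"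
  obtain \<alpha> u where b: "b = (\<alpha>, u)" by (cases b)
  show "D r (D s f) b = (if r \<in> Od \<and> s \<in> Od then - D s (D r f) else D s (D r f)) b"
  proof (cases "r \<in> Od \<and> s \<in> Od")
    case False
    then show ?thesis unfolding b using r s f E_Od
      by (auto simp: Y_iff D_E_apply D_O_apply fun_upd_twist)
  next
    case True
    show ?thesis
    proof (cases "u \<subseteq> Od \<and> r \<notin> u \<and> s \<notin> u \<and> r \<noteq> s")
      case False
      have "\<not> u \<subseteq> Od \<Longrightarrow> f (\<alpha>, insert r (insert s u)) = 0" using f unfolding Acar_def by (auto simp: in_B)
      then show ?thesis unfolding b using False True f
        by (cases "u \<subseteq> Od") (auto simp: D_O_apply insert_commute pointwise)
    next
      case t: True
      then have "finite u" using finite_Od_sub by blast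
      then show ?thesis unfolding b using True f t
        by (auto simp: D_O_apply nlt_insert insert_commute pointwise)
    qed
  qed
qed

section \<open>The Lie algebra\<close>

abbreviation L :: "'a welem set" where "L \<equiv> Weven p m n t"
abbreviation br :: "'a welem \<Rightarrow> 'a welem \<Rightarrow> 'a welem" where "br \<equiv> brW p m n t"

text \<open>The action of \<open>X\<close> as a differential operator on the superalgebra. Through
  it the bracket of even elements becomes a commutator, coordinate by coordinate
  (\<open>br_eq\<close>), and the Jacobi identity a fact about operators.\<close>

definition act :: "'a welem \<Rightarrow> (((nat \<Rightarrow> nat) \<times> nat set) \<Rightarrow> 'a) \<Rightarrow> (((nat \<Rightarrow> nat) \<times> nat set) \<Rightarrow> 'a)" where
  "act X g = (\<Sum>r\<in>Y. X r \<odot> D r g)"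

lemma L_iff: "X \<in> L \<longleftrightarrow> (\<forall>r. r \<notin> Y \<longrightarrow> X r = 0) \<and> (\<forall>r. par (tau m n r) (X r))"
  unfolding Weven_def Wcar_def par_def by auto

lemma L_par: "X \<in> L \<Longrightarrow> par (tau m n r) (X r)" and L_A [simp]: "X \<in> L \<Longrightarrow> X r \<in> A"
  and L_out: "X \<in> L \<Longrightarrow> r \<notin> Y \<Longrightarrow> X r = 0"
  unfolding L_iff par_def by auto

lemma act_add: "act X (f + g) = act X f + act X g" "act (X + X') g = act X g + act X' g"
  unfolding act_def by (simp_all add: D_add mul_add sum.distrib pointwise)
lemma act_sc: "act X (sc c f) = sc c (act X f)" "act (wsmul c X) g = sc c (act X g)"
proof -
  have "wsmul c X r = sc c (X r)" for r by (simp add: wsmul_def fun_eq_iff pointwise)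
  then show "act X (sc c f) = sc c (act X f)" "act (wsmul c X) g = sc c (act X g)"
    unfolding act_def by (simp_all add: D_sc mul_sc sc_sum)
qed
lemma act_0 [simp]: "act X 0 = 0" "act 0 g = 0"
  unfolding act_def by (simp_all add: pointwise)
lemma act_diff: "act X (f - g) = act X f - act X g" "act (X - X') g = act X g - act X' g"
  unfolding act_def by (simp_all add: D_diff mul_diff sum_subtractf pointwise)
lemma act_sum: "act X (sum f I) = (\<Sum>i\<in>I. act X (f i))"
  using sum_comp_morphism[of "act X" f I] by (simp add: act_add comp_def)

lemma br_eq:
  assumes "X \<in> L" "Z \<in> L"
  shows "br X Z s = act X (Z s) - act Z (X s)"
proof (cases "s \<in> Y")
  case True then show ?thesis unfolding brW_def act_def by (simp add: sum_subtractf)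
next
  case False
  then have "X s = 0" "Z s = 0" using assms by (simp_all add: L_out)
  then show ?thesis using False unfolding brW_def by simp
qed

lemma par_add: "par e f \<Longrightarrow> par e g \<Longrightarrow> par e (f + g)"
  and par_diff: "par e f \<Longrightarrow> par e g \<Longrightarrow> par e (f - g)"
  and par_sc: "par e f \<Longrightarrow> par e (sc c f)"
  and par_0: "par e 0"
  unfolding par_def by (simp_all add: pointwise)

lemma par_sum: "(\<And>i. i \<in> I \<Longrightarrow> par e (f i)) \<Longrightarrow> par e (sum f I)"
  by (induction I rule: infinite_finite_induct) (simp_all add: par_add par_0)

lemma mul_par:
  assumes f: "par e f" and g: "par e' g"
  shows "par (e + e') (f \<odot> g)"
  unfolding par_def
proof (intro conjI allI impI)
  fix b :: "(nat \<Rightarrow> nat) \<times> nat set" assume o: "odd (card (snd b) + (e + e'))"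
  obtain \<gamma> w where b: "b = (\<gamma>, w)" by (cases b)
  have "f x * g y = 0" if "x \<in> B" "y \<in> B" "snd x \<union> snd y = w" "snd x \<inter> snd y = {}" for x y
  proof -
    have "finite (snd x)" "finite (snd y)" using that B_finite by (metis prod.collapse)+
    then have "card w = card (snd x) + card (snd y)" using that card_Un_disjoint by blast
    then have "odd (card (snd x) + e) \<or> odd (card (snd y) + e')" using o b by auto
    then have "f x = 0 \<or> g y = 0" using f g unfolding par_def by blast
    then show ?thesis by auto
  qed
  then have "(\<Sum>(x, y)\<in>{(x, y). x \<in> B \<and> y \<in> B \<and> fst x + fst y = \<gamma> \<and> snd x \<union> snd y = w \<and> snd x \<inter> snd y = {}}.
          f x * g y * dpcoef m (fst x) (fst y) * osign (snd x) (snd y)) = 0"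
    by (intro sum.neutral) auto
  then show "(f \<odot> g) b = 0" unfolding amul_def b by auto
qed simp

lemma par_D:
  assumes "par e f" "r \<in> Y" shows "par (e + tau m n r) (D r f)"
  unfolding par_def
proof (intro conjI allI impI)
  fix b :: "(nat \<Rightarrow> nat) \<times> nat set" assume o: "odd (card (snd b) + (e + tau m n r))"
  obtain \<alpha> u where b: "b = (\<alpha>, u)" by (cases b)
  have fA: "f \<in> A" using assms by (simp add: par_def)
  show "D r f b = 0"
  proof (cases "r \<in> E")
    case True
    then show ?thesis using o assms(1) fA E_Od(2)[OF True] unfolding b by (simp add: D_E_apply par_def tau_def)
  next
    case False
    then have r: "r \<in> Od" using assms(2) by (simp add: Y_iff)
    show ?thesis
    proof (cases "finite u \<and> r \<notin> u")
      case True
      then have "odd (card (insert r u) + e)" using o r unfolding b by (simp add: tau_def)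
      then show ?thesis using assms(1) r fA True unfolding b by (simp add: D_O_apply par_def)
    next
      case False
      then show ?thesis unfolding aD_def b using r E_Od(3)[OF r] B_finite by auto
    qed
  qed
qed simp

lemma par_even: "par (e + 2 * k) f \<longleftrightarrow> par e f"
  by (auto simp: par_def)

lemma par_act: "X \<in> L \<Longrightarrow> par e g \<Longrightarrow> par e (act X g)"
  unfolding act_def
proof (rule par_sum)
  fix r assume "X \<in> L" "par e g" "r \<in> Y"
  then have "par (tau m n r + (e + tau m n r)) (X r \<odot> D r g)" by (intro mul_par par_D L_par)
  then show "par e (X r \<odot> D r g)" using par_even[of e "tau m n r"] by (simp add: mult_2 add_ac)
qed

lemma br_L [simp]: "X \<in> L \<Longrightarrow> Z \<in> L \<Longrightarrow> br X Z \<in> L"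
  unfolding L_iff[of "br X Z"] by (simp add: br_eq L_out par_diff par_act L_par)

lemma L_add [simp]: "X \<in> L \<Longrightarrow> Z \<in> L \<Longrightarrow> X + Z \<in> L"
  and L_diff [simp]: "X \<in> L \<Longrightarrow> Z \<in> L \<Longrightarrow> X - Z \<in> L"
  and L_0 [simp]: "0 \<in> L"
  unfolding L_iff by (simp_all add: par_add par_diff par_0 pointwise)

lemma wsmul_sc: "wsmul c X r = sc c (X r)" by (simp add: wsmul_def fun_eq_iff pointwise)

lemma L_wsmul [simp]: "X \<in> L \<Longrightarrow> wsmul c X \<in> L"
  unfolding L_iff by (simp add: wsmul_sc par_sc)

lemma L_sum [simp]: "(\<And>i. i \<in> I \<Longrightarrow> f i \<in> L) \<Longrightarrow> sum f I \<in> L"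
  by (induction I rule: infinite_finite_induct) auto

text \<open>The twist of \<open>D r\<close> on a product is undone by moving \<open>g\<close> past
  \<open>X r\<close>, whose parity is that of \<open>D r\<close>. So even elements act by ordinary
  derivations.\<close>

lemma act_der:
  assumes X: "X \<in> L" and g: "g \<in> A" and h: "h \<in> A"
  shows "act X (g \<odot> h) = act X g \<odot> h + g \<odot> act X h"
proof -
  have "X r \<odot> D r (g \<odot> h) = X r \<odot> D r g \<odot> h + g \<odot> (X r \<odot> D r h)" if r: "r \<in> Y" for r
  proof -
    have "X r \<odot> D r (g \<odot> h) = X r \<odot> (D r g \<odot> h) + X r \<odot> (sg r g \<odot> D r h)"
      using superder[OF r g h] by (simp add: mul_add)
    also have "\<dots> = X r \<odot> D r g \<odot> h + X r \<odot> sg r g \<odot> D r h"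
      using X g h by (simp add: mul_assoc)
    also have "X r \<odot> sg r g = g \<odot> X r"
      using mul_par_comm[OF L_par[OF X], of "sg r g" r] g by simp
    finally have "X r \<odot> D r (g \<odot> h) = X r \<odot> D r g \<odot> h + g \<odot> X r \<odot> D r h" .
    then show ?thesis using X g h by (simp only: mul_assoc[OF _ L_A[OF X] D_A])
  qed
  then show ?thesis unfolding act_def by (simp add: sum.distrib mul_sum)
qed

lemma sg_par: "par (tau m n s) f \<Longrightarrow> sg r f = (if r \<in> Od \<and> s \<in> Od then - f else f)"
  by (rule ext) (auto simp: sg_def par_def tau_def minus_one_power_iff pointwise)

text \<open>The second-order terms cancel: exchanging the coefficients \<open>X r\<close> and
  \<open>Z s\<close> costs the same sign as exchanging \<open>D r\<close> and
  \<open>D s\<close>.\<close>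

lemma act_br:
  assumes X: "X \<in> L" and Z: "Z \<in> L" and g: "g \<in> A"
  shows "act (br X Z) g = act X (act Z g) - act Z (act X g)"
proof -
  have expand: "act U (act V g) = (\<Sum>s\<in>Y. act U (V s) \<odot> D s g) + (\<Sum>s\<in>Y. \<Sum>r\<in>Y. V s \<odot> (U r \<odot> D r (D s g)))"
    if "U \<in> L" "V \<in> L" for U V
  proof -
    have "act U (act V g) = (\<Sum>s\<in>Y. act U (V s \<odot> D s g))" unfolding act_def[of V] by (rule act_sum)
    also have "\<dots> = (\<Sum>s\<in>Y. act U (V s) \<odot> D s g + V s \<odot> act U (D s g))"
      using that by (simp add: act_der)
    also have "\<dots> = (\<Sum>s\<in>Y. act U (V s) \<odot> D s g) + (\<Sum>s\<in>Y. V s \<odot> act U (D s g))" by (simp add: sum.distrib)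
    finally show ?thesis unfolding act_def[of U "D _ g"] by (simp add: mul_sum)
  qed
  have sw: "Z s \<odot> (X r \<odot> D r (D s g)) = X r \<odot> (Z s \<odot> D s (D r g))" if "r \<in> Y" "s \<in> Y" for r s
  proof -
    have "Z s \<odot> (X r \<odot> D r (D s g)) = Z s \<odot> X r \<odot> D r (D s g)" using X Z by (simp add: mul_assoc)
    also have "Z s \<odot> X r = sg s (X r) \<odot> Z s" by (rule mul_par_comm) (use X Z in \<open>simp_all add: L_par\<close>)
    also have "\<dots> = (if s \<in> Od \<and> r \<in> Od then - (X r \<odot> Z s) else X r \<odot> Z s)"
      using sg_par[OF L_par[OF X], of s r] by (simp add: mul_minus)
    finally have q: "Z s \<odot> (X r \<odot> D r (D s g)) = (if s \<in> Od \<and> r \<in> Od then - (X r \<odot> Z s) else X r \<odot> Z s) \<odot> D r (D s g)" .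
    have "(if s \<in> Od \<and> r \<in> Od then - (X r \<odot> Z s) else X r \<odot> Z s) \<odot> D r (D s g) = X r \<odot> (Z s \<odot> D s (D r g))"
      unfolding D_comm[OF that g] using X Z by (simp add: mul_minus mul_assoc)
    with q show ?thesis by simp
  qed
  have "(\<Sum>s\<in>Y. \<Sum>r\<in>Y. Z s \<odot> (X r \<odot> D r (D s g))) = (\<Sum>s\<in>Y. \<Sum>r\<in>Y. X r \<odot> (Z s \<odot> D s (D r g)))"
    by (intro sum.cong refl sw)
  also have "\<dots> = (\<Sum>r\<in>Y. \<Sum>s\<in>Y. X r \<odot> (Z s \<odot> D s (D r g)))" by (rule sum.swap)
  finally have cr: "(\<Sum>s\<in>Y. \<Sum>r\<in>Y. Z s \<odot> (X r \<odot> D r (D s g))) = (\<Sum>s\<in>Y. \<Sum>r\<in>Y. X s \<odot> (Z r \<odot> D r (D s g)))" .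
  have "act (br X Z) g = (\<Sum>s\<in>Y. act X (Z s) \<odot> D s g) - (\<Sum>s\<in>Y. act Z (X s) \<odot> D s g)"
    unfolding act_def[of "br X Z"] using X Z by (simp add: br_eq mul_diff sum_subtractf)
  then show ?thesis unfolding expand[OF X Z] expand[OF Z X] cr by simp
qed

lemma br_jacobi:
  assumes "X \<in> L" "U \<in> L" "V \<in> L"
  shows "br X (br U V) = br (br X U) V + br U (br X V)"
  by (rule ext) (use assms in \<open>simp add: br_eq act_br act_diff pointwise\<close>)

lemma br_add: "X \<in> L \<Longrightarrow> U \<in> L \<Longrightarrow> V \<in> L \<Longrightarrow> br X (U + V) = br X U + br X V"
    "X \<in> L \<Longrightarrow> U \<in> L \<Longrightarrow> V \<in> L \<Longrightarrow> br (U + V) X = br U X + br V X"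
  by (simp_all add: fun_eq_iff[where 'a = nat] br_eq act_add pointwise)

lemma br_diff: "X \<in> L \<Longrightarrow> U \<in> L \<Longrightarrow> V \<in> L \<Longrightarrow> br X (U - V) = br X U - br X V"
    "X \<in> L \<Longrightarrow> U \<in> L \<Longrightarrow> V \<in> L \<Longrightarrow> br (U - V) X = br U X - br V X"
  by (simp_all add: fun_eq_iff[where 'a = nat] br_eq act_diff pointwise)

lemma br_wsmul: "X \<in> L \<Longrightarrow> U \<in> L \<Longrightarrow> br X (wsmul c U) = wsmul c (br X U)"
    "X \<in> L \<Longrightarrow> U \<in> L \<Longrightarrow> br (wsmul c U) X = wsmul c (br U X)"
  by (simp_all add: fun_eq_iff[where 'a = nat] br_eq act_sc wsmul_sc sc_diff)

lemma br_anti: "X \<in> L \<Longrightarrow> U \<in> L \<Longrightarrow> br X U = - br U X"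
  by (rule ext) (simp add: br_eq pointwise)

lemma br_0 [simp]: "X \<in> L \<Longrightarrow> br X 0 = 0" "X \<in> L \<Longrightarrow> br 0 X = 0"
  by (simp_all add: fun_eq_iff[where 'a = nat] br_eq pointwise)

section \<open>Basis vectors and their brackets\<close>

definition el :: "(((nat \<Rightarrow> nat) \<times> nat set) \<Rightarrow> 'a) \<Rightarrow> nat \<Rightarrow> 'a welem" where
  "el f r = (\<lambda>s. if s = r then f else 0)"

definition M :: "(nat \<Rightarrow> nat) \<Rightarrow> nat set \<Rightarrow> nat \<Rightarrow> 'a welem" where
  "M \<alpha> u r = el (mon (\<alpha>, u)) r"

text \<open>The triples for which \<open>M \<alpha> u r\<close>, that is
  \<open>x^(\<alpha>) x^u D_r\<close>, is a basis vector of the even part.\<close>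

definition vld :: "(nat \<Rightarrow> nat) \<Rightarrow> nat set \<Rightarrow> nat \<Rightarrow> bool" where
  "vld \<alpha> u r \<longleftrightarrow> (\<alpha>, u) \<in> B \<and> r \<in> Y \<and> even (card u + tau m n r)"

lemma el_same [simp]: "el f r r = f" and el_other [simp]: "s \<noteq> r \<Longrightarrow> el f r s = 0"
  by (simp_all add: el_def)

lemma el_add: "el (f + g) r = el f r + el g r"
  and el_sc: "el (sc c f) r = wsmul c (el f r)"
  and el_0 [simp]: "el 0 r = 0"
  and el_diff: "el (f - g) r = el f r - el g r"
  and el_minus: "el (- f) r = - el f r"
  by (auto simp: el_def fun_eq_iff wsmul_sc pointwise)

lemma el_L: "r \<in> Y \<Longrightarrow> par (tau m n r) f \<Longrightarrow> el f r \<in> L"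
  unfolding L_iff by (auto simp: el_def par_0)

lemma mon_par: "even (card u + e) \<Longrightarrow> par e (mon (\<alpha>, u))"
  by (simp add: par_def) (auto simp: mon_def)

lemma nlt_single [simp]: "nlt r {a} = (if a < r then 1 else 0)"
proof -
  have "{j \<in> {a}. j < r} = (if a < r then {a} else {})" by auto
  then show ?thesis by (simp add: nlt_def)
qed

lemma mon_app: "mon b c = (if c = b \<and> b \<in> B then 1 else 0)"
  by (simp add: mon_def)

lemma M_L [simp]: "vld \<alpha> u r \<Longrightarrow> M \<alpha> u r \<in> L"
  unfolding M_def vld_def by (intro el_L mon_par) auto

lemma M_L2: "r \<in> Y \<Longrightarrow> even (card u + tau m n r) \<Longrightarrow> M \<alpha> u r \<in> L"
  unfolding M_def vld_def by (intro el_L mon_par) auto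

lemma L_decomp: "X \<in> L \<Longrightarrow> X = (\<Sum>r\<in>Y. el (X r) r)"
proof
  fix s assume X: "X \<in> L"
  have "(\<Sum>r\<in>Y. el (X r) r) s = (\<Sum>r\<in>Y. if r = s then X r else 0)"
    unfolding sum_apply'[where x = s] by (rule sum.cong) (auto simp: el_def)
  also have "\<dots> = (if s \<in> Y then X s else 0)" by simp
  finally show "X s = (\<Sum>r\<in>Y. el (X r) r) s" using X by (simp add: L_out)
qed

text \<open>The monomial case supplies a nonzero coefficient, so that for an element concentrated in
  one \<open>D_r\<close> only monomials with this \<open>r\<close> have to be treated.\<close>

lemma L_induct:
  assumes X: "X \<in> L" and z: "P 0" and M: "\<And>\<alpha> u r. vld \<alpha> u r \<Longrightarrow> X r (\<alpha>, u) \<noteq> 0 \<Longrightarrow> P (M \<alpha> u r)"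
    and add: "\<And>U V. U \<in> L \<Longrightarrow> V \<in> L \<Longrightarrow> P U \<Longrightarrow> P V \<Longrightarrow> P (U + V)"
    and sc: "\<And>c U. U \<in> L \<Longrightarrow> P U \<Longrightarrow> P (wsmul c U)"
  shows "P X"
proof -
  have 1: "el (X r) r \<in> L \<and> P (el (X r) r)" if r: "r \<in> Y" for r
  proof (rule A_induct_on[where P = "\<lambda>f. el f r \<in> L \<and> P (el f r)" and
        S = "{b. even (card (snd b) + tau m n r) \<and> X r b \<noteq> 0}" and f = "X r"])
    show "X r \<in> A" using X by simp
    fix b assume "X r b \<noteq> 0" then show "b \<in> {b. even (card (snd b) + tau m n r) \<and> X r b \<noteq> 0}"
      using L_par[OF X, of r] unfolding par_def by blast
  next
    show "el 0 r \<in> L \<and> P (el 0 r)" unfolding el_0 using z L_0 by blast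
  next
    fix b assume b: "b \<in> {b. even (card (snd b) + tau m n r) \<and> X r b \<noteq> 0}" "b \<in> B"
    then have "vld (fst b) (snd b) r" "X r (fst b, snd b) \<noteq> 0" using r by (simp_all add: vld_def)
    then show "el (mon b) r \<in> L \<and> P (el (mon b) r)" using M[of "fst b" "snd b" r] M_L[of "fst b" "snd b" r]
      unfolding M_def by simp
  next
    fix f g assume "f \<in> A" "g \<in> A" "el f r \<in> L \<and> P (el f r)" "el g r \<in> L \<and> P (el g r)"
    then show "el (f + g) r \<in> L \<and> P (el (f + g) r)" unfolding el_add using add L_add by blast
  next
    fix c f assume "f \<in> A" "el f r \<in> L \<and> P (el f r)"
    then show "el (sc c f) r \<in> L \<and> P (el (sc c f) r)" unfolding el_sc using sc L_wsmul by blast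
  qed
  have "C \<subseteq> Y \<longrightarrow> sum (\<lambda>r. el (X r) r) C \<in> L \<and> P (sum (\<lambda>r. el (X r) r) C)" if "finite C" for C
  proof (rule finite_induct[where P = "\<lambda>C. C \<subseteq> Y \<longrightarrow> sum (\<lambda>r. el (X r) r) C \<in> L \<and> P (sum (\<lambda>r. el (X r) r) C)", OF that])
    show "{} \<subseteq> Y \<longrightarrow> sum (\<lambda>r. el (X r) r) {} \<in> L \<and> P (sum (\<lambda>r. el (X r) r) {})"
      unfolding sum.empty using z L_0 by blast
    fix r C assume C: "finite C" "r \<notin> C" "C \<subseteq> Y \<longrightarrow> sum (\<lambda>r. el (X r) r) C \<in> L \<and> P (sum (\<lambda>r. el (X r) r) C)"
    show "insert r C \<subseteq> Y \<longrightarrow> sum (\<lambda>r. el (X r) r) (insert r C) \<in> L \<and> P (sum (\<lambda>r. el (X r) r) (insert r C))"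
      unfolding sum.insert[OF C(1,2)] using C(3) 1[of r] add[of "el (X r) r"] L_add[of "el (X r) r"] by blast
  qed
  from this[of Y] L_decomp[OF X] show ?thesis by simp
qed

lemma act_el: "r \<in> Y \<Longrightarrow> act (el f r) g = f \<odot> D r g"
proof -
  assume r: "r \<in> Y"
  have "act (el f r) g = (\<Sum>s\<in>Y. if s = r then f \<odot> D s g else 0)"
    unfolding act_def by (rule sum.cong) (auto simp: el_def)
  then show ?thesis using r by simp
qed

lemma br_el_left: "r \<in> Y \<Longrightarrow> el f r \<in> L \<Longrightarrow> Z \<in> L \<Longrightarrow>
    br (el f r) Z s = f \<odot> D r (Z s) - (if s = r then act Z f else 0)"
  by (simp add: br_eq act_el)

lemma br_el: "r \<in> Y \<Longrightarrow> s \<in> Y \<Longrightarrow> el f r \<in> L \<Longrightarrow> el g s \<in> L \<Longrightarrow>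
    br (el f r) (el g s) = el (f \<odot> D r g) s - el (g \<odot> D s f) r"
proof
  fix q assume a: "r \<in> Y" "s \<in> Y" "el f r \<in> L" "el g s \<in> L"
  show "br (el f r) (el g s) q = (el (f \<odot> D r g) s - el (g \<odot> D s f) r) q"
    using a by (cases "q = s"; cases "q = r") (simp_all add: br_eq act_el pointwise)
qed

lemma br_M: "vld \<alpha> u r \<Longrightarrow> vld \<beta> v s \<Longrightarrow>
    br (M \<alpha> u r) (M \<beta> v s) = el (mon (\<alpha>, u) \<odot> D r (mon (\<beta>, v))) s - el (mon (\<beta>, v) \<odot> D s (mon (\<alpha>, u))) r"
  using M_L[of \<alpha> u r] M_L[of \<beta> v s] unfolding M_def vld_def by (intro br_el) auto

lemma zr_B: "(zr, u) \<in> B \<longleftrightarrow> u \<subseteq> Od" by (auto simp: in_B)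

lemma sn_B: "j \<in> E \<Longrightarrow> (sn j k, u) \<in> B \<longleftrightarrow> k \<le> pi j \<and> u \<subseteq> Od"
  by (auto simp: in_B sn_def dest: spec[of _ j])

lemma pi_ge: "i \<in> E \<Longrightarrow> pi i \<ge> 3"
proof -
  assume "i \<in> E"
  then have "t i \<ge> 1" using t_ge by (simp add: Y0_def)
  then have "p ^ 1 \<le> p ^ t i" using p_gt by (intro power_increasing) auto
  then show ?thesis using p_gt by simp
qed

lemma sn1_B: "j \<in> E \<Longrightarrow> (sn j (Suc 0), u) \<in> B \<longleftrightarrow> u \<subseteq> Od"
  using sn_B[of j 1] pi_ge[of j] by simp

lemma dpcoef_zr [simp]: "dpcoef m zr \<beta> = (1::'a)" "dpcoef m \<beta> zr = (1::'a)"
  by (simp_all add: dpcoef_def)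

lemma dpcoef_sn: "j \<in> E \<Longrightarrow> dpcoef m (sn j k) \<beta> = (of_nat (\<beta> j + k choose k) :: 'a)"
proof -
  assume j: "j \<in> E"
  have "(\<Prod>i\<in>E - {j}. of_nat (sn j k i + \<beta> i choose sn j k i) :: 'a) = 1"
    by (rule prod.neutral) auto
  then show ?thesis using dpcoef_split[OF j, of "sn j k" \<beta>] by (simp add: add.commute)
qed

lemma osign_empty [simp]: "osign {} v = (1::'a)" "osign v {} = (1::'a)"
  by (simp_all add: osign_ninv)

lemma one_mul: "f \<in> A \<Longrightarrow> mon (zr, {}) \<odot> f = f"
proof (rule A_induct[where P = "\<lambda>f. mon (zr, {}) \<odot> f = f" and f = f])
  fix b assume "b \<in> B"
  then show "mon (zr, {}) \<odot> mon b = mon b" by (cases b) (simp add: mul_mon zr_B)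
qed (simp_all add: mul_add mul_sc)

lemma mul_one: "f \<in> A \<Longrightarrow> f \<odot> mon (zr, {}) = f"
proof (rule A_induct[where P = "\<lambda>f. f \<odot> mon (zr, {}) = f" and f = f])
  fix b assume "b \<in> B"
  then show "mon b \<odot> mon (zr, {}) = mon b" by (cases b) (simp add: mul_mon zr_B)
qed (simp_all add: mul_add mul_sc)

lemma D_one [simp]: "r \<in> Y \<Longrightarrow> D r (mon (zr, {})) = 0"
  by (auto simp: Y_iff D_mon_E D_mon_O zr_B)

lemma D_sn: "j \<in> E \<Longrightarrow> r \<in> Y \<Longrightarrow> D r (mon (sn j (Suc 0), {})) = (if r = j then mon (zr, {}) else 0)"
  by (auto simp: Y_iff D_mon_E D_mon_O sn1_B E_Od sn_pos)

lemma D_odd: "a \<in> Od \<Longrightarrow> r \<in> Y \<Longrightarrow> D r (mon (zr, {a})) = (if r = a then mon (zr, {}) else 0)"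
  by (auto simp: Y_iff D_mon_E D_mon_O zr_B E_Od)

lemma act_sn: "Z \<in> L \<Longrightarrow> j \<in> E \<Longrightarrow> act Z (mon (sn j (Suc 0), {})) = Z j"
proof -
  assume Z: "Z \<in> L" and j: "j \<in> E"
  have "act Z (mon (sn j (Suc 0), {})) = (\<Sum>r\<in>Y. if r = j then Z r else 0)"
    unfolding act_def by (rule sum.cong) (use Z j in \<open>simp_all add: D_sn mul_one\<close>)
  then show ?thesis using j by (simp add: Y_iff)
qed

lemma act_odd: "Z \<in> L \<Longrightarrow> a \<in> Od \<Longrightarrow> act Z (mon (zr, {a})) = Z a"
proof -
  assume Z: "Z \<in> L" and j: "a \<in> Od"
  have "act Z (mon (zr, {a})) = (\<Sum>r\<in>Y. if r = a then Z r else 0)"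
    unfolding act_def by (rule sum.cong) (use Z j in \<open>simp_all add: D_odd mul_one\<close>)
  then show ?thesis using j by (simp add: Y_iff)
qed

lemma act_one: "act Z (mon (zr, {})) = 0"
  unfolding act_def by (simp)

lemma B_raise: "i \<in> E \<Longrightarrow> (\<beta>, v) \<in> B \<Longrightarrow> (\<beta>(i := Suc (\<beta> i)), v) \<in> B \<longleftrightarrow> \<beta> i < pi i"
proof
  assume i: "i \<in> E" and b: "(\<beta>, v) \<in> B"
  show "(\<beta>(i := Suc (\<beta> i)), v) \<in> B \<Longrightarrow> \<beta> i < pi i"
  proof -
    assume "(\<beta>(i := Suc (\<beta> i)), v) \<in> B"
    then have "(\<beta>(i := Suc (\<beta> i))) i \<le> (if i \<in> E then pi i else 0)" unfolding in_B by blast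
    then show ?thesis using i by simp
  qed
  show "(\<beta>(i := Suc (\<beta> i)), v) \<in> B" if lt: "\<beta> i < pi i"
    unfolding in_B
  proof (intro conjI allI)
    fix k show "(\<beta>(i := Suc (\<beta> i))) k \<le> (if k \<in> E then pi k else 0)"
    proof (cases "k = i")
      case True then show ?thesis using i lt by simp
    next
      case False
      then show ?thesis using b[unfolded in_B] by simp
    qed
  qed (use b in \<open>simp add: in_B\<close>)
qed

text \<open>In divided powers \<open>x_j\<close> times \<open>x^(\<beta> - \<epsilon>_j)\<close> is
  \<open>\<beta> j\<close> times \<open>x^(\<beta>)\<close>. For \<open>\<beta> j = 0\<close> the
  truncated \<open>\<beta> j - 1\<close> is harmless, because the factor in front is zero.\<close>

lemma sn_mul_apply:
  assumes j: "j \<in> E" and f: "f \<in> A"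
  shows "(mon (sn j (Suc 0), {}) \<odot> f) (\<beta>, v) =
    (if (\<beta>, v) \<in> B then of_nat (\<beta> j) * f (\<beta>(j := \<beta> j - 1), v) else 0)"
proof (rule A_induct[where P = "\<lambda>f. (mon (sn j (Suc 0), {}) \<odot> f) (\<beta>, v) =
    (if (\<beta>, v) \<in> B then of_nat (\<beta> j) * f (\<beta>(j := \<beta> j - 1), v) else 0)", OF f])
  fix b assume b: "b \<in> B"
  obtain \<gamma> w where e: "b = (\<gamma>, w)" by (cases b)
  have "(mon (sn j (Suc 0), {}) \<odot> mon b) (\<beta>, v) = of_nat (Suc (\<gamma> j)) * mon (\<gamma>(j := Suc (\<gamma> j)), w) (\<beta>, v)"
    using b j unfolding e by (simp add: mul_mon sn1_B dpcoef_sn sn_add pointwise)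
  also have "\<dots> = (if (\<beta>, v) \<in> B then of_nat (\<beta> j) * mon (\<gamma>, w) (\<beta>(j := \<beta> j - 1), v) else 0)"
  proof (cases "\<beta> j > 0")
    case True
    have "\<beta> = \<gamma>(j := Suc (\<gamma> j)) \<longleftrightarrow> \<beta>(j := \<beta> j - 1) = \<gamma>"
      using True by (metis Suc_pred' diff_Suc_1 fun_upd_same fun_upd_triv fun_upd_upd)
    moreover have "\<beta>(j := \<beta> j - 1) = \<gamma> \<Longrightarrow> Suc (\<gamma> j) = \<beta> j" using True by auto
    ultimately show ?thesis using b unfolding e by (auto simp: mon_def)
  next
    case False
    then have "\<beta> \<noteq> \<gamma>(j := Suc (\<gamma> j))" by auto
    then show ?thesis using False by (auto simp: mon_def)
  qed
  finally show "(mon (sn j (Suc 0), {}) \<odot> mon b) (\<beta>, v) =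
      (if (\<beta>, v) \<in> B then of_nat (\<beta> j) * mon b (\<beta>(j := \<beta> j - 1), v) else 0)" by (simp add: e)
qed (simp_all add: mul_add mul_sc pointwise algebra_simps)

lemma odd_mul_apply:
  assumes j: "a \<in> Od" and f: "f \<in> A"
  shows "(mon (zr, {a}) \<odot> f) (\<beta>, v) = (if a \<in> v then (- 1) ^ nlt a v * f (\<beta>, v - {a}) else 0)"
proof (rule A_induct[where P = "\<lambda>f. (mon (zr, {a}) \<odot> f) (\<beta>, v) =
    (if a \<in> v then (- 1) ^ nlt a v * f (\<beta>, v - {a}) else 0)", OF f])
  fix b assume b: "b \<in> B"
  obtain \<gamma> w where e: "b = (\<gamma>, w)" by (cases b)
  have "(mon (zr, {a}) \<odot> mon b) (\<beta>, v) = (if a \<notin> w then (- 1) ^ nlt a w * mon (\<gamma>, insert a w) (\<beta>, v) else 0)"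
    using b j unfolding e by (simp add: mul_mon zr_B osign_ninv ninv_single_left pointwise)
  also have "\<dots> = (if a \<in> v then (- 1) ^ nlt a v * mon (\<gamma>, w) (\<beta>, v - {a}) else 0)"
  proof -
    have "(\<gamma>, insert a w) \<in> B" using b j unfolding e by (auto simp: in_B)
    moreover have "a \<notin> w \<and> v = insert a w \<longleftrightarrow> a \<in> v \<and> v - {a} = w" by auto
    ultimately have "(if a \<notin> w then (- 1) ^ nlt a w * mon (\<gamma>, insert a w) (\<beta>, v) else 0)
        = (if a \<in> v \<and> v - {a} = w \<and> \<beta> = \<gamma> then (- 1) ^ nlt a w else (0::'a))" by (auto simp: mon_app)
    also have "\<dots> = (if a \<in> v \<and> v - {a} = w \<and> \<beta> = \<gamma> then (- 1) ^ nlt a v else 0)"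
      using nlt_Diff_same[of a v] by auto
    also have "\<dots> = (if a \<in> v then (- 1) ^ nlt a v * mon (\<gamma>, w) (\<beta>, v - {a}) else 0)"
      using b unfolding e by (simp add: mon_app)
    finally show ?thesis .
  qed
  finally show "(mon (zr, {a}) \<odot> mon b) (\<beta>, v) = (if a \<in> v then (- 1) ^ nlt a v * mon b (\<beta>, v - {a}) else 0)"
    by (simp add: e)
qed (simp_all add: mul_add mul_sc pointwise algebra_simps)

section \<open>The torus, its weights, and coefficient formulas for brackets\<close>

definition T :: "nat \<Rightarrow> 'a welem" where
  "T q = (if q \<in> E then M (sn q (Suc 0)) {} q else M zr {q} q)"

abbreviation Dd :: "nat \<Rightarrow> 'a welem" where "Dd i \<equiv> M zr {} i"

text \<open>The eigenvalue of \<open>ad (T q)\<close> on \<open>x^(\<beta>) x^v D_s\<close>. Being a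
  field element, it knows even exponents only modulo \<open>p\<close>.\<close>

definition wt :: "nat \<Rightarrow> nat \<Rightarrow> (nat \<Rightarrow> nat) \<Rightarrow> nat set \<Rightarrow> 'a" where
  "wt q s \<beta> v = (if q \<in> E then of_nat (\<beta> q) else if q \<in> v then 1 else 0) - (if s = q then 1 else 0)"

lemma tau_E: "i \<in> E \<Longrightarrow> tau m n i = 0" and tau_O: "i \<in> Od \<Longrightarrow> tau m n i = Suc 0"
  by (auto simp: tau_def E_Od)

lemma vld_E: "i \<in> E \<Longrightarrow> vld \<alpha> u i \<longleftrightarrow> (\<alpha>, u) \<in> B \<and> even (card u)"
  by (simp add: vld_def Y_iff tau_E)
lemma vld_O: "i \<in> Od \<Longrightarrow> vld \<alpha> u i \<longleftrightarrow> (\<alpha>, u) \<in> B \<and> odd (card u)"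
  by (simp add: vld_def Y_iff tau_O)

lemma Y_E: "i \<in> E \<Longrightarrow> i \<in> Y" and Y_O: "i \<in> Od \<Longrightarrow> i \<in> Y" by (auto simp: Y_iff)

lemma T_L [simp]: "q \<in> Y \<Longrightarrow> T q \<in> L"
  by (auto simp: T_def Y_iff vld_E vld_O sn1_B zr_B)

lemma Dd_L [simp]: "i \<in> E \<Longrightarrow> Dd i \<in> L" by (simp add: vld_E zr_B)

lemma br_T:
  assumes q: "q \<in> Y" and Z: "Z \<in> L"
  shows "br (T q) Z s (\<beta>, v) = wt q s \<beta> v * Z s (\<beta>, v)"
proof (cases "(\<beta>, v) \<in> B")
  case B: True
  show ?thesis
  proof (cases "q \<in> E")
    case True
    have l: "el (mon (sn q (Suc 0), {})) q \<in> L" using T_L[OF q] True by (simp add: T_def M_def)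
    have "(mon (sn q (Suc 0), {}) \<odot> D q (Z s)) (\<beta>, v) = of_nat (\<beta> q) * Z s (\<beta>, v)"
      using True Z B by (cases "\<beta> q > 0") (simp_all add: sn_mul_apply D_E_apply)
    then show ?thesis using True Z
      by (simp add: T_def M_def br_el_left[OF q l] wt_def act_sn pointwise algebra_simps)
  next
    case False
    then have qO: "q \<in> Od" using q by (simp add: Y_iff)
    have l: "el (mon (zr, {q})) q \<in> L" using T_L[OF q] False by (simp add: T_def M_def)
    have "(mon (zr, {q}) \<odot> D q (Z s)) (\<beta>, v) = (if q \<in> v then 1 else 0) * Z s (\<beta>, v)"
      using qO Z by (simp add: odd_mul_apply D_O_apply nlt_Diff_same insert_absorb flip: power_add mult.assoc)
    then show ?thesis using False Z qO
      by (simp add: T_def M_def br_el_left[OF q l] wt_def act_odd pointwise algebra_simps)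
  qed
next
  case False
  have "br (T q) Z \<in> L" using q Z by simp
  then show ?thesis using A_out[OF L_A[of "br (T q) Z"] False] A_out[OF L_A[OF Z] False] by simp
qed

text \<open>\<open>ad D_i\<close> is a shift of coefficients. At the top exponent the right side is
  a coefficient off the basis, hence zero, as it should be.\<close>

lemma br_Dd:
  assumes i: "i \<in> E" and Z: "Z \<in> L"
  shows "br (Dd i) Z s (\<beta>, v) = Z s (\<beta>(i := Suc (\<beta> i)), v)"
proof -
  have l: "el (mon (zr, {})) i \<in> L" using Dd_L[OF i] by (simp add: M_def)
  show ?thesis using i Z
    by (simp add: M_def br_el_left[OF Y_E[OF i] l] act_one one_mul D_E_apply pointwise)
qed

lemma mul_const: "f \<in> A \<Longrightarrow> g \<in> A \<Longrightarrow> (f \<odot> g) (zr, {}) = f (zr, {}) * g (zr, {})"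
proof (rule A_induct[where P = "\<lambda>f. (f \<odot> g) (zr, {}) = f (zr, {}) * g (zr, {})" and f = f])
  fix a assume g: "g \<in> A" and a: "a \<in> B"
  show "(mon a \<odot> g) (zr, {}) = mon a (zr, {}) * g (zr, {})"
  proof (rule A_induct[where P = "\<lambda>g. (mon a \<odot> g) (zr, {}) = mon a (zr, {}) * g (zr, {})" and f = g, OF g])
    fix b assume b: "b \<in> B"
    obtain \<alpha> u \<beta> v where e: "a = (\<alpha>, u)" "b = (\<beta>, v)" by (cases a, cases b)
    have "\<alpha> + \<beta> = zr \<longleftrightarrow> \<alpha> = zr \<and> \<beta> = zr" by (auto simp: fun_eq_iff pointwise)
    then have n: "mon (\<alpha> + \<beta>, u \<union> v) (zr, {}) = 0" "mon a (zr, {}) * mon b (zr, {}) = 0"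
      if "\<not> (\<alpha> = zr \<and> \<beta> = zr \<and> u = {} \<and> v = {})"
      using that unfolding e mon_app by auto
    show "(mon a \<odot> mon b) (zr, {}) = mon a (zr, {}) * mon b (zr, {})"
    proof (cases "\<alpha> = zr \<and> \<beta> = zr \<and> u = {} \<and> v = {}")
      case True
      then have e': "a = (zr, {})" "b = (zr, {})" using e by auto
      show ?thesis unfolding e' by (simp add: one_mul) (simp add: mon_app)
    next
      case False
      show ?thesis unfolding n(2)[OF False] using a b n(1)[OF False] unfolding e by (simp add: mul_mon pointwise)
    qed
  qed (simp_all add: mul_add mul_sc pointwise algebra_simps)
qed (simp_all add: mul_add mul_sc pointwise algebra_simps)

text \<open>A constant term of a bracket involves only constant and linear coefficients. Odd
  \<open>r\<close> do not occur in the sum: the coefficient of \<open>D_r\<close> in an even element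
  is then odd and has no constant term.\<close>

lemma br_const:
  assumes X: "X \<in> L" and Z: "Z \<in> L"
  shows "br X Z s (zr, {}) =
    (\<Sum>r\<in>E. X r (zr, {}) * Z s (sn r 1, {}) - Z r (zr, {}) * X s (sn r 1, {}))"
proof -
  have a: "act U g (zr, {}) = (\<Sum>r\<in>E. U r (zr, {}) * g (sn r 1, {}))" if U: "U \<in> L" and g: "g \<in> A" for U g
  proof -
    have "act U g (zr, {}) = (\<Sum>r\<in>Y. U r (zr, {}) * D r g (zr, {}))"
      unfolding act_def sum_apply' using U by (simp add: mul_const)
    also have "\<dots> = (\<Sum>r\<in>E. U r (zr, {}) * D r g (zr, {}))"
    proof (rule sum.mono_neutral_right)
      show "\<forall>r\<in>Y - E. U r (zr, {}) * D r g (zr, {}) = 0"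
        using L_par[OF U] by (auto simp: Y_iff par_def tau_O)
    qed (auto simp: Yall_def)
    also have "\<dots> = (\<Sum>r\<in>E. U r (zr, {}) * g (sn r 1, {}))"
    proof (rule sum.cong)
      fix r assume "r \<in> E"
      moreover have "zr(r := Suc 0) = sn r 1" by (auto simp: sn_def)
      ultimately show "U r (zr, {}) * D r g (zr, {}) = U r (zr, {}) * g (sn r 1, {})" using g by (simp add: D_E_apply)
    qed simp
    finally show ?thesis .
  qed
  show ?thesis using X Z by (simp add: br_eq pointwise a sum_subtractf)
qed

lemma vld_y: "a \<in> Od \<Longrightarrow> b \<in> Od \<Longrightarrow> a \<noteq> b \<Longrightarrow> j \<in> E \<Longrightarrow> vld zr {a, b} j"
  by (simp add: vld_E zr_B)

text \<open>The last summand comes from \<open>Z(x_a x_b) = Z_a x_b + x_a Z_b\<close>. As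
  \<open>Z_a\<close> is odd, \<open>Z_a x_b = - x_b Z_a\<close>, and both coefficients enter with
  the same sign; this produces the pairwise sums needed for \<open>pair_zero\<close>.\<close>

lemma br_y:
  assumes ab: "a \<in> Od" "b \<in> Od" "a < b" and j: "j \<in> E" and Z: "Z \<in> L" and B: "(\<beta>, {a, b}) \<in> B"
  shows "br (M zr {a, b} j) Z s (\<beta>, {a, b}) =
    Z s (\<beta>(j := Suc (\<beta> j)), {}) - (if s = j then Z a (\<beta>, {a}) + Z b (\<beta>, {b}) else 0)"
proof -
  have l: "el (mon (zr, {a, b})) j \<in> L" using M_L[OF vld_y[of a b j]] ab j by (simp add: M_def)
  have pr: "mon (zr, {a, b}) = mon (zr, {a}) \<odot> mon (zr, {b})"
    using ab by (simp add: mul_mon zr_B osign_ninv ninv_single_left insert_commute)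
  have c0: "{ja. (ja = a \<or> ja = b) \<and> ja < a} = {}" using ab by auto
  have c1: "{ja. (ja = a \<or> ja = b) \<and> ja < b} = {a}" using ab by auto
  have n: "nlt a {a, b} = 0" "nlt b {a, b} = 1" "nlt b {b} = 0" using ab c0 c1 by (simp_all add: nlt_def)
  have d: "{a, b} - {a} = {b}" "{a, b} - {b} = {a}" using ab by auto
  have "(mon (zr, {a, b}) \<odot> D j (Z s)) (\<beta>, {a, b}) = D j (Z s) (\<beta>, {})"
    unfolding pr using ab Z by (simp add: mul_assoc odd_mul_apply n d)
  then have 1: "(mon (zr, {a, b}) \<odot> D j (Z s)) (\<beta>, {a, b}) = Z s (\<beta>(j := Suc (\<beta> j)), {})"
    using j Z by (simp add: D_E_apply)
  have h1: "act Z (mon (zr, {a, b})) = Z a \<odot> mon (zr, {b}) + mon (zr, {a}) \<odot> Z b"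
    unfolding pr using Z ab by (simp add: act_der act_odd)
  have h2: "Z a \<odot> mon (zr, {b}) = sg a (mon (zr, {b})) \<odot> Z a" by (rule mul_par_comm[OF L_par[OF Z]]) simp
  have h3: "sg a (mon (zr, {b})) = sc (- 1) (mon (zr, {b}))" using ab by (simp add: sg_mon)
  have 2: "act Z (mon (zr, {a, b})) (\<beta>, {a, b}) = Z a (\<beta>, {a}) + Z b (\<beta>, {b})"
    unfolding h1 h2 h3 mul_sc pointwise using ab Z by (simp add: odd_mul_apply n d)
  show ?thesis unfolding M_def using j 1 2 br_el_left[OF Y_E[OF j] l Z] by (simp add: pointwise)
qed

lemma L_vld: "X \<in> L \<longleftrightarrow> (\<forall>s \<beta> v. X s (\<beta>, v) \<noteq> 0 \<longrightarrow> vld \<beta> v s)"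
proof
  assume X: "X \<in> L"
  show "\<forall>s \<beta> v. X s (\<beta>, v) \<noteq> 0 \<longrightarrow> vld \<beta> v s"
  proof (intro allI impI)
    fix s \<beta> v assume nz: "X s (\<beta>, v) \<noteq> 0"
    have "s \<in> Y" using nz L_out[OF X] by (metis zero_fun_apply)
    moreover have "(\<beta>, v) \<in> B" using nz A_out[OF L_A[OF X]] by blast
    moreover have "even (card v + tau m n s)" using nz L_par[OF X, of s] unfolding par_def by auto
    ultimately show "vld \<beta> v s" by (simp add: vld_def)
  qed
next
  assume a: "\<forall>s \<beta> v. X s (\<beta>, v) \<noteq> 0 \<longrightarrow> vld \<beta> v s"
  show "X \<in> L" unfolding L_iff par_def Acar_def
    using a by (auto simp: vld_def fun_eq_iff pointwise)
qed

lemma L_vldD: "X \<in> L \<Longrightarrow> X s (\<beta>, v) \<noteq> 0 \<Longrightarrow> vld \<beta> v s"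
  by (simp add: L_vld)

lemma W_ext: "(\<And>s \<beta> v. X s (\<beta>, v) = Z s (\<beta>, v)) \<Longrightarrow> X = (Z :: 'a welem)"
  by (auto simp: fun_eq_iff)

lemma wsmul_apply: "wsmul c X s b = c * X s b" by (simp add: wsmul_def)

lemma wsmul_0 [simp]: "wsmul c 0 = 0" "wsmul 0 X = 0" and wsmul_1 [simp]: "wsmul 1 X = X"
  and wsmul_wsmul [simp]: "wsmul c (wsmul d X) = wsmul (c * d) X"
  by (auto simp: wsmul_def fun_eq_iff pointwise)

lemma M_apply: "M \<alpha> u r s b = (if s = r \<and> b = (\<alpha>, u) \<and> (\<alpha>, u) \<in> B then 1 else 0)"
  by (simp add: M_def el_def mon_app pointwise)

section \<open>Constants of the field and spare indices\<close>

lemma nz: "0 < k \<Longrightarrow> k < p \<Longrightarrow> (of_nat k :: 'a) \<noteq> 0"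
  by (auto simp: of_nat_eq_0_iff_char_dvd char_p dest: dvd_imp_le)

lemma two_nz: "(2 :: 'a) \<noteq> 0" and one_m: "(1::'a) \<noteq> - 1" "- 1 \<noteq> (1::'a)"
proof -
  show 2: "(2 :: 'a) \<noteq> 0" using nz[of 2] p_gt by simp
  then show "(1::'a) \<noteq> - 1" "- 1 \<noteq> (1::'a)" by (metis add.right_inverse one_add_one)+
qed

text \<open>The top exponent equals \<open>-1\<close> in the field. It therefore has the weight of a
  partial derivative, but it differs from the exponents that are 0 or 1 modulo \<open>p\<close>, and
  these can thus be raised by one.\<close>

lemma of_nat_pi: "i \<in> E \<Longrightarrow> (of_nat (pi i) :: 'a) = - 1"
proof -
  assume "i \<in> E"
  then have "t i \<ge> 1" using t_ge by (simp add: Y0_def)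
  then have "p dvd p ^ t i" by (simp add: dvd_power)
  then have "(of_nat (p ^ t i) :: 'a) = 0" by (simp only: of_nat_eq_0_iff_char_dvd char_p)
  moreover have "(of_nat (pi i) :: 'a) = of_nat (p ^ t i) - of_nat 1" by (rule of_nat_diff) (simp add: Suc_leI)
  ultimately show ?thesis by simp
qed

lemma Od_other:
  obtains c where "c \<in> Od" "c \<noteq> a" "c \<noteq> b"
proof -
  consider "m + 1 \<noteq> a \<and> m + 1 \<noteq> b" | "m + 2 \<noteq> a \<and> m + 2 \<noteq> b" | "m + 3 \<noteq> a \<and> m + 3 \<noteq> b" by linarith
  then show ?thesis
    using that[of "m + 1"] that[of "m + 2"] that[of "m + 3"] n_ge by cases (auto simp: Y1_def)
qed

lemma E_other:
  obtains c where "c \<in> E" "c \<noteq> a" "c \<noteq> b"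
proof -
  consider "1 \<noteq> a \<and> 1 \<noteq> b" | "2 \<noteq> a \<and> 2 \<noteq> b" | "3 \<noteq> a \<and> 3 \<noteq> b" by linarith
  then show ?thesis using that[of 1] that[of 2] that[of 3] m_ge by cases (auto simp: Y0_def)
qed

text \<open>For three odd indices,
  \<open>2 * c a = (c a + c b) + (c a + c d) - (c b + c d) = 0\<close>, and 2 is invertible.\<close>

lemma pair_zero:
  assumes "\<And>a b. a \<in> Od \<Longrightarrow> b \<in> Od \<Longrightarrow> a < b \<Longrightarrow> c a + c b = (0::'a)" and a: "a \<in> Od"
  shows "c a = 0"
proof -
  have s: "c a + c b = 0" if "a \<in> Od" "b \<in> Od" "a \<noteq> b" for a b
    using assms(1)[of a b] assms(1)[of b a] that by (cases "a < b") (auto simp: add.commute)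
  obtain b where b: "b \<in> Od" "b \<noteq> a" using Od_other by metis
  obtain d where d: "d \<in> Od" "d \<noteq> a" "d \<noteq> b" using Od_other by metis
  have "c a + c b = 0" "c a + c d = 0" "c b + c d = 0" using s a b d by auto
  then have "2 * c a = 0" by (metis add.assoc add.commute add_cancel_right_right mult_2)
  then show ?thesis using two_nz by simp
qed

lemma B_pos: "(\<beta>, v) \<in> B \<Longrightarrow> \<beta> \<noteq> zr \<Longrightarrow> \<exists>i\<in>E. \<beta> i > 0"
  unfolding in_B by (metis gr_zeroI le_zero_eq)

section \<open>Derivations\<close>

abbreviation Der :: "('a welem \<Rightarrow> 'a welem) set" where "Der \<equiv> DerW p m n t"

definition ad :: "'a welem \<Rightarrow> 'a welem \<Rightarrow> 'a welem" where
  "ad X = (\<lambda>y. if y \<in> L then br X y else 0)"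

lemma ad_apply: "y \<in> L \<Longrightarrow> ad X y = br X y" by (simp add: ad_def)

lemma Der_L [simp]: "\<phi> \<in> Der \<Longrightarrow> X \<in> L \<Longrightarrow> \<phi> X \<in> L"
  and Der_add: "\<phi> \<in> Der \<Longrightarrow> X \<in> L \<Longrightarrow> Z \<in> L \<Longrightarrow> \<phi> (X + Z) = \<phi> X + \<phi> Z"
  and Der_wsmul: "\<phi> \<in> Der \<Longrightarrow> X \<in> L \<Longrightarrow> \<phi> (wsmul c X) = wsmul c (\<phi> X)"
  and Der_br: "\<phi> \<in> Der \<Longrightarrow> X \<in> L \<Longrightarrow> Z \<in> L \<Longrightarrow> \<phi> (br X Z) = br (\<phi> X) Z + br X (\<phi> Z)"
  and Der_out: "\<phi> \<in> Der \<Longrightarrow> X \<notin> L \<Longrightarrow> \<phi> X = 0"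
  unfolding DerW_def by blast+

lemma Der_0 [simp]: "\<phi> \<in> Der \<Longrightarrow> \<phi> 0 = 0"
  using Der_wsmul[of \<phi> 0 0] by simp

lemma wminus: "- X = wsmul (- 1) (X :: 'a welem)" by (auto simp: wsmul_def fun_eq_iff pointwise)

lemma Der_minus: "\<phi> \<in> Der \<Longrightarrow> X \<in> L \<Longrightarrow> \<phi> (- X) = - \<phi> X"
  by (simp only: wminus Der_wsmul)

lemma L_minus [simp]: "X \<in> L \<Longrightarrow> - X \<in> L"
  by (simp only: wminus L_wsmul)

lemma Der_diff: "\<phi> \<in> Der \<Longrightarrow> X \<in> L \<Longrightarrow> Z \<in> L \<Longrightarrow> \<phi> (X - Z) = \<phi> X - \<phi> Z"
  by (simp only: diff_conv_add_uminus Der_add Der_minus L_minus)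

lemma wsmul_add: "wsmul c (X + Z) = wsmul c X + wsmul c Z"
  and wsmul_add2: "wsmul (c + d) X = wsmul c X + wsmul d X"
  by (auto simp: wsmul_def fun_eq_iff pointwise algebra_simps)

lemma ad_Der: "X \<in> L \<Longrightarrow> ad X \<in> Der"
  unfolding DerW_def ad_def by (auto simp: br_add br_wsmul intro: br_jacobi)

lemma Der_plus: "\<phi> \<in> Der \<Longrightarrow> \<psi> \<in> Der \<Longrightarrow> \<phi> + \<psi> \<in> Der"
  unfolding DerW_def by (simp add: pointwise br_add wsmul_add algebra_simps)

lemma Der_escale: "\<phi> \<in> Der \<Longrightarrow> escale c \<phi> \<in> Der"
  unfolding DerW_def escale_def by (simp add: br_wsmul wsmul_add mult.commute)

lemma Der_zero: "0 \<in> Der"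
  unfolding DerW_def by (simp add: pointwise)

lemma Der_sum: "(\<And>i. i \<in> I \<Longrightarrow> f i \<in> Der) \<Longrightarrow> sum f I \<in> Der"
  by (induction I rule: infinite_finite_induct) (simp_all add: Der_plus Der_zero)

section \<open>Weights of basis vectors\<close>

lemma br_T_M: "q \<in> Y \<Longrightarrow> vld \<alpha> u r \<Longrightarrow> br (T q) (M \<alpha> u r) = wsmul (wt q r \<alpha> u) (M \<alpha> u r)"
  by (rule W_ext) (simp add: br_T wsmul_apply M_apply)

lemma T_M: "T q = M (if q \<in> E then sn q (Suc 0) else zr) (if q \<in> E then {} else {q}) q"
  by (simp add: T_def)

lemma T_vld: "q \<in> Y \<Longrightarrow> vld (if q \<in> E then sn q (Suc 0) else zr) (if q \<in> E then {} else {q}) q"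
  by (auto simp: Y_iff vld_E vld_O sn1_B zr_B)

lemma wt_T: "q \<in> Y \<Longrightarrow> r \<in> Y \<Longrightarrow> wt q r (if r \<in> E then sn r (Suc 0) else zr) (if r \<in> E then {} else {r}) = 0"
  by (auto simp: wt_def sn_def Y_iff E_Od)

lemma br_T_T: "q \<in> Y \<Longrightarrow> r \<in> Y \<Longrightarrow> br (T q) (T r) = 0"
  using br_T_M[of q, OF _ T_vld[of r]] wt_T[of q r] by (simp add: T_M[of r])

lemma br_T_weight0:
  assumes "q \<in> Y" "Z \<in> L" "\<And>s \<beta> v. Z s (\<beta>, v) \<noteq> 0 \<Longrightarrow> wt q s \<beta> v = 0"
  shows "br (T q) Z = 0"
  by (rule W_ext) (use assms in \<open>auto simp: br_T pointwise\<close>)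

text \<open>The weight of \<open>x^u D_r\<close> at \<open>r\<close> is \<open>-1\<close>. Among
  vectors with constant even part only those with direction \<open>r\<close> have this weight, since
  \<open>1 \<noteq> - 1\<close>; the weights at the odd indices then recover
  \<open>u\<close>.\<close>

lemma weight_const:
  assumes w: "\<forall>q\<in>Y. wt q s zr v = wt q r zr u" and r: "r \<notin> u" and u: "vld zr u r" and v: "vld zr v s"
  shows "s = r \<and> v = u"
proof -
  have Y: "s \<in> Y" "r \<in> Y" and uv: "u \<subseteq> Od" "v \<subseteq> Od" using u v by (auto simp: vld_def zr_B)
  have "wt r s zr v = - 1" using w Y r by (auto simp: wt_def)
  then have s: "s = r" and rv: "r \<notin> v"
    using one_m E_Od uv by (auto simp: wt_def split: if_splits)
  have "q \<in> v \<longleftrightarrow> q \<in> u" if "q \<in> Od" for q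
    using bspec[OF w, of q] that E_Od(3)[OF that] r rv s by (auto simp: wt_def Y_iff split: if_splits)
  then show ?thesis using s uv by blast
qed

lemma weight_zero_const:
  assumes w: "\<forall>q\<in>Y. wt q s zr v = 0" and v: "vld zr v s"
  shows "s \<in> Od \<and> v = {s}"
proof -
  have Y: "s \<in> Y" and uv: "v \<subseteq> Od" using v by (auto simp: vld_def zr_B)
  have "wt s s zr v = 0" using w Y by auto
  then have s: "s \<in> Od" "s \<in> v" using Y by (auto simp: wt_def Y_iff split: if_splits)
  have "q = s" if "q \<in> v" for q
    using bspec[OF w, of q] that uv E_Od(3)[of q] by (auto simp: wt_def Y_iff split: if_splits)
  then show ?thesis using s by blast
qed

lemma zr_Suc: "zr(i := Suc 0) = sn i (Suc 0)" by (auto simp: sn_def)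

text \<open>The hypotheses say that \<open>Z\<close> has constant coefficients and weight zero, hence \<open>Z = \<Sum> z_a x_a D_a\<close>;
  commuting with \<open>x_a x_b D_j\<close> forces \<open>z_a + z_b = 0\<close> for all pairs, and there are at least three
  odd indices.\<close>

lemma central_zero:
  assumes Z: "Z \<in> L" and c: "\<And>i. i \<in> E \<Longrightarrow> br (Dd i) Z = 0"
    and w: "\<And>s \<beta> v. Z s (\<beta>, v) \<noteq> 0 \<Longrightarrow> \<forall>q\<in>Y. wt q s \<beta> v = 0"
    and y: "\<And>a b j. a \<in> Od \<Longrightarrow> b \<in> Od \<Longrightarrow> a < b \<Longrightarrow> j \<in> E \<Longrightarrow> br (M zr {a, b} j) Z = 0"
  shows "Z = 0"
proof -
  have 1: "Z s (\<beta>, v) = 0" if nzr: "\<beta> \<noteq> zr" for s \<beta> v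
  proof (rule ccontr)
    assume n: "Z s (\<beta>, v) \<noteq> 0"
    then have "(\<beta>, v) \<in> B" using L_vldD[OF Z n] by (simp add: vld_def)
    then obtain i where i: "i \<in> E" "\<beta> i > 0" using B_pos[OF \<open>(\<beta>, v) \<in> B\<close> nzr] by blast
    have "Z s (\<beta>, v) = br (Dd i) Z s (\<beta>(i := \<beta> i - 1), v)" using i Z by (simp add: br_Dd)
    then show False using n c[OF i(1)] by (simp add: pointwise)
  qed
  have 2: "s \<in> Od \<and> v = {s}" if "Z s (zr, v) \<noteq> 0" for s v
    using weight_zero_const[OF w[OF that]] that Z unfolding L_vld by blast
  have 3: "Z a (zr, {a}) = 0" if "a \<in> Od" for a
  proof (rule pair_zero[OF _ that])
    fix a b assume ab: "a \<in> Od" "b \<in> Od" "a < b"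
    obtain j where j: "j \<in> E" using E_other by metis
    have "br (M zr {a, b} j) Z j (zr, {a, b}) = Z j (sn j (Suc 0), {}) - (Z a (zr, {a}) + Z b (zr, {b}))"
      using br_y[OF ab j Z, of zr j] ab by (simp add: zr_B zr_Suc)
    then have "0 - (Z a (zr, {a}) + Z b (zr, {b})) = 0"
      using y[OF ab j] 1[of "sn j (Suc 0)" j "{}"] by (simp add: pointwise del: diff_0)
    then show "Z a (zr, {a}) + Z b (zr, {b}) = 0" by (simp only: diff_0 neg_equal_0_iff_equal)
  qed
  show ?thesis
  proof (rule W_ext)
    fix s \<beta> v show "Z s (\<beta>, v) = 0 s (\<beta>, v)"
      by (cases "\<beta> = zr") (use 1 2[of s v] 3[of s] in \<open>auto simp: pointwise\<close>)
  qed
qed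

section \<open>Making the torus vanish\<close>

definition torus0 :: "('a welem \<Rightarrow> 'a welem) \<Rightarrow> bool" where
  "torus0 \<phi> \<longleftrightarrow> \<phi> \<in> Der \<and> (\<forall>q\<in>Y. \<phi> (T q) = 0)"

lemma torus0_weight:
  assumes \<phi>: "torus0 \<phi>" and v: "vld \<alpha> u r" and n: "\<phi> (M \<alpha> u r) s (\<beta>, v) \<noteq> 0"
  shows "\<forall>q\<in>Y. wt q s \<beta> v = wt q r \<alpha> u" "vld \<beta> v s"
proof -
  have D: "\<phi> \<in> Der" using \<phi> by (simp add: torus0_def)
  have l: "\<phi> (M \<alpha> u r) \<in> L" using D v by simp
  then show "vld \<beta> v s" using n unfolding L_vld by blast
  show "\<forall>q\<in>Y. wt q s \<beta> v = wt q r \<alpha> u"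
  proof
    fix q assume q: "q \<in> Y"
    have "\<phi> (br (T q) (M \<alpha> u r)) = br (\<phi> (T q)) (M \<alpha> u r) + br (T q) (\<phi> (M \<alpha> u r))"
      using D q v by (simp add: Der_br)
    then have "wsmul (wt q r \<alpha> u) (\<phi> (M \<alpha> u r)) = br (T q) (\<phi> (M \<alpha> u r))"
      using \<phi> D q v by (simp add: br_T_M Der_wsmul torus0_def)
    then have "wt q r \<alpha> u * \<phi> (M \<alpha> u r) s (\<beta>, v) = wt q s \<beta> v * \<phi> (M \<alpha> u r) s (\<beta>, v)"
      using br_T[OF q l] by (metis wsmul_apply)
    then show "wt q s \<beta> v = wt q r \<alpha> u" using n by simp
  qed
qed

text \<open>The nonzero weight part of the values on the torus is removed by an inner derivation.
  What is left has weight zero, turns out to commute with every basis vector, and vanishes by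
  \<open>central_zero\<close>.\<close>

lemma torus_step:
  assumes D: "\<phi> \<in> Der"
  shows "\<exists>X\<in>L. torus0 (\<phi> + ad X)"
proof -
  define h where "h q = \<phi> (T q)" for q
  have hL: "h q \<in> L" if "q \<in> Y" for q using D that by (simp add: h_def)
  \<comment> \<open>Applying \<open>\<phi>\<close> to \<open>[T q, T r] = 0\<close> gives this
    compatibility, coefficient by coefficient.\<close>
  have hh: "wt q s \<beta> v * h r s (\<beta>, v) = wt r s \<beta> v * h q s (\<beta>, v)" if "q \<in> Y" "r \<in> Y" for q r s \<beta> v
  proof -
    have "\<phi> (br (T q) (T r)) = br (h q) (T r) + br (T q) (h r)" using D that by (simp add: Der_br h_def)
    then have "0 = br (T q) (h r) - br (T r) (h q)"
      using that D hL br_anti[of "h q" "T r"] by (simp add: br_T_T)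
    then show ?thesis using that hL by (metis br_T eq_iff_diff_eq_0 )
  qed
  \<comment> \<open>Each coefficient of \<open>h q\<close> is divided by its weight for some
    \<open>q\<close> of nonzero weight; by \<open>hh\<close> the choice does not matter.
    Coefficients of weight zero for all \<open>q\<close> are out of reach and set to 0.\<close>
  define X where "X = (\<lambda>s b. let Q = (\<lambda>q. q \<in> Y \<and> wt q s (fst b) (snd b) \<noteq> 0) in
    if \<exists>q. Q q then h (SOME q. Q q) s b / wt (SOME q. Q q) s (fst b) (snd b) else 0)"
  have Xw: "wt q s \<beta> v * X s (\<beta>, v) = h q s (\<beta>, v)" if "q \<in> Y" "\<exists>r\<in>Y. wt r s \<beta> v \<noteq> 0" for q s \<beta> v
  proof -
    let ?Q = "\<lambda>q. q \<in> Y \<and> wt q s \<beta> v \<noteq> 0"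
    define r where "r = (SOME q. ?Q q)"
    have r: "?Q r" unfolding r_def by (rule someI_ex) (use that in blast)
    have "X s (\<beta>, v) = h r s (\<beta>, v) / wt r s \<beta> v"
      using that(2) unfolding X_def Let_def r_def by auto
    then have "wt r s \<beta> v * (wt q s \<beta> v * X s (\<beta>, v)) = wt r s \<beta> v * h q s (\<beta>, v)"
      using hh[of q r s \<beta> v] that r by simp
    then show ?thesis using r by simp
  qed
  have XL: "X \<in> L"
    unfolding L_vld
  proof (intro allI impI)
    fix s \<beta> v assume n: "X s (\<beta>, v) \<noteq> 0"
    then obtain r where r: "r \<in> Y" "wt r s \<beta> v \<noteq> 0" unfolding X_def Let_def by (auto split: if_splits)
    then have "h r s (\<beta>, v) \<noteq> 0" using Xw[OF r(1) bexI[of "\<lambda>r. wt r s \<beta> v \<noteq> 0", OF r(2) r(1)]] n by auto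
    then show "vld \<beta> v s" using hL[OF r(1)] unfolding L_vld by blast
  qed
  define \<psi> where "\<psi> = \<phi> + ad X"
  have \<psi>D: "\<psi> \<in> Der" unfolding \<psi>_def using D XL by (simp add: Der_plus ad_Der)
  define g where "g q = \<psi> (T q)" for q
  have gL: "g q \<in> L" if "q \<in> Y" for q using \<psi>D that by (simp add: g_def)
  have ge: "g q s (\<beta>, v) = h q s (\<beta>, v) - wt q s \<beta> v * X s (\<beta>, v)" if q: "q \<in> Y" for q s \<beta> v
  proof -
    have "g q = h q + br X (T q)" using q by (simp add: g_def \<psi>_def pointwise ad_apply h_def)
    also have "br X (T q) = - br (T q) X" using XL q by (simp add: br_anti[of X])
    finally show ?thesis using br_T[OF q XL] by (simp add: pointwise)
  qed
  have gw: "\<forall>r\<in>Y. wt r s \<beta> v = 0" if "q \<in> Y" "g q s (\<beta>, v) \<noteq> 0" for q s \<beta> v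
  proof (rule ccontr)
    assume "\<not> (\<forall>r\<in>Y. wt r s \<beta> v = 0)"
    then show False using Xw[OF that(1), of s \<beta> v] that(2) ge[OF that(1), of s \<beta> v] by auto
  qed
  \<comment> \<open>As \<open>g q\<close> has weight zero, the bracket lives in the
    \<open>T q\<close>-weight of \<open>M \<alpha> u r\<close>. In exactly this weight the other two
    terms of \<open>\<psi> [T q, M \<alpha> u r]\<close> cancel.\<close>
  have gM: "br (g q) (M \<alpha> u r) = 0" if q: "q \<in> Y" and v: "vld \<alpha> u r" for q \<alpha> u r
  proof (rule W_ext)
    fix s \<beta> w
    have L: "br (g q) (M \<alpha> u r) \<in> L" using gL[OF q] v by simp
    have "br (T q) (g q) = 0" by (rule br_T_weight0) (use q gL gw in auto)
    then have "br (T q) (br (g q) (M \<alpha> u r)) = wsmul (wt q r \<alpha> u) (br (g q) (M \<alpha> u r))"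
      using br_jacobi[of "T q" "g q" "M \<alpha> u r"] q gL v by (simp add: br_T_M br_wsmul)
    then have 1: "wt q s \<beta> w * br (g q) (M \<alpha> u r) s (\<beta>, w) = wt q r \<alpha> u * br (g q) (M \<alpha> u r) s (\<beta>, w)"
      using br_T[OF q L] by (metis wsmul_apply)
    have "\<psi> (br (T q) (M \<alpha> u r)) = br (g q) (M \<alpha> u r) + br (T q) (\<psi> (M \<alpha> u r))"
      using \<psi>D q v by (simp add: Der_br g_def)
    then have "wsmul (wt q r \<alpha> u) (\<psi> (M \<alpha> u r)) = br (g q) (M \<alpha> u r) + br (T q) (\<psi> (M \<alpha> u r))"
      using \<psi>D q v by (simp add: br_T_M Der_wsmul)
    then have "wsmul (wt q r \<alpha> u) (\<psi> (M \<alpha> u r)) s (\<beta>, w) = (br (g q) (M \<alpha> u r) + br (T q) (\<psi> (M \<alpha> u r))) s (\<beta>, w)"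
      by (simp only:)
    then have "wt q r \<alpha> u * \<psi> (M \<alpha> u r) s (\<beta>, w) = br (g q) (M \<alpha> u r) s (\<beta>, w) + wt q s \<beta> w * \<psi> (M \<alpha> u r) s (\<beta>, w)"
      by (simp add: wsmul_apply pointwise br_T[OF q Der_L[OF \<psi>D M_L[OF v]]])
    with 1 show "br (g q) (M \<alpha> u r) s (\<beta>, w) = 0 s (\<beta>, w)" by (auto simp: pointwise)
  qed
  have "g q = 0" if q: "q \<in> Y" for q
  proof (rule central_zero)
    show "g q \<in> L" using gL q .
    show "br (Dd i) (g q) = 0" if "i \<in> E" for i
      using gM[OF q, of zr "{}" i] br_anti[of "Dd i" "g q"] gL[OF q] that by (simp add: vld_E zr_B)
    show "\<forall>q\<in>Y. wt q s \<beta> v = 0" if "g q s (\<beta>, v) \<noteq> 0" for s \<beta> v using gw[OF q that] .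
    show "br (M zr {a, b} j) (g q) = 0" if "a \<in> Od" "b \<in> Od" "a < b" "j \<in> E" for a b j
      using gM[OF q vld_y[of a b j]] br_anti[of "M zr {a, b} j" "g q"] gL[OF q] M_L[OF vld_y[of a b j]] that by simp
  qed
  then have "torus0 (\<phi> + ad X)" using \<psi>D unfolding torus0_def \<psi>_def[symmetric] g_def by blast
  with XL show ?thesis by blast
qed

lemma torus0_plus:
  assumes "torus0 \<phi>" "X \<in> L" "\<And>s \<beta> v q. X s (\<beta>, v) \<noteq> 0 \<Longrightarrow> q \<in> Y \<Longrightarrow> wt q s \<beta> v = 0"
  shows "torus0 (\<phi> + ad X)"
proof -
  have "br X (T q) = 0" if "q \<in> Y" for q
    using br_T_weight0[OF that assms(2)] assms(3) that br_anti[of X "T q"] assms(2) by auto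
  then show ?thesis using assms unfolding torus0_def by (auto simp: Der_plus ad_Der pointwise ad_apply)
qed

section \<open>Making the even partial derivatives vanish\<close>

definition nf :: "('a welem \<Rightarrow> 'a welem) \<Rightarrow> bool" where
  "nf \<phi> \<longleftrightarrow> torus0 \<phi> \<and> (\<forall>i\<in>E. \<phi> (Dd i) = 0)"

lemma br_Dd_Dd: "i \<in> E \<Longrightarrow> k \<in> E \<Longrightarrow> br (Dd i) (Dd k) = 0"
  by (rule W_ext) (simp add: br_Dd M_apply pointwise fun_eq_iff, metis nat.distinct(1))

lemma Dd_step:
  assumes T: "torus0 \<phi>"
  shows "\<exists>X\<in>L. nf (\<phi> + ad X)"
proof -
  have D: "\<phi> \<in> Der" using T by (simp add: torus0_def)
  \<comment> \<open>\<open>[D_i, D_k] = 0\<close> makes the values on the \<open>D_i\<close> a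
    closed form. The fact is kept general because it serves both \<open>\<phi>\<close> and its
    correction.\<close>
  have closed: "\<psi> (Dd k) s (\<beta>(i := Suc (\<beta> i)), v) = \<psi> (Dd i) s (\<beta>(k := Suc (\<beta> k)), v)"
    if "\<psi> \<in> Der" "i \<in> E" "k \<in> E" for \<psi> i k s \<beta> v
  proof -
    have "\<psi> (br (Dd i) (Dd k)) = br (\<psi> (Dd i)) (Dd k) + br (Dd i) (\<psi> (Dd k))" using that by (simp add: Der_br)
    then have "0 = br (Dd i) (\<psi> (Dd k)) - br (Dd k) (\<psi> (Dd i))"
      using that br_anti[of "\<psi> (Dd i)" "Dd k"] by (simp add: br_Dd_Dd)
    then have "br (Dd i) (\<psi> (Dd k)) s (\<beta>, v) = br (Dd k) (\<psi> (Dd i)) s (\<beta>, v)" by simp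
    then show ?thesis using that by (simp add: br_Dd)
  qed
  define h where "h i = \<phi> (Dd i)" for i
  have hL: "h i \<in> L" if "i \<in> E" for i using D that by (simp add: h_def)
  \<comment> \<open>Divided powers integrate by raising an exponent, without denominators.
    \<open>SOME\<close> picks a direction in which the exponent is positive; closedness makes the
    result independent of it. The integration constant is 0.\<close>
  define X where "X = (\<lambda>s b. if b \<in> B \<and> (\<exists>i. i \<in> E \<and> fst b i > 0) then
     h (SOME i. i \<in> E \<and> fst b i > 0) s ((fst b)((SOME i. i \<in> E \<and> fst b i > 0) :=
       fst b (SOME i. i \<in> E \<and> fst b i > 0) - 1), snd b) else 0)"
  have Xe: "X s (\<beta>, v) = h i s (\<beta>(i := \<beta> i - 1), v)" if "(\<beta>, v) \<in> B" "i \<in> E" "\<beta> i > 0" for s \<beta> v i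
  proof -
    define k where "k = (SOME i. i \<in> E \<and> \<beta> i > 0)"
    have k: "k \<in> E \<and> \<beta> k > 0" unfolding k_def by (rule someI_ex) (use that in blast)
    have "X s (\<beta>, v) = h k s (\<beta>(k := \<beta> k - 1), v)"
      using that unfolding X_def k_def by auto
    also have "\<dots> = h i s (\<beta>(i := \<beta> i - 1), v)"
    proof (cases "i = k")
      case False
      let ?b = "\<beta>(i := \<beta> i - 1, k := \<beta> k - 1)"
      have e1: "?b(i := Suc (?b i)) = \<beta>(k := \<beta> k - 1)" using False that by (auto simp: fun_eq_iff)
      have e2: "?b(k := Suc (?b k)) = \<beta>(i := \<beta> i - 1)" using False k by (auto simp: fun_eq_iff)
      have "h k s (?b(i := Suc (?b i)), v) = h i s (?b(k := Suc (?b k)), v)"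
        using closed[OF D, of i k s ?b v] that k unfolding h_def by blast
      then show ?thesis unfolding e1 e2 .
    qed simp
    finally show ?thesis .
  qed
  have Xn: "\<exists>i\<in>E. (\<beta>, v) \<in> B \<and> \<beta> i > 0 \<and> h i s (\<beta>(i := \<beta> i - 1), v) \<noteq> 0" if "X s (\<beta>, v) \<noteq> 0" for s \<beta> v
  proof -
    have "(\<beta>, v) \<in> B \<and> (\<exists>i. i \<in> E \<and> \<beta> i > 0)" proof (rule ccontr)
      assume "\<not> ?thesis"
      then have "\<not> ((\<beta>, v) \<in> B \<and> (\<exists>i. i \<in> E \<and> fst (\<beta>, v) i > 0))" by simp
      then show False using that unfolding X_def by (simp only: if_False simp_thms)
    qed
    then obtain i where "(\<beta>, v) \<in> B" "i \<in> E" "\<beta> i > 0" by blast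
    with Xe[OF this] that show ?thesis by metis
  qed
  have XL: "X \<in> L"
    unfolding L_vld
  proof (intro allI impI)
    fix s \<beta> v assume "X s (\<beta>, v) \<noteq> 0"
    from Xn[OF this] obtain i where i: "i \<in> E" "(\<beta>, v) \<in> B" "h i s (\<beta>(i := \<beta> i - 1), v) \<noteq> 0" by blast
    then have "vld (\<beta>(i := \<beta> i - 1)) v s" using hL[OF i(1)] unfolding L_vld by blast
    then show "vld \<beta> v s" using i by (simp add: vld_def)
  qed
  \<comment> \<open>The value on \<open>D_i\<close> has the weight of \<open>D_i\<close>, and
    raising the exponent at \<open>i\<close> brings it back to zero. Hence the correction does not
    disturb the torus.\<close>
  have Xw: "wt q s \<beta> v = 0" if "X s (\<beta>, v) \<noteq> 0" "q \<in> Y" for s \<beta> v q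
  proof -
    from Xn[OF that(1)] obtain i where i: "i \<in> E" "\<beta> i > 0" "h i s (\<beta>(i := \<beta> i - 1), v) \<noteq> 0" by blast
    have "wt q s (\<beta>(i := \<beta> i - 1)) v = wt q i zr {}"
      using torus0_weight(1)[OF T, of zr "{}" i] i that by (simp add: h_def vld_E zr_B)
    then show ?thesis using i by (auto simp: wt_def of_nat_diff split: if_splits)
  qed
  define \<psi> where "\<psi> = \<phi> + ad X"
  have T': "torus0 \<psi>" unfolding \<psi>_def by (rule torus0_plus[OF T XL]) (use Xw in blast)
  have D': "\<psi> \<in> Der" using T' by (simp add: torus0_def)
  have \<psi>e: "\<psi> (Dd i) s (\<beta>, v) = h i s (\<beta>, v) - X s (\<beta>(i := Suc (\<beta> i)), v)" if i: "i \<in> E" for i s \<beta> v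
  proof -
    have "\<psi> (Dd i) = h i + br X (Dd i)" using i by (simp add: \<psi>_def pointwise ad_apply h_def)
    also have "br X (Dd i) = - br (Dd i) X" using XL i by (simp add: br_anti[of X])
    finally show ?thesis using br_Dd[OF i XL] by (simp add: pointwise)
  qed
  \<comment> \<open>Integration in direction \<open>i\<close> fails only at the top exponent, where
    the raised index leaves the basis.\<close>
  have top: "\<beta> i = pi i" if i: "i \<in> E" and n: "\<psi> (Dd i) s (\<beta>, v) \<noteq> 0" for i s \<beta> v
  proof (rule ccontr)
    assume ne: "\<beta> i \<noteq> pi i"
    have "vld zr {} i" using i by (simp add: vld_E zr_B)
    then have Bb: "(\<beta>, v) \<in> B" using torus0_weight(2)[OF T' _ n] by (simp add: vld_def)
    then have "\<beta> i \<le> pi i" using i unfolding in_B by metis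
    then have "(\<beta>(i := Suc (\<beta> i)), v) \<in> B" using B_raise[OF i Bb] ne by simp
    then have "X s (\<beta>(i := Suc (\<beta> i)), v) = h i s (\<beta>, v)" using Xe[of "\<beta>(i := Suc (\<beta> i))" v i s] i by simp
    then show False using \<psi>e[OF i] n by simp
  qed
  have only: "\<beta> k = 0" if i: "i \<in> E" and k: "k \<in> E" "k \<noteq> i" and n: "\<psi> (Dd i) s (\<beta>, v) \<noteq> 0" for i k s \<beta> v
  proof (rule ccontr)
    assume "\<beta> k \<noteq> 0"
    then have e: "(\<beta>(k := \<beta> k - 1))(k := Suc ((\<beta>(k := \<beta> k - 1)) k)) = \<beta>" by auto
    let ?c = "(\<beta>(k := \<beta> k - 1))(i := Suc ((\<beta>(k := \<beta> k - 1)) i))"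
    have "\<psi> (Dd i) s (\<beta>, v) = \<psi> (Dd k) s (?c, v)"
      using closed[OF D' k(1) i, of s "\<beta>(k := \<beta> k - 1)" v] unfolding e .
    then have "vld ?c v s" using torus0_weight(2)[OF T', of zr "{}" k s ?c v] n k by (simp add: vld_E zr_B)
    then have "?c i \<le> pi i" using i unfolding vld_def in_B by metis
    moreover have "?c i = Suc (\<beta> i)" using k by simp
    ultimately have "Suc (\<beta> i) \<le> pi i" by simp
    then show False using top[OF i n] by linarith
  qed
  have "\<psi> (Dd i) = 0" if i: "i \<in> E" for i
  proof -
    let ?P = "sn i (pi i)"
    have Z: "\<psi> (Dd i) \<in> L" using D' i by simp
    have shape: "\<beta> = ?P \<and> s \<in> Od \<and> v = {s}" if n: "\<psi> (Dd i) s (\<beta>, v) \<noteq> 0" for s \<beta> v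
    proof -
      have vl: "vld \<beta> v s" and w: "\<forall>q\<in>Y. wt q s \<beta> v = wt q i zr {}"
        using torus0_weight[OF T' _ n] i by (simp_all add: vld_E zr_B)
      have sY: "s \<in> Y" and vO: "v \<subseteq> Od" and bB: "(\<beta>, v) \<in> B" using vl by (auto simp: vld_def in_B)
      have bE: "\<beta> = ?P"
      proof
        fix k show "\<beta> k = ?P k"
          using top[OF i n] only[OF i _ _ n, of k] bB[unfolded in_B, THEN conjunct1, rule_format, of k] i
          by (cases "k \<in> E"; cases "k = i") auto
      qed
      have "wt i s \<beta> v = - 1" using bspec[OF w, of i] i by (simp add: wt_def Y_iff)
      \<comment> \<open>The top exponent alone already contributes the weight \<open>-1\<close>; for
        \<open>s = i\<close> the weight at \<open>i\<close> would be \<open>-2\<close>.\<close>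
      then have si: "s \<noteq> i" using i of_nat_pi[OF i] unfolding bE by (auto simp: wt_def)
      have "wt s s \<beta> v = 0" using bspec[OF w sY] i si by (simp add: wt_def)
      then have s: "s \<in> Od" "s \<in> v" using sY si unfolding bE by (auto simp: wt_def Y_iff split: if_splits)
      have "q = s" if "q \<in> v" for q
        using bspec[OF w, of q] that vO E_Od(3)[of q] i by (auto simp: wt_def Y_iff split: if_splits)
      then show ?thesis using s bE by blast
    qed
    have PB: "(?P, u) \<in> B \<longleftrightarrow> u \<subseteq> Od" for u using sn_B[OF i, of "pi i" u] by simp
    have c0: "\<psi> (Dd i) a (?P, {a}) = 0" if "a \<in> Od" for a
    proof (rule pair_zero[OF _ that])
      fix a b assume ab: "a \<in> Od" "b \<in> Od" "a < b"
      obtain j where j: "j \<in> E" "j \<noteq> i" using E_other by metis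
      let ?y = "M zr {a, b} j"
      have yv: "vld zr {a, b} j" using ab j by (simp add: vld_y)
      have y0: "br (Dd i) ?y = 0"
        by (rule W_ext) (use i yv in \<open>simp add: br_Dd M_apply pointwise fun_eq_iff, metis nat.distinct(1)\<close>)
      have "\<psi> (br (Dd i) ?y) = br (\<psi> (Dd i)) ?y + br (Dd i) (\<psi> ?y)" using D' i yv by (simp add: Der_br)
      then have "br ?y (\<psi> (Dd i)) = br (Dd i) (\<psi> ?y)"
        using D' i yv br_anti[of "\<psi> (Dd i)" ?y] by (simp add: y0)
      \<comment> \<open>Nothing in the image of \<open>ad D_i\<close> has a coefficient at the top
        exponent of \<open>x_i\<close>. With \<open>j \<noteq> i\<close>, \<open>?y\<close> commutes
        with \<open>D_i\<close>, so \<open>[?y, \<psi> (D_i)]\<close> lies in this image.\<close>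
      then have "br ?y (\<psi> (Dd i)) j (?P, {a, b}) = \<psi> ?y j (?P(i := Suc (?P i)), {a, b})"
        using br_Dd[OF i, of "\<psi> ?y"] D' yv by simp
      also have "\<dots> = 0"
      proof (rule ccontr)
        assume "\<psi> ?y j (?P(i := Suc (?P i)), {a, b}) \<noteq> 0"
        then have "(?P(i := Suc (?P i)), {a, b}) \<in> B" using L_vldD[OF Der_L[OF D' M_L[OF yv]]] unfolding vld_def by blast
        then show False using B_raise[OF i, of ?P "{a, b}"] PB ab by simp
      qed
      finally have "br ?y (\<psi> (Dd i)) j (?P, {a, b}) = 0" .
      moreover have "\<psi> (Dd i) j (?P(j := Suc (?P j)), {}) = 0" using shape j E_Od by blast
      moreover have "br ?y (\<psi> (Dd i)) j (?P, {a, b}) =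
          \<psi> (Dd i) j (?P(j := Suc (?P j)), {}) - (\<psi> (Dd i) a (?P, {a}) + \<psi> (Dd i) b (?P, {b}))"
        using br_y[OF ab j(1) Z, of ?P j] PB ab by simp
      ultimately show "\<psi> (Dd i) a (?P, {a}) + \<psi> (Dd i) b (?P, {b}) = 0"
        by (metis diff_0 neg_equal_0_iff_equal)
    qed
    show ?thesis
    proof (rule W_ext)
      fix s \<beta> v show "\<psi> (Dd i) s (\<beta>, v) = 0 s (\<beta>, v)"
        using shape[of s \<beta> v] c0[of s] by (auto simp: pointwise)
    qed
  qed
  then have "nf (\<phi> + ad X)" using T' unfolding nf_def \<psi>_def by blast
  with XL show ?thesis by blast
qed

section \<open>Normal form of a derivation\<close>

lemma vld_lower: "vld \<alpha> u r \<Longrightarrow> k \<le> \<alpha> i \<Longrightarrow> vld (\<alpha>(i := k)) u r"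
  by (simp add: vld_def B_lower)

lemma vld_le: "vld \<alpha> u r \<Longrightarrow> i \<in> E \<Longrightarrow> \<alpha> i \<le> pi i"
proof -
  assume "vld \<alpha> u r" "i \<in> E"
  then have "\<alpha> i \<le> (if i \<in> E then pi i else 0)" unfolding vld_def in_B by blast
  then show ?thesis using \<open>i \<in> E\<close> by simp
qed

lemma br_Dd_M:
  assumes i: "i \<in> E" and v: "vld \<alpha> u r"
  shows "br (Dd i) (M \<alpha> u r) = (if \<alpha> i > 0 then M (\<alpha>(i := \<alpha> i - 1)) u r else 0)"
proof (rule W_ext)
  fix s \<beta> w
  have e: "\<beta>(i := Suc (\<beta> i)) = \<alpha> \<longleftrightarrow> \<alpha> i > 0 \<and> \<beta> = \<alpha>(i := \<alpha> i - 1)"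
    by (metis Suc_pred' diff_Suc_1 fun_upd_same fun_upd_triv fun_upd_upd zero_less_Suc)
  have "vld (\<alpha>(i := \<alpha> i - 1)) u r" using v by (simp add: vld_lower)
  then have B: "(\<alpha>(i := \<alpha> i - 1), u) \<in> B" "(\<alpha>, u) \<in> B" using v by (simp_all add: vld_def)
  show "br (Dd i) (M \<alpha> u r) s (\<beta>, w) = (if \<alpha> i > 0 then M (\<alpha>(i := \<alpha> i - 1)) u r else 0) s (\<beta>, w)"
    unfolding br_Dd[OF i M_L[OF v]] M_apply using e B by (auto simp: M_apply pointwise)
qed

lemma nf_Der: "nf \<phi> \<Longrightarrow> \<phi> \<in> Der" by (simp add: nf_def torus0_def)

lemma nf_weight:
  assumes "nf \<phi>" "vld \<alpha> u r" "\<phi> (M \<alpha> u r) s (\<beta>, v) \<noteq> 0"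
  shows "\<forall>q\<in>Y. wt q s \<beta> v = wt q r \<alpha> u" "vld \<beta> v s"
  using torus0_weight[of \<phi> \<alpha> u r s \<beta> v] assms by (simp_all add: nf_def)

lemma nf_shift:
  assumes \<phi>: "nf \<phi>" and Z: "Z \<in> L" and i: "i \<in> E"
  shows "\<phi> Z s (\<beta>(i := Suc (\<beta> i)), v) = \<phi> (br (Dd i) Z) s (\<beta>, v)"
proof -
  have "\<phi> (br (Dd i) Z) = br (\<phi> (Dd i)) Z + br (Dd i) (\<phi> Z)" using nf_Der[OF \<phi>] Z i by (simp add: Der_br)
  then have "\<phi> (br (Dd i) Z) = br (Dd i) (\<phi> Z)" using \<phi> i Z by (simp add: nf_def)
  then show ?thesis using br_Dd[OF i Der_L[OF nf_Der[OF \<phi>] Z]] by simp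
qed

text \<open>As \<open>\<phi>\<close> commutes with \<open>ad D_i\<close>, a coefficient with
  positive exponent at \<open>i\<close> is a coefficient of the value on the
  \<open>D_i\<close>-derivative, which is zero or killed by assumption.\<close>

lemma nf_const:
  assumes \<phi>: "nf \<phi>" and v: "vld \<alpha> u r"
    and low: "\<And>i. i \<in> E \<Longrightarrow> \<alpha> i > 0 \<Longrightarrow> \<phi> (M (\<alpha>(i := \<alpha> i - 1)) u r) = 0"
    and n: "\<phi> (M \<alpha> u r) s (\<beta>, w) \<noteq> 0"
  shows "\<beta> = zr"
proof (rule ccontr)
  assume "\<beta> \<noteq> zr"
  moreover have "(\<beta>, w) \<in> B" using nf_weight(2)[OF \<phi> v n] by (simp add: vld_def)
  ultimately obtain i where i: "i \<in> E" "\<beta> i > 0" using B_pos by blast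
  then have e: "(\<beta>(i := \<beta> i - 1))(i := Suc ((\<beta>(i := \<beta> i - 1)) i)) = \<beta>" by auto
  have "\<phi> (M \<alpha> u r) s (\<beta>, w) = \<phi> (br (Dd i) (M \<alpha> u r)) s (\<beta>(i := \<beta> i - 1), w)"
    using nf_shift[OF \<phi> M_L[OF v] i(1), of s "\<beta>(i := \<beta> i - 1)" w] unfolding e .
  also have "\<phi> (br (Dd i) (M \<alpha> u r)) = 0"
    using br_Dd_M[OF i(1) v] low[OF i(1)] nf_Der[OF \<phi>] by simp
  finally show False using n by (simp add: pointwise)
qed

text \<open>The value has constant even part and the same weight, so \<open>weight_const\<close>
  leaves only multiples of the vector itself.\<close>

lemma nf_const_mult:
  assumes \<phi>: "nf \<phi>" and v: "vld zr u r" and r: "r \<notin> u"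
  shows "\<phi> (M zr u r) = wsmul (\<phi> (M zr u r) r (zr, u)) (M zr u r)"
proof (rule W_ext)
  fix s \<beta> w
  have B: "(zr, u) \<in> B" using v by (simp add: vld_def)
  have "s = r \<and> w = u \<and> \<beta> = zr" if n: "\<phi> (M zr u r) s (\<beta>, w) \<noteq> 0"
  proof -
    have b: "\<beta> = zr" by (rule nf_const[OF \<phi> v _ n]) simp
    show ?thesis using weight_const[OF _ r v, of s w] nf_weight[OF \<phi> v n] unfolding b by blast
  qed
  then show "\<phi> (M zr u r) s (\<beta>, w) = wsmul (\<phi> (M zr u r) r (zr, u)) (M zr u r) s (\<beta>, w)"
    using B by (auto simp: wsmul_apply M_apply)
qed

lemma act_sum_left: "act (sum f I) g = (\<Sum>i\<in>I. act (f i) g)"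
  using sum_comp_morphism[of "\<lambda>X. act X g" f I] by (simp add: act_add comp_def)

lemma br_sum_left:
  assumes "\<And>i. i \<in> I \<Longrightarrow> f i \<in> L" "Z \<in> L"
  shows "br (sum f I) Z = (\<Sum>i\<in>I. br (f i) Z)"
proof
  fix s
  have "br (sum f I) Z s = (\<Sum>i\<in>I. act (f i) (Z s)) - act Z (\<Sum>i\<in>I. f i s)"
    using assms by (simp add: br_eq act_sum_left sum_apply'[where x = s])
  also have "\<dots> = (\<Sum>i\<in>I. br (f i) Z s)"
    using assms by (simp add: act_sum sum_subtractf[symmetric] br_eq)
  finally show "br (sum f I) Z s = (\<Sum>i\<in>I. br (f i) Z) s" by (simp only: sum_apply'[where x = s])
qed

section \<open>Corrections by the odd part of the torus\<close>

definition tor :: "(nat \<Rightarrow> 'a) \<Rightarrow> 'a welem" where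
  "tor \<tau> = (\<Sum>q\<in>Y. wsmul (\<tau> q) (T q))"

lemma tor_L [simp]: "tor \<tau> \<in> L" by (simp add: tor_def)

lemma wsmul_sum_left: "(\<Sum>i\<in>I. wsmul (c i) X) = wsmul (\<Sum>i\<in>I. c i) X"
  using sum_comp_morphism[of "\<lambda>c. wsmul c X" c I] by (simp add: wsmul_add2 comp_def)

lemma br_tor:
  assumes v: "vld \<alpha> u r"
  shows "br (tor \<tau>) (M \<alpha> u r) = wsmul (\<Sum>q\<in>Y. \<tau> q * wt q r \<alpha> u) (M \<alpha> u r)"
proof -
  have "br (tor \<tau>) (M \<alpha> u r) = (\<Sum>q\<in>Y. br (wsmul (\<tau> q) (T q)) (M \<alpha> u r))"
    unfolding tor_def by (rule br_sum_left) (use v in auto)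
  also have "\<dots> = (\<Sum>q\<in>Y. wsmul (\<tau> q * wt q r \<alpha> u) (M \<alpha> u r))"
    by (rule sum.cong) (use v in \<open>simp_all add: br_wsmul br_T_M\<close>)
  finally show ?thesis by (simp add: wsmul_sum_left)
qed

text \<open>With \<open>\<tau>\<close> vanishing on even indices, \<open>tor \<tau>\<close> commutes
  with the torus and with every \<open>D_i\<close>.\<close>

lemma nf_tor:
  assumes \<phi>: "nf \<phi>" and \<tau>: "\<And>i. i \<in> E \<Longrightarrow> \<tau> i = 0"
  shows "nf (\<phi> + ad (tor \<tau>))"
proof -
  have "torus0 (\<phi> + ad (tor \<tau>))"
  proof (rule torus0_plus)
    show "torus0 \<phi>" using \<phi> by (simp add: nf_def)
    show "tor \<tau> \<in> L" by simp
    fix s \<beta> v q assume n: "tor \<tau> s (\<beta>, v) \<noteq> 0" and q: "q \<in> Y"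
    have "tor \<tau> s (\<beta>, v) = (\<Sum>q\<in>Y. \<tau> q * T q s (\<beta>, v))"
      unfolding tor_def sum_apply'[where x = s] sum_apply'[where x = "(\<beta>, v)"] by (simp add: wsmul_apply)
    then obtain r where r: "r \<in> Y" "T r s (\<beta>, v) \<noteq> 0" using n by (metis (no_types, lifting) mult_zero_right sum.neutral)
    then have "s = r" "\<beta> = (if r \<in> E then sn r (Suc 0) else zr)" "v = (if r \<in> E then {} else {r})"
      unfolding T_M[of r] M_apply by (auto split: if_splits)
    then show "wt q s \<beta> v = 0" using wt_T[OF q r(1)] by simp
  qed
  moreover have "(\<phi> + ad (tor \<tau>)) (Dd i) = 0" if i: "i \<in> E" for i
  proof -
    have "(\<Sum>q\<in>Y. \<tau> q * wt q i zr {}) = 0"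
      by (rule sum.neutral) (use \<tau> i in \<open>auto simp: wt_def Y_iff\<close>)
    then show ?thesis using \<phi> i br_tor[of zr "{}" i \<tau>] by (simp add: nf_def pointwise ad_apply vld_E zr_B)
  qed
  ultimately show ?thesis by (simp add: nf_def)
qed

lemma wt_sum:
  assumes \<tau>: "\<And>i. i \<in> E \<Longrightarrow> \<tau> i = 0" and u: "u \<subseteq> Od" and r: "r \<in> Y"
  shows "(\<Sum>q\<in>Y. \<tau> q * wt q r \<alpha> u) = (\<Sum>q\<in>u. \<tau> q) - \<tau> r"
proof -
  have "(\<Sum>q\<in>Y. \<tau> q * wt q r \<alpha> u) = (\<Sum>q\<in>Y. (if q \<in> u then \<tau> q else 0) - (if q = r then \<tau> q else 0))"
    by (rule sum.cong) (use \<tau> u E_Od in \<open>auto simp: wt_def Y_iff\<close>)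
  also have "\<dots> = (\<Sum>q\<in>Y. if q \<in> u then \<tau> q else 0) - \<tau> r"
    using r by (simp add: sum_subtractf)
  also have "(\<Sum>q\<in>Y. if q \<in> u then \<tau> q else 0) = (\<Sum>q\<in>u. \<tau> q)"
    by (rule sum.mono_neutral_cong_right) (use u in \<open>auto simp: Y_iff\<close>)
  finally show ?thesis .
qed

lemma vld_gl: "a \<in> Od \<Longrightarrow> b \<in> Od \<Longrightarrow> vld zr {a} b"
  by (simp add: vld_O zr_B)

lemma br_gl:
  assumes "a \<in> Od" "b \<in> Od" "c \<in> Od" "a \<noteq> b" "b \<noteq> c"
  shows "br (M zr {a} b) (M zr {b} c) = M zr {a} c - (if c = a then M zr {b} b else 0)"
  using assms by (simp add: br_M vld_gl D_odd Y_O mul_one) (simp add: M_def)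

text \<open>Brackets of matrix units make the eigenvalues \<open>c a b\<close> of
  \<open>\<phi>\<close> on \<open>x_a D_b\<close> additive, \<open>c a d = c a b + c b d\<close>;
  and \<open>c a b = - c b a\<close> because \<open>[x_a D_b, x_b D_a] = T a - T b\<close> is
  killed. Such a family is a difference of values at \<open>a\<close> and \<open>b\<close>, which a
  torus element can cancel.\<close>

lemma gl_step:
  assumes \<phi>: "nf \<phi>"
  shows "\<exists>X\<in>L. nf (\<phi> + ad X) \<and> (\<forall>a\<in>Od. \<forall>b\<in>Od. a \<noteq> b \<longrightarrow> (\<phi> + ad X) (M zr {a} b) = 0)"
proof -
  have D: "\<phi> \<in> Der" using nf_Der[OF \<phi>] .
  define c where "c a b = \<phi> (M zr {a} b) b (zr, {a})" for a b
  have m: "\<phi> (M zr {a} b) = wsmul (c a b) (M zr {a} b)" if "a \<in> Od" "b \<in> Od" "a \<noteq> b" for a b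
    unfolding c_def by (rule nf_const_mult[OF \<phi>]) (use that in \<open>auto simp: vld_gl\<close>)
  have br: "\<phi> (br (M zr {a} b) (M zr {b} d)) = wsmul (c a b + c b d) (br (M zr {a} b) (M zr {b} d))"
    if "a \<in> Od" "b \<in> Od" "d \<in> Od" "a \<noteq> b" "b \<noteq> d" for a b d
    using that D by (simp add: Der_br vld_gl m br_wsmul wsmul_add2)
  have add: "c a d = c a b + c b d" if "a \<in> Od" "b \<in> Od" "d \<in> Od" "a \<noteq> b" "b \<noteq> d" "a \<noteq> d" for a b d
  proof -
    have "wsmul (c a d) (M zr {a} d) = wsmul (c a b + c b d) (M zr {a} d)"
      using br[of a b d] br_gl[of a b d] m[of a d] that by simp
    then have "wsmul (c a d) (M zr {a} d) d (zr, {a}) = wsmul (c a b + c b d) (M zr {a} d) d (zr, {a})" by simp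
    then show ?thesis using that by (simp add: wsmul_apply M_apply zr_B)
  qed
  have anti: "c a b = - c b a" if "a \<in> Od" "b \<in> Od" "a \<noteq> b" for a b
  proof -
    have "br (M zr {a} b) (M zr {b} a) = T a - T b"
      using br_gl[of a b a] that E_Od by (simp add: T_def)
    moreover have "\<phi> (T a - T b) = 0" using \<phi> that D by (simp add: Der_diff Y_O nf_def torus0_def)
    ultimately have "wsmul (c a b + c b a) (T a - T b) a (zr, {a}) = 0" using br[of a b a] that by (simp add: pointwise)
    then have "c a b + c b a = 0" using that E_Od by (simp add: wsmul_apply pointwise T_def M_apply zr_B)
    then show ?thesis by (simp add: eq_neg_iff_add_eq_0)
  qed
  obtain o' where o: "o' \<in> Od" using Od_other by metis
  \<comment> \<open>With base point \<open>o'\<close>, additivity gives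
    \<open>c a b = c a o' - c b o'\<close>, and \<open>tor \<tau>\<close> adds
    \<open>\<tau> a - \<tau> b\<close>.\<close>
  define \<tau> where "\<tau> a = (if a \<in> E \<or> a = o' then 0 else - c a o')" for a
  have \<tau>E: "\<tau> i = 0" if "i \<in> E" for i using that by (simp add: \<tau>_def)
  have "(\<phi> + ad (tor \<tau>)) (M zr {a} b) = 0" if ab: "a \<in> Od" "b \<in> Od" "a \<noteq> b" for a b
  proof -
    have "(\<Sum>q\<in>Y. \<tau> q * wt q b zr {a}) = \<tau> a - \<tau> b"
      using wt_sum[OF \<tau>E, where u = "{a}" and r = b and \<alpha> = zr] ab by (simp add: Y_O)
    then have "br (tor \<tau>) (M zr {a} b) = wsmul (\<tau> a - \<tau> b) (M zr {a} b)" using br_tor[of zr "{a}" b \<tau>] ab by (simp add: vld_gl)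
    then have "(\<phi> + ad (tor \<tau>)) (M zr {a} b) = wsmul (c a b + (\<tau> a - \<tau> b)) (M zr {a} b)"
      using ab m by (simp add: pointwise ad_apply vld_gl wsmul_add2)
    moreover have "c a b + (\<tau> a - \<tau> b) = 0"
      using add[of a b o'] anti[of o' b] ab o E_Od by (auto simp: \<tau>_def algebra_simps)
    ultimately show ?thesis by simp
  qed
  moreover have "nf (\<phi> + ad (tor \<tau>))" by (rule nf_tor[OF \<phi>]) (rule \<tau>E)
  ultimately show ?thesis using tor_L by blast
qed

definition nf2 :: "('a welem \<Rightarrow> 'a welem) \<Rightarrow> bool" where
  "nf2 \<phi> \<longleftrightarrow> nf \<phi> \<and> (\<forall>a\<in>Od. \<forall>b\<in>Od. a \<noteq> b \<longrightarrow> \<phi> (M zr {a} b) = 0)"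

lemma vld_sn: "j \<in> E \<Longrightarrow> i \<in> E \<Longrightarrow> vld (sn j (Suc 0)) {} i"
  by (simp add: vld_E sn1_B)

text \<open>The value would be constant of weight 1 at the even index \<open>j\<close>, but vectors
  with constant even part have weight 0 or \<open>-1\<close> there.\<close>

lemma nf_xD:
  assumes \<phi>: "nf \<phi>" and ji: "j \<in> E" "i \<in> E" "j \<noteq> i"
  shows "\<phi> (M (sn j (Suc 0)) {} i) = 0"
proof (rule W_ext, rule ccontr)
  fix s \<beta> v
  have vl: "vld (sn j (Suc 0)) {} i" using ji by (simp add: vld_sn)
  assume "\<phi> (M (sn j (Suc 0)) {} i) s (\<beta>, v) \<noteq> 0 s (\<beta>, v)"
  then have n: "\<phi> (M (sn j (Suc 0)) {} i) s (\<beta>, v) \<noteq> 0" by (simp add: pointwise)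
  have b: "\<beta> = zr"
    by (rule nf_const[OF \<phi> vl _ n]) (use \<phi> ji in \<open>auto simp: sn_pos nf_def\<close>)
  have "wt j s \<beta> v = wt j i (sn j (Suc 0)) {}" using nf_weight(1)[OF \<phi> vl n] ji by (simp add: Y_E)
  then show False using ji one_m unfolding b by (auto simp: wt_def split: if_splits)
qed

text \<open>Brackets with the killed elements \<open>x_d D_b\<close> and \<open>x_j D_k\<close>
  connect all the vectors \<open>x_a x_b D_j\<close>, so \<open>\<phi>\<close> acts on them by a
  single scalar \<open>\<kappa>\<close>.\<close>

lemma y_step:
  assumes \<phi>: "nf2 \<phi>"
  shows "\<exists>X\<in>L. nf2 (\<phi> + ad X) \<and> (\<forall>a\<in>Od. \<forall>b\<in>Od. \<forall>j\<in>E. a \<noteq> b \<longrightarrow> (\<phi> + ad X) (M zr {a, b} j) = 0)"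
proof -
  have N: "nf \<phi>" using \<phi> by (simp add: nf2_def)
  have D: "\<phi> \<in> Der" using nf_Der[OF N] .
  define c where "c a b j = \<phi> (M zr {a, b} j) j (zr, {a, b})" for a b j
  have cc: "c a b j = c b a j" for a b j by (simp add: c_def insert_commute)
  have m: "\<phi> (M zr {a, b} j) = wsmul (c a b j) (M zr {a, b} j)" if "a \<in> Od" "b \<in> Od" "a \<noteq> b" "j \<in> E" for a b j
    unfolding c_def by (rule nf_const_mult[OF N]) (use that E_Od in \<open>auto simp: vld_y\<close>)
  have c1: "c a b j = c a d j" if "a \<in> Od" "b \<in> Od" "d \<in> Od" "a \<noteq> b" "a \<noteq> d" "j \<in> E" for a b d j
  proof (cases "b = d")
    case False
    have l: "M zr {d} b \<in> L" "M zr {a, b} j \<in> L" "M zr {a, d} j \<in> L" using that False by (simp_all add: vld_gl vld_y)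
    define e where "e = ((- 1) ^ nlt b {a, b} * osign {d} {a} :: 'a)"
    have e0: "e \<noteq> 0" by (simp add: e_def osign_ninv)
    have "{a, b} - {b} = {a}" using that by auto
    then have D1: "D b (mon (zr, {a, b})) = sc ((- 1) ^ nlt b {a, b}) (mon (zr, {a}))"
      using that by (simp add: D_mon_O)
    have D2: "D j (mon (zr, {d})) = 0" using that by (simp add: D_mon_E zr_B)
    have "br (M zr {d} b) (M zr {a, b} j) = wsmul e (M zr {a, d} j)"
      using that D1 D2 by (simp add: br_M vld_gl vld_y mul_sc mul_mon zr_B e_def insert_commute) (simp add: M_def el_sc)
    moreover have "\<phi> (br (M zr {d} b) (M zr {a, b} j)) = wsmul (c a b j) (br (M zr {d} b) (M zr {a, b} j))"
      using \<phi> D l m that False by (simp add: Der_br nf2_def br_wsmul)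
    ultimately have "wsmul (e * c a d j) (M zr {a, d} j) = wsmul (c a b j * e) (M zr {a, d} j)"
      using D l m that by (simp add: Der_wsmul)
    then have "wsmul (e * c a d j) (M zr {a, d} j) j (zr, {a, d}) = wsmul (c a b j * e) (M zr {a, d} j) j (zr, {a, d})" by simp
    then show ?thesis using that e0 by (simp add: wsmul_apply M_apply zr_B)
  qed simp
  have c2: "c a b j = c a b k" if "a \<in> Od" "b \<in> Od" "a \<noteq> b" "j \<in> E" "k \<in> E" for a b j k
  proof (cases "j = k")
    case False
    have l: "M (sn j (Suc 0)) {} k \<in> L" "M zr {a, b} j \<in> L" "M zr {a, b} k \<in> L" using that by (simp_all add: vld_sn vld_y)
    have "br (M zr {a, b} j) (M (sn j (Suc 0)) {} k) = M zr {a, b} k"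
      using that by (simp add: br_M vld_sn vld_y D_sn Y_E mul_one D_mon_E zr_B) (simp add: M_def)
    moreover have "\<phi> (br (M zr {a, b} j) (M (sn j (Suc 0)) {} k)) = wsmul (c a b j) (br (M zr {a, b} j) (M (sn j (Suc 0)) {} k))"
      using nf_xD[OF N that(4,5) False] D l m that by (simp add: Der_br br_wsmul)
    ultimately have "wsmul (c a b k) (M zr {a, b} k) = wsmul (c a b j) (M zr {a, b} k)" using m that by simp
    then have "wsmul (c a b k) (M zr {a, b} k) k (zr, {a, b}) = wsmul (c a b j) (M zr {a, b} k) k (zr, {a, b})" by simp
    then show ?thesis using that by (simp add: wsmul_apply M_apply zr_B)
  qed simp
  obtain o1 where o1: "o1 \<in> Od" using Od_other by metis
  obtain o2 where o2: "o2 \<in> Od" "o2 \<noteq> o1" using Od_other by metis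
  obtain j0 where j0: "j0 \<in> E" using E_other by metis
  define \<kappa> where "\<kappa> = c o1 o2 j0"
  have k: "c a b j = \<kappa>" if "a \<in> Od" "b \<in> Od" "a \<noteq> b" "j \<in> E" for a b j
  proof -
    have "c a b j0 = \<kappa>"
    proof (cases "a = o1")
      case True then show ?thesis using c1[of a b o2 j0] that o1 o2 j0 by (simp add: \<kappa>_def)
    next
      case False
      have "c a b j0 = c a o1 j0" using c1[of a b o1 j0] that False o1 j0 by simp
      also have "\<dots> = c o1 a j0" by (rule cc)
      also have "\<dots> = \<kappa>" using c1[of o1 a o2 j0] that False o1 o2 j0 by (simp add: \<kappa>_def)
      finally show ?thesis .
    qed
    then show ?thesis using c2[OF that(1,2,3,4) j0] by simp
  qed
  \<comment> \<open>A multiple of the sum of all odd \<open>T a\<close>: it commutes with each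
    \<open>x_a D_b\<close> and acts on each \<open>x_a x_b D_j\<close> by twice the entry, that is
    by \<open>- \<kappa>\<close>.\<close>
  define \<tau> where "\<tau> a = (if a \<in> E then 0 else - (\<kappa> / 2))" for a
  have \<tau>E: "\<tau> i = 0" if "i \<in> E" for i using that by (simp add: \<tau>_def)
  have 1: "(\<phi> + ad (tor \<tau>)) (M zr {a} b) = 0" if ab: "a \<in> Od" "b \<in> Od" "a \<noteq> b" for a b
  proof -
    have "(\<Sum>q\<in>Y. \<tau> q * wt q b zr {a}) = 0"
      using wt_sum[OF \<tau>E, where u = "{a}" and r = b and \<alpha> = zr] ab E_Od by (simp add: Y_O \<tau>_def)
    then show ?thesis using \<phi> br_tor[of zr "{a}" b \<tau>] ab by (simp add: pointwise ad_apply vld_gl nf2_def)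
  qed
  have 2: "(\<phi> + ad (tor \<tau>)) (M zr {a, b} j) = 0" if ab: "a \<in> Od" "b \<in> Od" "a \<noteq> b" "j \<in> E" for a b j
  proof -
    have "(\<Sum>q\<in>Y. \<tau> q * wt q j zr {a, b}) = - \<kappa>"
      using wt_sum[OF \<tau>E, where u = "{a, b}" and r = j and \<alpha> = zr] ab E_Od two_nz by (simp add: Y_E \<tau>_def)
    then have "(\<phi> + ad (tor \<tau>)) (M zr {a, b} j) = wsmul (\<kappa> + - \<kappa>) (M zr {a, b} j)"
      unfolding wsmul_add2 using br_tor[of zr "{a, b}" j \<tau>] ab m k by (simp add: pointwise ad_apply vld_y)
    then show ?thesis by simp
  qed
  have "nf (\<phi> + ad (tor \<tau>))" by (rule nf_tor[OF N]) (rule \<tau>E)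
  then show ?thesis using tor_L 1 2 unfolding nf2_def by blast
qed

definition nf3 :: "('a welem \<Rightarrow> 'a welem) \<Rightarrow> bool" where
  "nf3 \<phi> \<longleftrightarrow> nf2 \<phi> \<and> (\<forall>a\<in>Od. \<forall>b\<in>Od. \<forall>j\<in>E. a \<noteq> b \<longrightarrow> \<phi> (M zr {a, b} j) = 0)"

lemma ad_plus: "X \<in> L \<Longrightarrow> Z \<in> L \<Longrightarrow> ad X + ad Z = ad (X + Z)"
  by (rule ext) (simp add: ad_def br_add pointwise)

lemma normal_form:
  assumes "\<phi> \<in> Der" shows "\<exists>X\<in>L. nf3 (\<phi> + ad X)"
proof -
  obtain X1 where X1: "X1 \<in> L" "torus0 (\<phi> + ad X1)" using torus_step[OF assms] by blast
  obtain X2 where X2: "X2 \<in> L" "nf (\<phi> + ad X1 + ad X2)" using Dd_step[OF X1(2)] by blast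
  obtain X3 where X3: "X3 \<in> L" "nf2 (\<phi> + ad X1 + ad X2 + ad X3)" using gl_step[OF X2(2)] unfolding nf2_def by blast
  obtain X4 where X4: "X4 \<in> L" "nf3 (\<phi> + ad X1 + ad X2 + ad X3 + ad X4)" using y_step[OF X3(2)] unfolding nf3_def by blast
  have "\<phi> + ad X1 + ad X2 + ad X3 + ad X4 = \<phi> + ad (X1 + X2 + X3 + X4)"
    using X1 X2 X3 X4 by (simp add: ad_plus[symmetric] add.assoc)
  then show ?thesis using X1 X2 X3 X4 by (metis L_add)
qed

section \<open>Constant terms of the values on \<open>x^(\<alpha>) D_i\<close>\<close>

lemma nf3_nf: "nf3 \<phi> \<Longrightarrow> nf \<phi>" by (simp add: nf3_def nf2_def)

lemma nf3_y:
  assumes \<phi>: "nf3 \<phi>" and Z: "Z \<in> L" and ab: "a \<in> Od" "b \<in> Od" "a < b" and j: "j \<in> E"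
  shows "\<phi> (br (M zr {a, b} j) Z) = br (M zr {a, b} j) (\<phi> Z)"
proof -
  have "\<phi> (M zr {a, b} j) = 0" using \<phi> ab j unfolding nf3_def by auto
  then show ?thesis using nf_Der[OF nf3_nf[OF \<phi>]] Z ab j by (simp add: Der_br vld_y)
qed

lemma br_y_M:
  assumes ab: "a \<in> Od" "b \<in> Od" "a \<noteq> b" and j: "j \<in> E" and i: "i \<in> Y" "i \<notin> {a, b}" and v: "vld \<alpha> v i" "v \<inter> {a, b} = {}"
  shows "br (M zr {a, b} j) (M \<alpha> v i) =
    (if \<alpha> j > 0 then wsmul (osign {a, b} v) (M (\<alpha>(j := \<alpha> j - 1)) (insert a (insert b v)) i) else 0)"
proof -
  have B: "(\<alpha>, v) \<in> B" "(\<alpha>(j := \<alpha> j - 1), v) \<in> B" using v vld_lower[OF v(1), of "\<alpha> j - 1" j] by (simp_all add: vld_def)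
  have "D i (mon (zr, {a, b})) = 0" using i ab E_Od by (auto simp: Y_iff D_mon_E D_mon_O zr_B)
  then show ?thesis using ab j v B
    by (simp add: br_M vld_y D_mon_E mul_mon zr_B Int_commute) (simp add: el_sc M_def)
qed

text \<open>Otherwise a divergence-type cocycle \<open>f D_i \<mapsto> D_i(f) \<Sum> x_a D_a\<close> could survive: it is excluded by
  computing \<open>\<phi>(x^(\<alpha> - \<epsilon>_l) x_a x_b D_i)\<close> from \<open>x^\<alpha> D_i\<close> in two ways.\<close>

lemma nf3_q:
  assumes \<phi>: "nf3 \<phi>" and i: "i \<in> E" and v: "vld \<alpha> {} i" and a: "a \<in> Od"
  shows "\<phi> (M \<alpha> {} i) a (zr, {a}) = 0"
proof (rule pair_zero[OF _ a])
  note N = nf3_nf[OF \<phi>] 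
  note D = nf_Der[OF N]
  fix a b assume ab: "a \<in> Od" "b \<in> Od" "a < b"
  define Z where "Z = \<phi> (M \<alpha> {} i)"
  have ZL: "Z \<in> L" using D v by (simp add: Z_def)
  have abB: "(zr, {a, b}) \<in> B" using ab by (simp add: zr_B)
  show "\<phi> (M \<alpha> {} i) a (zr, {a}) + \<phi> (M \<alpha> {} i) b (zr, {b}) = 0"
  proof (rule ccontr)
    assume n: "\<phi> (M \<alpha> {} i) a (zr, {a}) + \<phi> (M \<alpha> {} i) b (zr, {b}) \<noteq> 0"
    then obtain d where d: "d \<in> Od" "\<phi> (M \<alpha> {} i) d (zr, {d}) \<noteq> 0" using ab by (metis add.right_neutral)
    have "wt i d zr {d} = wt i i \<alpha> {}" using nf_weight(1)[OF N v d(2)] i by (simp add: Y_E)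
    moreover have "d \<noteq> i" using i d E_Od by blast
    \<comment> \<open>So \<open>\<alpha> i\<close> is not the top exponent, which is
      \<open>-1\<close> in the field; this leaves room for \<open>?a\<close> below.\<close>
    ultimately have ai: "(of_nat (\<alpha> i) :: 'a) = 1" using i by (simp add: wt_def)
    obtain l where l: "l \<in> E" "l \<noteq> i" using E_other by metis
    \<comment> \<open>In the direction \<open>D_l\<close> the unwanted sum shows up only when the
      bracket is taken with \<open>x_a x_b D_l\<close> itself.\<close>
    have key: "\<phi> (br (M zr {a, b} j) (M \<beta> {} i)) l (zr, {a, b}) =
        \<phi> (br (Dd j) (M \<beta> {} i)) l (zr, {}) -
        (if l = j then \<phi> (M \<beta> {} i) a (zr, {a}) + \<phi> (M \<beta> {} i) b (zr, {b}) else 0)"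
      if "j \<in> E" "vld \<beta> {} i" for j \<beta>
      using that br_y[OF ab that(1) Der_L[OF D M_L[OF that(2)]] abB] nf3_y[OF \<phi> M_L[OF that(2)] ab that(1)]
        nf_shift[OF N M_L[OF that(2)] that(1), of l zr "{}"] by simp
    show False
    proof (cases "\<alpha> l > 0")
      case False
      then have "br (M zr {a, b} l) (M \<alpha> {} i) = 0" "br (Dd l) (M \<alpha> {} i) = 0"
        using br_y_M[of a b l i \<alpha> "{}"] br_Dd_M[OF l(1) v] ab l i v E_Od by (auto simp: Y_E)
      then have "\<phi> (br (M zr {a, b} l) (M \<alpha> {} i)) l (zr, {a, b}) = 0" "\<phi> (br (Dd l) (M \<alpha> {} i)) l (zr, {}) = 0"
        using D by (simp_all add: pointwise)
      moreover have "\<phi> (br (M zr {a, b} l) (M \<alpha> {} i)) l (zr, {a, b}) = \<phi> (br (Dd l) (M \<alpha> {} i)) l (zr, {}) -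
          (\<phi> (M \<alpha> {} i) a (zr, {a}) + \<phi> (M \<alpha> {} i) b (zr, {b}))"
        using key[OF l(1) v] by simp
      ultimately show False using n by (metis diff_0 neg_equal_0_iff_equal)
    next
      case True
      let ?d = "\<alpha>(l := \<alpha> l - 1)"
      \<comment> \<open>Bracketing \<open>x^(?a) D_i\<close> with \<open>x_a x_b D_i\<close> gives
        the same vector as bracketing \<open>x^(\<alpha>) D_i\<close> with
        \<open>x_a x_b D_l\<close>, but without the sum in \<open>key\<close>.\<close>
      let ?a = "?d(i := Suc (?d i))"
      have ib: "i \<notin> {a, b}" using i ab E_Od by auto
      have vd: "vld ?d {} i" using v by (simp add: vld_lower)
      have "?d i \<noteq> pi i" using ai of_nat_pi[OF i] one_m l by auto
      moreover have "?d i \<le> pi i" by (rule vld_le[OF vd i])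
      ultimately have va: "vld ?a {} i" using vd B_raise[OF i, of ?d "{}"] by (simp add: vld_def)
      have down: "?a(i := ?a i - 1) = ?d" by (simp add: fun_upd_idem)
      have 1: "br (M zr {a, b} l) (M \<alpha> {} i) = M ?d {a, b} i" "br (Dd l) (M \<alpha> {} i) = M ?d {} i"
        using br_y_M[of a b l i \<alpha> "{}"] br_Dd_M[OF l(1) v] ab l i ib v True by (auto simp: Y_E)
      have 2: "br (M zr {a, b} i) (M ?a {} i) = M ?d {a, b} i" "br (Dd i) (M ?a {} i) = M ?d {} i"
        using br_y_M[of a b i i ?a "{}"] br_Dd_M[OF i va] ab i ib va unfolding down by (auto simp: Y_E)
      have "\<phi> (M ?d {a, b} i) l (zr, {a, b}) = \<phi> (M ?d {} i) l (zr, {}) -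
          (\<phi> (M \<alpha> {} i) a (zr, {a}) + \<phi> (M \<alpha> {} i) b (zr, {b}))"
        using key[OF l(1) v] unfolding 1 by simp
      moreover have "\<phi> (M ?d {a, b} i) l (zr, {a, b}) = \<phi> (M ?d {} i) l (zr, {})"
        using key[OF i va] l unfolding 2 by simp
      ultimately show False using n by (metis diff_left_imp_eq diff_zero)
    qed
  qed
qed

text \<open>A probe for constant terms: bracketing with \<open>x_k D_l\<close> transports the
  constant coefficient of \<open>D_k\<close> to \<open>D_l\<close>.\<close>

lemma br_const_sn:
  assumes "k \<in> E" "l \<in> E" "Z \<in> L"
  shows "br (M (sn k (Suc 0)) {} l) Z l (zr, {}) = - Z k (zr, {})"
proof -
  have "zr \<noteq> sn k (Suc 0)" by (metis sn_eq_0 nat.distinct(1))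
  then have a: "M (sn k (Suc 0)) {} l r (zr, {}) = 0" for r by (simp add: M_apply)
  have "sn r (Suc 0) = sn k (Suc 0) \<longleftrightarrow> r = k" for r by (metis sn_apply nat.distinct(1))
  then have b: "M (sn k (Suc 0)) {} l l (sn r 1, {}) = (if r = k then 1 else 0)" for r
    using assms by (simp add: M_apply sn1_B)
  have "br (M (sn k (Suc 0)) {} l) Z l (zr, {}) = (\<Sum>r\<in>E. - (if r = k then Z r (zr, {}) else 0))"
    unfolding br_const[OF M_L[OF vld_sn[OF assms(1,2)]] assms(3)] a b by (rule sum.cong) auto
  then show ?thesis using assms by (simp add: sum_negf)
qed

lemma br_xD_M:
  assumes kl: "k \<in> E" "l \<in> E" "k \<noteq> l" and i: "i \<in> E" and v: "vld \<alpha> {} i"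
  shows "br (M (sn k (Suc 0)) {} l) (M \<alpha> {} i) =
    (if \<alpha> l > 0 then wsmul (of_nat (Suc (\<alpha> k))) (M (\<alpha>(l := \<alpha> l - 1, k := Suc (\<alpha> k))) {} i) else 0)
    - (if i = k then M \<alpha> {} l else 0)"
proof -
  have B: "(\<alpha>, {}) \<in> B" "(\<alpha>(l := \<alpha> l - 1), {}) \<in> B" using v vld_lower[OF v(1), of "\<alpha> l - 1" l] by (simp_all add: vld_def)
  have 1: "mon (sn k (Suc 0), {}) \<odot> D l (mon (\<alpha>, {})) =
      (if \<alpha> l > 0 then sc (of_nat (Suc (\<alpha> k))) (mon (\<alpha>(l := \<alpha> l - 1, k := Suc (\<alpha> k)), {})) else 0)"
    using kl B by (simp add: D_mon_E mul_mon sn1_B dpcoef_sn sn_add)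
  have 2: "mon (\<alpha>, {}) \<odot> D i (mon (sn k (Suc 0), {})) = (if i = k then mon (\<alpha>, {}) else 0)"
    using kl i by (simp add: D_sn Y_E mul_one)
  show ?thesis using kl v by (simp add: br_M vld_sn 1 2) (simp add: M_def el_sc)
qed

text \<open>Weights leave only \<open>D_s\<close> with \<open>s\<close> even and
  \<open>x_s D_s\<close> with \<open>s\<close> odd, and \<open>nf3_q\<close> removes the latter. An
  even \<open>s \<noteq> i\<close> forces \<open>\<alpha> s\<close> to be \<open>-1\<close> in the
  field; then \<open>[x_s D_l, x^(\<alpha>) D_i] = 0\<close>, whereas \<open>br_const_sn\<close>
  would detect the constant term.\<close>

lemma nf3_W_const:
  assumes \<phi>: "nf3 \<phi>" and i: "i \<in> E" and v: "vld \<alpha> {} i" and n: "\<phi> (M \<alpha> {} i) s (zr, w) \<noteq> 0"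
  shows "s = i \<and> w = {}"
proof -
  note N = nf3_nf[OF \<phi>] 
  note D = nf_Der[OF N]
  note W = nf_weight[OF N v n]
  have s: "s \<in> Y" and wO: "w \<subseteq> Od" using W(2) by (auto simp: vld_def zr_B)
  have q: "q \<in> w \<longleftrightarrow> q = s" if "q \<in> Od" for q
    using bspec[OF W(1), of q] that i E_Od(3)[OF that] by (auto simp: wt_def Y_iff split: if_splits)
  have sE: "s \<in> E"
  proof (rule ccontr)
    assume "s \<notin> E"
    then have "s \<in> Od" using s by (simp add: Y_iff)
    then have "w = {s}" using q wO by blast
    then show False using nf3_q[OF \<phi> i v \<open>s \<in> Od\<close>] n by simp
  qed
  then have w: "w = {}" using q wO E_Od by blast
  have "s = i"
  proof (rule ccontr)
    assume ne: "s \<noteq> i"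
    obtain l where l: "l \<in> E" "l \<noteq> s" using E_other by metis
    have "wt s s zr w = wt s i \<alpha> {}" using W(1) s by blast
    then have as: "(of_nat (Suc (\<alpha> s)) :: 'a) = 0" using sE ne by (simp add: wt_def) (metis add.right_inverse)
    have b0: "br (M (sn s (Suc 0)) {} l) (M \<alpha> {} i) = 0"
      using br_xD_M[OF sE l(1) _ i v] l ne unfolding as by simp
    have b1: "\<phi> (br (M (sn s (Suc 0)) {} l) (M \<alpha> {} i)) = br (M (sn s (Suc 0)) {} l) (\<phi> (M \<alpha> {} i))"
      using nf_xD[OF N sE l(1)] l D v sE by (simp add: Der_br vld_sn)
    have "br (M (sn s (Suc 0)) {} l) (\<phi> (M \<alpha> {} i)) l (zr, {}) = 0"
      unfolding b1[symmetric] b0 Der_0[OF D] by (simp add: pointwise)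
    then show False using br_const_sn[OF sE l(1), of "\<phi> (M \<alpha> {} i)"] n D v w by simp
  qed
  with w show ?thesis by simp
qed

text \<open>Apply \<open>\<phi>\<close> to \<open>[x_i D_l, x^(\<alpha>) D_i]\<close>, which is
  \<open>- x^(\<alpha>) D_l\<close> plus a multiple of another \<open>x^(\<beta>) D_i\<close>, and
  compare the constant coefficients of \<open>D_l\<close>. By \<open>nf3_W_const\<close> the extra
  term has none.\<close>

lemma nf3_c_indep:
  assumes \<phi>: "nf3 \<phi>" and i: "i \<in> E" and l: "l \<in> E" and v: "vld \<alpha> {} i"
  shows "\<phi> (M \<alpha> {} i) i (zr, {}) = \<phi> (M \<alpha> {} l) l (zr, {})"
proof (cases "i = l")
  case False
  note N = nf3_nf[OF \<phi>] 
  note D = nf_Der[OF N]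
  let ?X = "M (sn i (Suc 0)) {} l"
  let ?b = "\<alpha>(l := \<alpha> l - 1, i := Suc (\<alpha> i))"
  have vl: "vld \<alpha> {} l" using v l i by (simp add: vld_E)
  have bL: "M ?b {} i \<in> L" using i by (intro M_L2) (auto simp: tau_E Y_E)
  have b0: "\<phi> (M ?b {} i) l (zr, {}) = 0"
  proof (cases "(?b, {}) \<in> B")
    case True
    then show ?thesis using nf3_W_const[OF \<phi> i, of ?b l "{}"] i False by (auto simp: vld_E)
  next
    case F: False
    then have "M ?b {} i = 0" by (simp add: M_def)
    then show ?thesis using D by (simp add: pointwise)
  qed
  have e: "br ?X (M \<alpha> {} i) = (if \<alpha> l > 0 then wsmul (of_nat (Suc (\<alpha> i))) (M ?b {} i) else 0) - M \<alpha> {} l"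
    using br_xD_M[OF i l False i v] by simp
  have "\<phi> (br ?X (M \<alpha> {} i)) = br ?X (\<phi> (M \<alpha> {} i))"
    using nf_xD[OF N i l False] D v i l by (simp add: Der_br vld_sn)
  then have "\<phi> (br ?X (M \<alpha> {} i)) l (zr, {}) = - \<phi> (M \<alpha> {} i) i (zr, {})"
    using br_const_sn[OF i l, of "\<phi> (M \<alpha> {} i)"] D v by simp
  moreover have "\<phi> (br ?X (M \<alpha> {} i)) l (zr, {}) = - \<phi> (M \<alpha> {} l) l (zr, {})"
    unfolding e using D bL vl b0 by (simp add: Der_diff Der_wsmul pointwise wsmul_apply)
  ultimately show ?thesis by simp
qed simp

text \<open>If \<open>\<alpha>\<close> is not a prime power at a single index, then \<open>x^\<alpha> D_j\<close> is up to a nonzero scalar the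
  bracket of \<open>x^\<beta> D_j\<close> and \<open>x^(\<alpha> - \<beta> + \<epsilon>_j) D_j\<close>, where \<open>\<phi>\<close> takes values without constant terms
  that could contribute to \<open>D_j\<close>.\<close>

lemma nf3_prime_power:
  assumes \<phi>: "nf3 \<phi>" and i: "i \<in> E" and v: "vld \<alpha> {} i" and n: "\<phi> (M \<alpha> {} i) i (zr, {}) \<noteq> 0"
  shows "\<exists>k\<in>E. \<exists>e. 1 \<le> e \<and> e < t k \<and> \<alpha> = sn k (p ^ e)"
proof -
  note N = nf3_nf[OF \<phi>] 
  note D = nf_Der[OF N]
  \<comment> \<open>A constant term in \<open>D_i\<close> has the weight of \<open>D_i\<close>,
    hence every exponent of \<open>\<alpha>\<close> is 0 in the field.\<close>
  have dvd: "p dvd \<alpha> k" if "k \<in> E" for k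
  proof -
    have "wt k i zr {} = wt k i \<alpha> {}" using nf_weight(1)[OF N v n] that by (simp add: Y_E)
    then have "(of_nat (\<alpha> k) :: 'a) = 0" using that by (simp add: wt_def)
    then show ?thesis by (simp add: of_nat_eq_0_iff_char_dvd char_p)
  qed
  have B: "(\<alpha>, {}) \<in> B" using v by (simp add: vld_def)
  have "\<alpha> \<noteq> zr" using n N i by (auto simp: nf_def pointwise)
  then obtain k where k: "k \<in> E" "\<alpha> k > 0" using B_pos[OF B] by blast
  have le: "\<alpha> k \<le> pi k" by (rule vld_le[OF v k(1)])
  obtain q e where q: "\<alpha> k = p ^ e * q" "\<not> p dvd q"
    using multiplicity_decompose'[of "\<alpha> k" p] k prime_p by (metis not_prime_unit neq0_conv)
  have e1: "1 \<le> e" using q dvd[OF k(1)] by (cases e) auto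
  show ?thesis
  proof (cases "\<alpha> = sn k (p ^ e)")
    case True
    then have "p ^ e \<le> pi k" using le by simp
    then have "p ^ e < p ^ t k" by (metis Suc_pred' le_imp_less_Suc p_pos zero_less_power diff_Suc_1 One_nat_def)
    then have "e < t k" using p_gt power_less_imp_less_exp[of p e "t k"] by simp
    then show ?thesis using True k e1 by blast
  next
    case False
    \<comment> \<open>The exponent to split off at \<open>k\<close>. If \<open>\<alpha>\<close>
      lives at \<open>k\<close> alone it is \<open>p ^ e\<close>, a proper part because
      \<open>q \<noteq> 1\<close>; otherwise it is all of \<open>\<alpha> k\<close>. Either way a
      nonzero rest remains.\<close>
    have "\<exists>b. 0 < b \<and> b \<le> \<alpha> k \<and> p dvd b \<and> \<alpha>(k := \<alpha> k - b) \<noteq> zr \<and> (of_nat (\<alpha> k choose b) :: 'a) \<noteq> 0"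
    proof (cases "\<alpha> = sn k (\<alpha> k)")
      case True
      have q0: "q \<noteq> 0" "q \<noteq> 1" using q k False True by auto
      have "p ^ e dvd \<alpha> k" using q by simp
      then have "p ^ e \<le> \<alpha> k" using k dvd_imp_le by blast
      moreover have "p ^ e \<noteq> \<alpha> k" using q q0 by simp
      moreover have "(\<alpha>(k := \<alpha> k - p ^ e)) k = \<alpha> k - p ^ e" by simp
      ultimately have "\<alpha>(k := \<alpha> k - p ^ e) \<noteq> zr" by (metis diff_is_0_eq le_antisym)
      moreover have "\<not> p dvd (\<alpha> k choose p ^ e)" using not_dvd_choose_prime_power[OF prime_p q(2), of e] q(1) by simp
      moreover have "p dvd p ^ e" using e1 by (simp add: dvd_power)
      ultimately show ?thesis using \<open>p ^ e \<le> \<alpha> k\<close>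
        by (intro exI[of _ "p ^ e"]) (simp add: of_nat_eq_0_iff_char_dvd char_p)
    next
      case F: False
      have "\<alpha>(k := \<alpha> k - \<alpha> k) \<noteq> zr"
      proof
        assume "\<alpha>(k := \<alpha> k - \<alpha> k) = zr"
        then have "\<alpha> = sn k (\<alpha> k)" by (auto simp: fun_eq_iff sn_def split: if_splits)
        with F show False by simp
      qed
      then show ?thesis using k dvd by (intro exI[of _ "\<alpha> k"]) simp
    qed
    then obtain b where b: "0 < b" "b \<le> \<alpha> k" "p dvd b" "\<alpha>(k := \<alpha> k - b) \<noteq> zr" "(of_nat (\<alpha> k choose b) :: 'a) \<noteq> 0" by blast
    obtain j where j: "j \<in> E" "j \<noteq> k" using E_other by metis
    let ?g = "\<alpha>(k := \<alpha> k - b)"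
    let ?g' = "?g(j := Suc (?g j))"
    let ?X = "M (sn k b) {} j" let ?Z = "M ?g' {} j"
    have b1: "b \<noteq> 1" using b(3) p_gt by auto
    have vX: "vld (sn k b) {} j" using k j le b by (simp add: vld_E sn_B)
    have vg: "vld ?g {} j" using v i j by (simp add: vld_E B_lower)
    \<comment> \<open>The exponent at \<open>j\<close> is 0 in the field and the top exponent is
      \<open>-1\<close>, so one more \<open>x_j\<close> fits.\<close>
    have "(of_nat (\<alpha> j) :: 'a) = 0" using dvd[OF j(1)] by (simp add: of_nat_eq_0_iff_char_dvd char_p)
    then have "?g j \<noteq> pi j" using of_nat_pi[OF j(1)] j by auto
    moreover have "?g j \<le> pi j" by (rule vld_le[OF vg j(1)])
    ultimately have vZ: "vld ?g' {} j" using vg B_raise[OF j(1), of ?g "{}"] by (simp add: vld_def)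
    have d: "D j (mon (?g', {})) = mon (?g, {})"
      using vZ j by (simp add: D_mon_E vld_def fun_upd_idem)
    have d2: "D j (mon (sn k b, {})) = 0" using vX j by (simp add: D_mon_E vld_def sn_pos)
    have "mon (sn k b, {}) \<odot> mon (?g, {}) = sc (of_nat (\<alpha> k choose b)) (mon (\<alpha>, {}))"
      using vX vg k b by (simp add: mul_mon vld_def dpcoef_sn sn_add fun_upd_idem)
    then have "br ?X ?Z = wsmul (of_nat (\<alpha> k choose b)) (M \<alpha> {} j)"
      unfolding br_M[OF vX vZ] d d2 by (simp add: el_sc M_def)
    moreover have vj: "vld \<alpha> {} j" using v i j by (simp add: vld_E)
    ultimately have "\<phi> (br ?X ?Z) j (zr, {}) = of_nat (\<alpha> k choose b) * \<phi> (M \<alpha> {} j) j (zr, {})"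
      using D by (simp add: Der_wsmul wsmul_apply)
    moreover have "\<phi> (M \<alpha> {} j) j (zr, {}) = \<phi> (M \<alpha> {} i) i (zr, {})"
      using nf3_c_indep[OF \<phi> i j(1) v] by simp
    ultimately have nz: "\<phi> (br ?X ?Z) j (zr, {}) \<noteq> 0" using b(5) n by simp
    obtain l where l: "?g l > 0" using b(4) by (metis neq0_conv ext)
    have g0: "?g' \<noteq> zr" by (metis fun_upd_same nat.distinct(1))
    have g1: "?g' \<noteq> sn r 1" for r
    proof
      assume a: "?g' = sn r 1"
      then have "sn r 1 j = Suc (?g j)" "l \<noteq> j \<Longrightarrow> sn r 1 l = ?g l" by (metis fun_upd_same, metis fun_upd_other)
      then show False using l by (cases "l = j") (auto simp: sn_def split: if_splits)
    qed
    have s0: "sn k b \<noteq> sn r 1" for r using b b1 by (metis sn_apply(1) sn_apply(2) less_numeral_extra(3))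
    \<comment> \<open>By \<open>br_const\<close> only constant and linear coefficients of
      \<open>?X\<close> and \<open>?Z\<close> matter, and there are none: \<open>b\<close> is a
      positive multiple of \<open>p\<close>, and \<open>?g'\<close> has degree at least 2.\<close>
    have "br (\<phi> ?X) ?Z j (zr, {}) = 0"
      unfolding br_const[OF Der_L[OF D M_L[OF vX]] M_L[OF vZ]] using g0[symmetric] g1[symmetric] by (intro sum.neutral) (auto simp: M_apply)
    moreover have "br ?X (\<phi> ?Z) j (zr, {}) = 0"
    proof -
      have "zr \<noteq> sn k b" using b by (metis sn_eq_0 less_numeral_extra(3))
      then have "?X r (zr, {}) = 0" "?X j (sn r 1, {}) = 0" for r using s0[of r, symmetric] by (simp_all add: M_apply)
      then show ?thesis unfolding br_const[OF M_L[OF vX] Der_L[OF D M_L[OF vZ]]] by (simp only: mult_zero_left mult_zero_right diff_self sum.neutral_const)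
    qed
    ultimately have "\<phi> (br ?X ?Z) j (zr, {}) = 0" using D vX vZ by (simp add: Der_br pointwise)
    with nz show ?thesis by simp
  qed
qed

section \<open>Powers of the inner derivations by even partial derivatives\<close>

definition dpow :: "nat \<Rightarrow> nat \<Rightarrow> 'a welem \<Rightarrow> 'a welem" where
  "dpow k N = (br (Dd k) ^^ N)"

lemma dpow_L [simp]: "k \<in> E \<Longrightarrow> Z \<in> L \<Longrightarrow> dpow k N Z \<in> L"
  unfolding dpow_def by (induction N) simp_all

lemma dpow_Suc: "dpow k (Suc N) Z = br (Dd k) (dpow k N Z)"
  by (simp add: dpow_def)

lemma dpow_0 [simp]: "dpow k 0 Z = Z"
  by (simp add: dpow_def)

lemma dpow_apply: "k \<in> E \<Longrightarrow> Z \<in> L \<Longrightarrow> dpow k N Z s (\<beta>, v) = Z s (\<beta>(k := \<beta> k + N), v)"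
proof (induction N arbitrary: \<beta>)
  case (Suc N)
  have e: "(\<beta>(k := Suc (\<beta> k)))(k := (\<beta>(k := Suc (\<beta> k))) k + N) = \<beta>(k := \<beta> k + Suc N)" by simp
  have "dpow k (Suc N) Z s (\<beta>, v) = dpow k N Z s (\<beta>(k := Suc (\<beta> k)), v)"
    using Suc.prems by (simp add: dpow_Suc br_Dd)
  also have "\<dots> = Z s ((\<beta>(k := Suc (\<beta> k)))(k := (\<beta>(k := Suc (\<beta> k))) k + N), v)"
    by (rule Suc.IH[OF Suc.prems])
  finally show ?case unfolding e .
qed simp

lemma dpow_leibniz:
  assumes k: "k \<in> E" and x: "x \<in> L" and y: "y \<in> L"
  shows "dpow k N (br x y) s (\<beta>, v) =
    (\<Sum>j\<le>N. of_nat (N choose j) * br (dpow k j x) (dpow k (N - j) y) s (\<beta>, v))"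
proof (induction N arbitrary: \<beta>)
  case (Suc N)
  define g where "g j = br (dpow k j x) (dpow k (Suc N - j) y) s (\<beta>, v)" for j
  have st: "br (dpow k j x) (dpow k (N - j) y) s (\<beta>(k := Suc (\<beta> k)), v) = g (Suc j) + g j" if "j \<le> N" for j
  proof -
    have "br (dpow k j x) (dpow k (N - j) y) s (\<beta>(k := Suc (\<beta> k)), v)
        = br (Dd k) (br (dpow k j x) (dpow k (N - j) y)) s (\<beta>, v)"
      using k x y by (simp add: br_Dd)
    moreover have J: "br (Dd k) (br (dpow k j x) (dpow k (N - j) y))
        = br (dpow k (Suc j) x) (dpow k (N - j) y) + br (dpow k j x) (dpow k (Suc (N - j)) y)"
      unfolding dpow_Suc by (rule br_jacobi) (use k x y in auto)
    ultimately show ?thesis using that by (simp only: J g_def pointwise Suc_diff_le diff_Suc_Suc)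
  qed
  have "dpow k (Suc N) (br x y) s (\<beta>, v) = dpow k N (br x y) s (\<beta>(k := Suc (\<beta> k)), v)"
    using k x y by (simp add: dpow_Suc br_Dd)
  also have "\<dots> = (\<Sum>j\<le>N. of_nat (N choose j) * br (dpow k j x) (dpow k (N - j) y) s (\<beta>(k := Suc (\<beta> k)), v))"
    by (rule Suc)
  also have "\<dots> = (\<Sum>j\<le>N. of_nat (N choose j) * (g (Suc j) + g j))"
    by (rule sum.cong) (use st in auto)
  also have "\<dots> = (\<Sum>j\<le>Suc N. of_nat (Suc N choose j) * g j)" by (rule pascal_sum)
  finally show ?case by (simp only: g_def)
qed simp

definition P :: "nat \<Rightarrow> nat \<Rightarrow> 'a welem \<Rightarrow> 'a welem" where
  "P k e = (\<lambda>Z. if Z \<in> L then dpow k (p ^ e) Z else 0)"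

lemma P_apply: "k \<in> E \<Longrightarrow> Z \<in> L \<Longrightarrow> P k e Z s (\<beta>, v) = Z s (\<beta>(k := \<beta> k + p ^ e), v)"
  by (simp add: P_def dpow_apply)

text \<open>In the Leibniz formula for the \<open>p ^ e\<close>-th power all inner binomials are
  zero in the field; only the two outer terms remain.\<close>

lemma P_br:
  assumes k: "k \<in> E" and x: "x \<in> L" and y: "y \<in> L"
  shows "P k e (br x y) = br (P k e x) y + br x (P k e y)"
proof (rule W_ext)
  fix s \<beta> v
  let ?N = "p ^ e"
  let ?f = "\<lambda>j. of_nat (?N choose j) * br (dpow k j x) (dpow k (?N - j) y) s (\<beta>, v)"
  have N: "?N > 0" by simp
  have "P k e (br x y) s (\<beta>, v) = (\<Sum>j\<le>?N. ?f j)"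
    using x y dpow_leibniz[OF k x y] by (simp add: P_def)
  also have "\<dots> = (\<Sum>j\<in>{0, ?N}. ?f j)"
  proof (rule sum.mono_neutral_right)
    show "\<forall>j\<in>{..?N} - {0, ?N}. ?f j = 0"
    proof
      fix j assume "j \<in> {..?N} - {0, ?N}"
      then have "(of_nat (?N choose j) :: 'a) = 0" by (intro of_nat_choose_prime_power) auto
      then show "?f j = 0" by simp
    qed
  qed auto
  also have "\<dots> = ?f 0 + ?f ?N" using N by simp
  also have "\<dots> = (br (P k e x) y + br x (P k e y)) s (\<beta>, v)"
    using x y by (simp add: P_def pointwise)
  finally show "P k e (br x y) s (\<beta>, v) = (br (P k e x) y + br x (P k e y)) s (\<beta>, v)" .
qed

lemma P_L: "k \<in> E \<Longrightarrow> Z \<in> L \<Longrightarrow> P k e Z \<in> L"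
  by (simp add: P_def)

lemma P_Der: "k \<in> E \<Longrightarrow> P k e \<in> Der"
  unfolding DerW_def
proof (intro CollectI conjI ballI allI impI)
  fix x y :: "'a welem" and c assume k: "k \<in> E" and x: "x \<in> L"
  show "P k e x \<in> L" using k x by (rule P_L)
  show "P k e (wsmul c x) = wsmul c (P k e x)"
    by (rule W_ext) (use k x in \<open>simp add: P_apply wsmul_apply\<close>)
  assume y: "y \<in> L"
  show "P k e (x + y) = P k e x + P k e y"
    by (rule W_ext) (use k x y in \<open>simp add: P_apply pointwise\<close>)
  show "P k e (br x y) = br (P k e x) y + br x (P k e y)" by (rule P_br[OF k x y])
qed (simp add: P_def)

text \<open>The case \<open>e = 0\<close> is left out because \<open>P k 0\<close> is
  \<open>ad (Dd k)\<close>; from \<open>e = t k\<close> on the shift exceeds every exponent and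
  \<open>P k e\<close> is zero.\<close>

definition Ix :: "(nat \<times> nat) set" where
  "Ix = {(k, e). k \<in> E \<and> 1 \<le> e \<and> e < t k}"

lemma Ix_Sigma: "Ix = (SIGMA k:E. {1..<t k})"
  by (auto simp: Ix_def)

lemma finite_Ix [simp]: "finite Ix" by (simp add: Ix_Sigma)

definition Q :: "(nat \<times> nat \<Rightarrow> 'a) \<Rightarrow> 'a welem \<Rightarrow> 'a welem" where
  "Q c = (\<Sum>i\<in>Ix. escale (c i) (P (fst i) (snd i)))"

lemma Q_Der: "Q c \<in> Der"
  unfolding Q_def by (intro Der_sum Der_escale P_Der) (auto simp: Ix_def)

lemma Q_apply:
  assumes Z: "Z \<in> L"
  shows "Q c Z s (\<beta>, v) = (\<Sum>(k, e)\<in>Ix. c (k, e) * Z s (\<beta>(k := \<beta> k + p ^ e), v))"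
  unfolding Q_def sum_apply'[where x = Z] sum_apply'[where x = s] sum_apply'[where x = "(\<beta>, v)"]
  by (rule sum.cong) (use Z in \<open>auto simp: Ix_def escale_def wsmul_apply P_apply\<close>)

lemma p_pow_ge: "1 \<le> e \<Longrightarrow> p ^ e \<ge> 2"
  using power_increasing[of 1 e p] p_gt by simp

text \<open>Each power in \<open>Q\<close> shifts an exponent by at least \<open>p\<close>. All the
  elements normalised so far have exponents at most 1, so adding \<open>Q c\<close> keeps the normal
  form.\<close>

lemma Q_low:
  assumes v: "vld \<alpha> u r" and a: "\<And>k. \<alpha> k \<le> 1"
  shows "Q c (M \<alpha> u r) = 0"
proof (rule W_ext)
  fix s \<beta> w
  have "M \<alpha> u r s (\<beta>(k := \<beta> k + p ^ e), w) = 0" if "(k, e) \<in> Ix" for k e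
  proof -
    have "(\<beta>(k := \<beta> k + p ^ e)) k \<ge> 2" using p_pow_ge[of e] that by (simp add: Ix_def)
    then have "\<beta>(k := \<beta> k + p ^ e) \<noteq> \<alpha>" using a[of k] by auto
    then show ?thesis by (simp add: M_apply)
  qed
  then show "Q c (M \<alpha> u r) s (\<beta>, w) = 0 s (\<beta>, w)"
    unfolding Q_apply[OF M_L[OF v]] pointwise by (intro sum.neutral) auto
qed

lemma nf3_plus_Q:
  assumes \<phi>: "nf3 \<phi>" shows "nf3 (\<phi> + Q c)"
proof -
  have T: "Q c (T q) = 0" if "q \<in> Y" for q
    unfolding T_M by (rule Q_low[OF T_vld[OF that]]) (simp add: sn_def)
  have D: "Q c (Dd i) = 0" if "i \<in> E" for i
    by (rule Q_low) (use that in \<open>simp_all add: vld_E zr_B\<close>)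
  have G: "Q c (M zr {a} b) = 0" if "a \<in> Od" "b \<in> Od" for a b
    by (rule Q_low) (use that in \<open>simp_all add: vld_gl\<close>)
  have y: "Q c (M zr {a, b} j) = 0" if "a \<in> Od" "b \<in> Od" "a \<noteq> b" "j \<in> E" for a b j
    by (rule Q_low) (use that in \<open>simp_all add: vld_y\<close>)
  show ?thesis using \<phi> T D G y Q_Der Der_plus
    unfolding nf3_def nf2_def nf_def torus0_def by (simp add: pointwise)
qed

lemma vld_sn_pow: "(k, e) \<in> Ix \<Longrightarrow> i \<in> E \<Longrightarrow> vld (sn k (p ^ e)) {} i"
proof -
  assume a: "(k, e) \<in> Ix" "i \<in> E"
  then have "p ^ e < p ^ t k" using p_gt by (simp add: Ix_def)
  then have "p ^ e \<le> pi k" by simp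
  then show ?thesis using a by (simp add: vld_E sn_B Ix_def)
qed

text \<open>The vectors at \<open>sn k (p ^ e)\<close> are dual to the powers. They prescribe the
  correction in \<open>kill_W\<close> and later prove independence.\<close>

lemma Q_sn:
  assumes ke: "(k, e) \<in> Ix" and i: "i \<in> E"
  shows "Q c (M (sn k (p ^ e)) {} i) i (zr, {}) = c (k, e)"
proof -
  note v = vld_sn_pow[OF ke i]
  have eq: "zr(k' := p ^ e') = sn k (p ^ e) \<longleftrightarrow> k' = k \<and> e' = e" if "(k', e') \<in> Ix" for k' e'
  proof
    assume h: "zr(k' := p ^ e') = sn k (p ^ e)"
    then have "(zr(k' := p ^ e')) k' = sn k (p ^ e) k'" by simp
    then have "k' = k" "p ^ e' = p ^ e" using p_gt by (auto simp: sn_def split: if_splits)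
    then show "k' = k \<and> e' = e" using p_gt by simp
  qed (auto simp: sn_def)
  have B: "(sn k (p ^ e), {}) \<in> B" using v by (simp add: vld_def)
  have "Q c (M (sn k (p ^ e)) {} i) i (zr, {}) = (\<Sum>x\<in>Ix. if x = (k, e) then c (k, e) else 0)"
    unfolding Q_apply[OF M_L[OF v]] by (rule sum.cong) (use eq B in \<open>auto simp: M_apply split: if_splits\<close>)
  then show ?thesis using ke by simp
qed

text \<open>\<open>Q c\<close> cancels the constant terms at prime powers, the only places where any
  can occur. Induction on the total degree then finishes, since \<open>nf_const\<close> reduces a
  value to its constant terms once the lower monomials are killed.\<close>

lemma kill_W:
  assumes \<phi>: "nf3 \<phi>"
  shows "\<exists>c. \<forall>\<alpha> i. i \<in> E \<longrightarrow> vld \<alpha> {} i \<longrightarrow> (\<phi> + Q c) (M \<alpha> {} i) = 0"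
proof -
  \<comment> \<open>The coefficient is read off in direction \<open>k\<close>; by
    \<open>nf3_c_indep\<close> every other direction gives the same.\<close>
  define c where "c = (\<lambda>(k, e). - \<phi> (M (sn k (p ^ e)) {} k) k (zr, {}))"
  define \<psi> where "\<psi> = \<phi> + Q c"
  have \<psi>: "nf3 \<psi>" unfolding \<psi>_def by (rule nf3_plus_Q[OF \<phi>])
  have c0: "\<psi> (M \<alpha> {} i) i (zr, {}) = 0" if i: "i \<in> E" and v: "vld \<alpha> {} i" for \<alpha> i
  proof (rule ccontr)
    assume "\<psi> (M \<alpha> {} i) i (zr, {}) \<noteq> 0"
    from nf3_prime_power[OF \<psi> i v this] obtain k e where k: "k \<in> E" "1 \<le> e" "e < t k" and a: "\<alpha> = sn k (p ^ e)" by blast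
    have "(k, e) \<in> Ix" using k by (simp add: Ix_def)
    then have "Q c (M \<alpha> {} i) i (zr, {}) = c (k, e)" unfolding a using i by (rule Q_sn)
    then have "\<psi> (M \<alpha> {} i) i (zr, {}) = \<phi> (M \<alpha> {} i) i (zr, {}) + c (k, e)" by (simp add: \<psi>_def pointwise)
    also have "\<phi> (M \<alpha> {} i) i (zr, {}) = \<phi> (M \<alpha> {} k) k (zr, {})" by (rule nf3_c_indep[OF \<phi> i k(1) v])
    finally show False using \<open>\<psi> (M \<alpha> {} i) i (zr, {}) \<noteq> 0\<close> by (simp add: c_def a)
  qed
  have "\<forall>\<alpha>. (\<Sum>k\<in>E. \<alpha> k) = N \<longrightarrow> vld \<alpha> {} i \<longrightarrow> \<psi> (M \<alpha> {} i) = 0" if i: "i \<in> E" for N i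
  proof (induction N rule: less_induct)
    case (less N)
    show ?case
    proof (intro allI impI)
      fix \<alpha> assume N: "(\<Sum>k\<in>E. \<alpha> k) = N" and v: "vld \<alpha> {} i"
      show "\<psi> (M \<alpha> {} i) = 0"
      proof (rule W_ext, rule ccontr)
        fix s \<beta> w assume "\<psi> (M \<alpha> {} i) s (\<beta>, w) \<noteq> 0 s (\<beta>, w)"
        then have n: "\<psi> (M \<alpha> {} i) s (\<beta>, w) \<noteq> 0" by (simp add: pointwise)
        have b: "\<beta> = zr"
        proof (rule nf_const[OF nf3_nf[OF \<psi>] v _ n])
          fix k assume k: "k \<in> E" "0 < \<alpha> k"
          have "(\<Sum>j\<in>E. (\<alpha>(k := \<alpha> k - 1)) j) < N"
            unfolding N[symmetric] by (rule sum_strict_mono_ex1) (use k in \<open>auto intro!: bexI[of _ k]\<close>)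
          then show "\<psi> (M (\<alpha>(k := \<alpha> k - 1)) {} i) = 0" using less v by (metis vld_lower diff_le_self)
        qed
        have "s = i \<and> w = {}" using nf3_W_const[OF \<psi> i v, of s w] n b by simp
        then show False using c0[OF i v] n b by simp
      qed
    qed
  qed
  then show ?thesis unfolding \<psi>_def by blast
qed

lemma wsmul_eq_0: "wsmul c X = 0 \<Longrightarrow> c \<noteq> 0 \<Longrightarrow> X = 0"
  by (auto simp: wsmul_def fun_eq_iff pointwise)

lemma osign_nz: "(osign u v :: 'a) \<noteq> 0" by (simp add: osign_ninv)

section \<open>Elements generated from the normalised ones\<close>

lemma two_elements:
  fixes v :: "nat set"
  assumes "card v \<ge> 2"
  obtains a b v' where "a < b" "v = insert a (insert b v')" "v' \<inter> {a, b} = {}" "card v = Suc (Suc (card v'))"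
proof -
  define k where "k = card v - 2"
  have "card v = Suc (Suc k)" using assms by (simp add: k_def)
  then obtain a w where w: "v = insert a w" "a \<notin> w" "card w = Suc k" by (metis card_Suc_eq)
  then obtain b v' where v': "w = insert b v'" "b \<notin> v'" "card v' = k" by (metis card_Suc_eq)
  have c: "card v = Suc (Suc (card v'))" using \<open>card v = Suc (Suc k)\<close> v' by simp
  show ?thesis
  proof (cases "a < b")
    case True then show ?thesis using that[of a b v'] w v' c by simp
  next
    case False then show ?thesis using that[of b a v'] w v' c by (auto simp: insert_commute)
  qed
qed

text \<open>Induction on the size of \<open>v\<close>: \<open>x^(\<beta>) x^v D_i\<close> is up to
  sign the bracket of \<open>x_a x_b D_i\<close> with
  \<open>x^(\<beta> + \<epsilon>_i) x^(v') D_i\<close>, where \<open>v'\<close> is \<open>v\<close>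
  without \<open>a\<close> and \<open>b\<close>. This needs room at \<open>i\<close>, so the top
  exponent is treated separately.\<close>

lemma kill_V:
  assumes \<phi>: "nf3 \<phi>" and W: "\<And>\<alpha> i. i \<in> E \<Longrightarrow> vld \<alpha> {} i \<Longrightarrow> \<phi> (M \<alpha> {} i) = 0"
  shows "i \<in> E \<Longrightarrow> vld \<alpha> v i \<Longrightarrow> \<phi> (M \<alpha> v i) = 0"
proof -
  note D = nf_Der[OF nf3_nf[OF \<phi>]]
  have "\<forall>v \<alpha> i. card v = N \<longrightarrow> i \<in> E \<longrightarrow> vld \<alpha> v i \<longrightarrow> \<phi> (M \<alpha> v i) = 0" for N
  proof (induction N rule: less_induct)
    case (less N)
    show ?case
    proof (intro allI impI)
      fix v \<alpha> i assume N: "card v = N" and i: "i \<in> E" and v: "vld \<alpha> v i"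
      have vO: "v \<subseteq> Od" "even (card v)" using v i by (auto simp: vld_E in_B)
      have fv: "finite v" using vO(1) by (rule finite_Od_sub)
      show "\<phi> (M \<alpha> v i) = 0"
      proof (cases "v = {}")
        case True then show ?thesis using W i v by simp
      next
        case False
        then have "card v \<noteq> 0" using fv by simp
        then have "card v \<ge> 2" using vO by (cases "card v = 1") auto
        then obtain a b v' where ab: "a < b" "v = insert a (insert b v')" "v' \<inter> {a, b} = {}" "card v = Suc (Suc (card v'))"
          by (rule two_elements)
        have abO: "a \<in> Od" "b \<in> Od" "v' \<subseteq> Od" using ab vO by auto
        have iab: "i \<notin> {a, b}" using i abO E_Od by auto
        have low: "\<phi> (M \<beta> v i) = 0" if vb: "vld \<beta> v i" and lt: "\<beta> i < pi i" for \<beta>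
        proof -
          let ?b = "\<beta>(i := Suc (\<beta> i))"
          have "(\<beta>, v') \<in> B" using vb abO by (simp add: vld_def in_B)
          then have "(?b, v') \<in> B" using B_raise[OF i] lt by blast
          then have vb': "vld ?b v' i" using vO ab i by (simp add: vld_E)
          have "\<phi> (M ?b v' i) = 0" using less[of "card v'"] ab N i vb' by simp
          then have "\<phi> (br (M zr {a, b} i) (M ?b v' i)) = 0"
            using nf3_y[OF \<phi> M_L[OF vb'] abO(1,2) ab(1) i] abO ab i by (simp add: vld_y)
          moreover have "br (M zr {a, b} i) (M ?b v' i) = wsmul (osign {a, b} v') (M \<beta> v i)"
            using br_y_M[OF abO(1,2) _ i Y_E[OF i] iab vb' ab(3)] ab by (simp add: fun_upd_idem)
          ultimately have "wsmul (osign {a, b} v') (\<phi> (M \<beta> v i)) = 0" using D vb by (simp add: Der_wsmul)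
          then show ?thesis using wsmul_eq_0 osign_nz by blast
        qed
        show ?thesis
        proof (cases "\<alpha> i < pi i")
          case True then show ?thesis using low v by blast
        next
          case F: False
          then have ai: "\<alpha> i = pi i" using vld_le[OF v i] by simp
          have apos: "\<alpha> i > 0" using pi_ge[OF i] ai by linarith
          \<comment> \<open>At the top exponent the bracket
            \<open>[x_i x^v D_i, x^(\<alpha>) D_i]\<close> is used instead: it equals
            \<open>pi i - 1 = -2\<close> times the wanted vector, and \<open>x_i x^v D_i\<close> is
            covered by \<open>low\<close>.\<close>
          have vX: "vld (sn i (Suc 0)) v i" using i vO by (simp add: vld_E sn1_B)
          have vA: "vld \<alpha> {} i" using v i by (simp add: vld_E in_B)
          have B: "(\<alpha>, {}) \<in> B" "(\<alpha>(i := \<alpha> i - 1), {}) \<in> B" "(\<alpha>, v) \<in> B" "(sn i (Suc 0), v) \<in> B" "(zr, v) \<in> B"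
            using vA vld_lower[OF vA, of "\<alpha> i - 1" i] v vX vO by (simp_all add: vld_def zr_B)
          have up: "(\<alpha>(i := \<alpha> i - 1))(i := (\<alpha>(i := \<alpha> i - 1)) i + Suc 0) = \<alpha>" using apos by (simp add: fun_upd_idem)
          have m1: "mon (sn i (Suc 0), v) \<odot> D i (mon (\<alpha>, {})) = sc (of_nat (\<alpha> i)) (mon (\<alpha>, v))"
            using B apos i up by (simp add: D_mon_E mul_mon dpcoef_sn sn_add fun_upd_idem)
          have m2: "mon (\<alpha>, {}) \<odot> D i (mon (sn i (Suc 0), v)) = mon (\<alpha>, v)"
            using B i by (simp add: D_mon_E mul_mon)
          have "br (M (sn i (Suc 0)) v i) (M \<alpha> {} i) = wsmul (of_nat (\<alpha> i)) (M \<alpha> v i) - M \<alpha> v i"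
            unfolding br_M[OF vX vA] m1 m2 el_sc by (simp only: M_def)
          also have "\<dots> = wsmul (- 2) (M \<alpha> v i)"
            by (rule W_ext) (simp add: wsmul_apply pointwise ai of_nat_pi[OF i, unfolded One_nat_def])
          finally have e: "br (M (sn i (Suc 0)) v i) (M \<alpha> {} i) = wsmul (- 2) (M \<alpha> v i)" .
          have "\<phi> (M (sn i (Suc 0)) v i) = 0" using low[OF vX] pi_ge[OF i] by simp
          then have "\<phi> (br (M (sn i (Suc 0)) v i) (M \<alpha> {} i)) = 0" using D vX vA W[OF i vA] by (simp add: Der_br)
          then have "wsmul (- 2) (\<phi> (M \<alpha> v i)) = 0" unfolding e using D v by (simp add: Der_wsmul)
          then show ?thesis using wsmul_eq_0[of "- 2"] two_nz by simp
        qed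
      qed
    qed
  qed
  then show "i \<in> E \<Longrightarrow> vld \<alpha> v i \<Longrightarrow> \<phi> (M \<alpha> v i) = 0" by blast
qed

lemma B_split: "(\<alpha>, u) \<in> B \<longleftrightarrow> (\<alpha>, {}) \<in> B \<and> u \<subseteq> Od"
  by (simp add: in_B)

text \<open>As \<open>D_b\<close> kills \<open>x^(\<alpha>)\<close> for odd \<open>b\<close>, one
  bracket replaces \<open>x_j\<close> by an arbitrary \<open>x^(\<alpha>)\<close>. In odd directions
  it thus suffices to treat \<open>x_j x^u D_b\<close>.\<close>

lemma br_scale:
  assumes j: "j \<in> E" and b: "b \<in> Od" and v: "vld \<alpha> u b"
  shows "br (M \<alpha> {} j) (M (sn j (Suc 0)) u b) = M \<alpha> u b"
proof -
  have va: "vld \<alpha> {} j" and vx: "vld (sn j (Suc 0)) u b" and B: "(\<alpha>, {}) \<in> B" "(zr, u) \<in> B" "(sn j (Suc 0), u) \<in> B" "(\<alpha>, u) \<in> B"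
    using j b v B_split[of \<alpha> u] by (auto simp: vld_E vld_O sn1_B zr_B)
  have 1: "mon (\<alpha>, {}) \<odot> D j (mon (sn j (Suc 0), u)) = mon (\<alpha>, u)"
    using B j by (simp add: D_mon_E mul_mon)
  have 2: "D b (mon (\<alpha>, {})) = 0" using b by (simp add: D_mon_O)
  show ?thesis unfolding br_M[OF va vx] 1 2 by (simp add: M_def)
qed

text \<open>Even directions are \<open>kill_V\<close>. For odd \<open>b\<close>,
  \<open>br_scale\<close> reduces to \<open>x_j x^u D_b\<close>: for a single \<open>u\<close> the
  value would be constant of weight 1 at \<open>j\<close>, which is impossible; larger
  \<open>u\<close> are built up two indices at a time.\<close>

lemma kill_all:
  assumes \<phi>: "nf3 \<phi>" and W: "\<And>\<alpha> i. i \<in> E \<Longrightarrow> vld \<alpha> {} i \<Longrightarrow> \<phi> (M \<alpha> {} i) = 0" and X: "X \<in> L"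
  shows "\<phi> X = 0"
proof -
  note N = nf3_nf[OF \<phi>]
  note D = nf_Der[OF N]
  note V = kill_V[OF \<phi> W]
  obtain j where j: "j \<in> E" using E_other by metis
  have scale: "\<phi> (M \<alpha> u b) = 0" if "\<phi> (M (sn j (Suc 0)) u b) = 0" "b \<in> Od" "vld \<alpha> u b" for \<alpha> u b
  proof -
    have va: "vld \<alpha> {} j" and vx: "vld (sn j (Suc 0)) u b"
      using that j B_split[of \<alpha> u] by (simp_all add: vld_E vld_O sn1_B)
    have "\<phi> (br (M \<alpha> {} j) (M (sn j (Suc 0)) u b)) = 0"
      using D va vx that W[OF j va] by (simp add: Der_br)
    then show ?thesis unfolding br_scale[OF j that(2,3)] .
  qed
  have gl: "\<phi> (M (sn j (Suc 0)) {a} b) = 0" if ab: "a \<in> Od" "b \<in> Od" for a b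
  proof (rule W_ext, rule ccontr)
    fix s \<beta> v
    have vl: "vld (sn j (Suc 0)) {a} b" using ab j by (simp add: vld_O sn1_B)
    assume "\<phi> (M (sn j (Suc 0)) {a} b) s (\<beta>, v) \<noteq> 0 s (\<beta>, v)"
    then have n: "\<phi> (M (sn j (Suc 0)) {a} b) s (\<beta>, v) \<noteq> 0" by (simp add: pointwise)
    have g0: "\<phi> (M zr {a} b) = 0"
    proof (cases "a = b")
      case True
      have "T b = M zr {a} b" using True ab E_Od by (simp add: T_def)
      moreover have "\<phi> (T b) = 0" using N ab by (simp add: nf_def torus0_def Y_O)
      ultimately show ?thesis by simp
    next
      case False then show ?thesis using \<phi> ab by (simp add: nf3_def nf2_def)
    qed
    have b0: "\<beta> = zr"
      by (rule nf_const[OF N vl _ n]) (use g0 in \<open>auto simp: sn_pos\<close>)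
    have "wt j s \<beta> v = wt j b (sn j (Suc 0)) {a}" using nf_weight(1)[OF N vl n] j by (simp add: Y_E)
    moreover have "b \<noteq> j" using ab j E_Od by auto
    ultimately show False using j one_m unfolding b0 by (auto simp: wt_def split: if_splits)
  qed
  have H: "\<forall>u \<alpha> b. card u = K \<longrightarrow> b \<in> Od \<longrightarrow> vld \<alpha> u b \<longrightarrow> \<phi> (M \<alpha> u b) = 0" for K
  proof (induction K rule: less_induct)
    case (less K)
    show ?case
    proof (intro allI impI)
      fix u \<alpha> b assume K: "card u = K" and b: "b \<in> Od" and v: "vld \<alpha> u b"
      have uO: "u \<subseteq> Od" "odd (card u)" using v b by (auto simp: vld_O in_B)
      show "\<phi> (M \<alpha> u b) = 0"
      proof (cases "card u = 1")
        case True
        then obtain a where a: "u = {a}" by (metis card_1_singletonE)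
        then show ?thesis using scale[OF gl b] v b uO by simp
      next
        case False
        then have "card u \<ge> 2" using uO by (cases "card u = 0") auto
        then obtain c d u' where cd: "c < d" "u = insert c (insert d u')" "u' \<inter> {c, d} = {}" "card u = Suc (Suc (card u'))"
          by (rule two_elements)
        have cO: "c \<in> Od" "d \<in> Od" "u' \<subseteq> Od" "odd (card u')" using cd uO by auto
        \<comment> \<open>The exponent 2 is chosen so that \<open>D_j\<close> leaves
          \<open>x_j\<close>: the bracket is \<open>x_j x^u D_b\<close> up to sign, minus a term in
          direction \<open>D_j\<close> that \<open>kill_V\<close> already covers.\<close>
        let ?X = "M (sn j 2) u' b" and ?y = "M zr {c, d} j"
        have vX: "vld (sn j 2) u' b" using b j cO pi_ge[OF j] by (simp add: vld_O sn_B)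
        have vy: "vld zr {c, d} j" using cO cd j by (simp add: vld_y)
        have v1: "vld (sn j (Suc 0)) u b" using b j uO by (simp add: vld_O sn1_B)
        define f where "f = mon (sn j 2, u') \<odot> D b (mon (zr, {c, d}))"
        have "par (1 + (0 + tau m n b)) f"
          unfolding f_def by (intro mul_par par_D mon_par) (use cO cd b in \<open>auto simp: Y_O\<close>)
        then have "par (0 + 2 * 1) f" using b by (simp add: tau_O numeral_2_eq_2)
        then have "par (tau m n j) f" using j unfolding par_even by (simp add: tau_E)
        then have fL: "el f j \<in> L" using j by (intro el_L) (simp add: Y_E)
        have fV: "\<phi> (el f j) = 0"
        proof (rule L_induct[where P = "\<lambda>Z. \<phi> Z = 0", OF fL])
          fix \<beta> w r assume "vld \<beta> w r" "el f j r (\<beta>, w) \<noteq> 0"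
          moreover from this have "r = j" by (metis el_other zero_fun_apply)
          ultimately show "\<phi> (M \<beta> w r) = 0" using V j by simp
        qed (use D in \<open>simp_all add: Der_add Der_wsmul\<close>)
        have Bs: "(sn j 2, u') \<in> B" "(sn j (Suc 0), u') \<in> B" "(zr, {c, d}) \<in> B"
          using vX cO j by (simp_all add: vld_def sn1_B zr_B)
        have m1: "mon (zr, {c, d}) \<odot> D j (mon (sn j 2, u')) = sc (osign {c, d} u') (mon (sn j (Suc 0), u))"
          using Bs cd j by (simp add: D_mon_E mul_mon Int_commute)
        have e: "br ?y ?X = wsmul (osign {c, d} u') (M (sn j (Suc 0)) u b) - el f j"
          unfolding br_M[OF vy vX] m1 f_def[symmetric] el_sc by (simp only: M_def)
        have "\<phi> ?X = 0" using less[of "card u'"] cd K b vX by simp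
        then have "\<phi> (br ?y ?X) = 0"
          using nf3_y[OF \<phi> M_L[OF vX] cO(1,2) cd(1) j] vy by simp
        then have "wsmul (osign {c, d} u') (\<phi> (M (sn j (Suc 0)) u b)) = 0"
          unfolding e using D fL fV v1 by (simp add: Der_diff Der_wsmul)
        then have "\<phi> (M (sn j (Suc 0)) u b) = 0" using wsmul_eq_0 osign_nz by blast
        then show ?thesis using scale b v by blast
      qed
    qed
  qed
  show ?thesis
  proof (rule L_induct[where P = "\<lambda>Z. \<phi> Z = 0", OF X])
    fix \<alpha> u r assume v: "vld \<alpha> u r"
    then have "r \<in> E \<or> r \<in> Od" by (simp add: vld_def Y_iff)
    then show "\<phi> (M \<alpha> u r) = 0" using V v H by blast
  qed (use D in \<open>simp_all add: Der_add Der_wsmul\<close>)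
qed

section \<open>The outer derivations\<close>

lemma Q_uminus: "Z \<in> L \<Longrightarrow> Q (\<lambda>i. - c i) Z = - Q c Z"
  by (rule W_ext) (simp add: Q_apply pointwise case_prod_beta sum_negf)

lemma br_minus: "X \<in> L \<Longrightarrow> Z \<in> L \<Longrightarrow> br (- X) Z = - br X Z"
  by (simp only: wminus br_wsmul)

lemma Der_decomp:
  assumes \<phi>: "\<phi> \<in> Der"
  obtains X c where "X \<in> L" "\<phi> = ad X + Q c"
proof -
  obtain X where X: "X \<in> L" "nf3 (\<phi> + ad X)" using normal_form[OF \<phi>] by blast
  obtain c where c: "\<forall>\<alpha> i. i \<in> E \<longrightarrow> vld \<alpha> {} i \<longrightarrow> (\<phi> + ad X + Q c) (M \<alpha> {} i) = 0"
    using kill_W[OF X(2)] by blast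
  have z: "(\<phi> + ad X + Q c) Z = 0" if "Z \<in> L" for Z
    by (rule kill_all[OF nf3_plus_Q[OF X(2)] _ that]) (use c in blast)
  have "\<phi> = ad (- X) + Q (\<lambda>i. - c i)"
  proof
    fix Z show "\<phi> Z = (ad (- X) + Q (\<lambda>i. - c i)) Z"
    proof (cases "Z \<in> L")
      case True
      then have "\<phi> Z + br X Z + Q c Z = 0" using z by (simp add: pointwise ad_apply)
      then have "\<phi> Z = - br X Z + - Q c Z" by (rule add3_eq_0)
      then show ?thesis using True X by (simp only: pointwise ad_apply br_minus Q_uminus)
    next
      case False
      then show ?thesis using \<phi> Q_Der[of "\<lambda>i. - c i"] by (simp add: Der_out pointwise ad_def)
    qed
  qed
  then show ?thesis using that[of "- X" "\<lambda>i. - c i"] X(1) by simp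
qed

text \<open>\<open>Q c\<close> kills the torus, so \<open>X\<close> commutes with it and has no
  constant term in any even direction, such a term having weight \<open>-1\<close>. By
  \<open>br_const\<close> the bracket of \<open>X\<close> with
  \<open>x^(p^e \<epsilon>_k) D_k\<close> then has constant term zero in direction
  \<open>D_k\<close>, while \<open>Q_sn\<close> says that this term is
  \<open>c (k, e)\<close>.\<close>

lemma Q_eq_ad:
  assumes X: "X \<in> L" and e: "Q c = ad X" and i: "i \<in> Ix"
  shows "c i = 0"
proof -
  have brX: "br X (M \<alpha> u r) = 0" if "vld \<alpha> u r" "\<And>k. \<alpha> k \<le> 1" for \<alpha> u r
    using Q_low[OF that, of c] that(1) unfolding e by (simp add: ad_apply)
  have XE: "X s (zr, {}) = 0" if s: "s \<in> E" for s
  proof -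
    have "br X (T s) = 0"
      unfolding T_M by (rule brX[OF T_vld]) (use s in \<open>auto simp: Y_E sn_def\<close>)
    then have "br (T s) X s (zr, {}) = 0"
      using br_anti[of "T s" X] X s by (simp add: Y_E pointwise)
    then show ?thesis using br_T[OF Y_E[OF s] X] s by (simp add: wt_def)
  qed
  obtain k e where ke: "i = (k, e)" by (cases i)
  then have I: "(k, e) \<in> Ix" using i by simp
  then have k: "k \<in> E" by (simp add: Ix_def)
  note v = vld_sn_pow[OF I k]
  have "p ^ e \<noteq> 0" using p_gt by simp
  then have "zr \<noteq> sn k (p ^ e)" by (metis sn_eq_0)
  then have M0: "M (sn k (p ^ e)) {} k r (zr, {}) = 0" for r by (simp add: M_apply)
  have "c (k, e) = br X (M (sn k (p ^ e)) {} k) k (zr, {})"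
    using Q_sn[OF I k, of c] v unfolding assms(2) by (simp add: ad_apply)
  also have "\<dots> = 0"
    unfolding br_const[OF X M_L[OF v]] M0 by (rule sum.neutral) (simp add: XE)
  finally show ?thesis by (simp add: ke)
qed

section \<open>The quotient by the inner derivations\<close>

lemma vs_escale: "vector_space (escale :: 'a \<Rightarrow> ('a welem \<Rightarrow> 'a welem) \<Rightarrow> ('a welem \<Rightarrow> 'a welem))"
  by standard (auto simp: escale_def wsmul_def fun_eq_iff pointwise algebra_simps)

interpretation es: vector_space "escale :: 'a \<Rightarrow> ('a welem \<Rightarrow> 'a welem) \<Rightarrow> ('a welem \<Rightarrow> 'a welem)"
  by (rule vs_escale)

lemma adW_eq: "adW p m n t = ad ` L"
  unfolding adW_def ad_def by auto

lemma ad_in_Der: "adW p m n t \<subseteq> Der"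
  unfolding adW_eq using ad_Der by blast

lemma ad_wsmul: "X \<in> L \<Longrightarrow> ad (wsmul c X) = escale c (ad X)"
  by (rule ext) (simp add: ad_def escale_def br_wsmul)

lemma subspace_ad: "es.subspace (adW p m n t)"
  unfolding adW_eq
proof (rule es.subspaceI)
  have "ad 0 = 0" by (rule ext) (simp add: ad_def pointwise)
  then show "0 \<in> ad ` L" by (metis L_0 imageI)
qed (auto simp: ad_plus ad_wsmul[symmetric])

lemma Der_ad_commute:
  assumes \<phi>: "\<phi> \<in> Der" and X: "X \<in> L" and Z: "Z \<in> L"
  shows "\<phi> (ad X Z) - ad X (\<phi> Z) = ad (\<phi> X) Z"
  using assms by (simp add: ad_apply Der_br)

lemma Q_commute:
  assumes Z: "Z \<in> L" shows "Q c (Q d Z) = Q d (Q c Z)"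
proof (rule W_ext)
  fix s \<beta> v
  have Q2: "Q c (Q d Z) s (\<beta>, v) = (\<Sum>i\<in>Ix. \<Sum>j\<in>Ix. c i * d j *
      Z s (\<beta>(fst i := \<beta> (fst i) + p ^ snd i, fst j := (\<beta>(fst i := \<beta> (fst i) + p ^ snd i)) (fst j) + p ^ snd j), v))" for c d
    using Z Q_Der[of d] by (simp add: Q_apply case_prod_beta sum_distrib_left mult.assoc)
  have sw: "\<beta>(k := \<beta> k + x, l := (\<beta>(k := \<beta> k + x)) l + y) = \<beta>(l := \<beta> l + y, k := (\<beta>(l := \<beta> l + y)) k + x)" for k l x y
    by (cases "k = l") (simp_all add: fun_upd_twist add_ac)
  have "Q d (Q c Z) s (\<beta>, v) = (\<Sum>j\<in>Ix. \<Sum>i\<in>Ix. c i * d j *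
      Z s (\<beta>(fst i := \<beta> (fst i) + p ^ snd i, fst j := (\<beta>(fst i := \<beta> (fst i) + p ^ snd i)) (fst j) + p ^ snd j), v))"
    unfolding Q2 by (intro sum.cong refl) (simp only: sw mult.commute[of "c _"])
  then show "Q c (Q d Z) s (\<beta>, v) = Q d (Q c Z) s (\<beta>, v)"
    unfolding Q2[of c d] by (subst sum.swap) simp
qed

lemma commutator_inner:
  assumes D1: "D1 \<in> Der" and D2: "D2 \<in> Der"
  shows "(\<lambda>x. D1 (D2 x) - D2 (D1 x)) \<in> adW p m n t"
proof -
  obtain X1 c1 where 1: "X1 \<in> L" "D1 = ad X1 + Q c1" using Der_decomp[OF D1] by blast
  obtain X2 c2 where 2: "X2 \<in> L" "D2 = ad X2 + Q c2" using Der_decomp[OF D2] by blast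
  \<comment> \<open>\<open>[D1, ad X2] = ad (D1 X2)\<close> and
    \<open>[ad X1, Q c2] = - ad (Q c2 X1)\<close>; the remaining commutator of \<open>Q c1\<close>
    and \<open>Q c2\<close> is zero.\<close>
  let ?X = "D1 X2 - Q c2 X1"
  have XL: "?X \<in> L" using D1 1 2 Q_Der by simp
  have "D1 (D2 x) - D2 (D1 x) = ad ?X x" for x
  proof (cases "x \<in> L")
    case True
    note q = Q_Der[of c1] Q_Der[of c2]
    have l: "ad X2 x \<in> L" "Q c2 x \<in> L" "ad X1 x \<in> L" "Q c1 x \<in> L" "D1 x \<in> L"
      using True 1(1) 2(1) q D1 by (simp_all add: ad_apply)
    have a: "D1 (ad X2 x) - ad X2 (D1 x) = ad (D1 X2) x" by (rule Der_ad_commute[OF D1 2(1) True])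
    have b: "Q c2 (ad X1 x) - ad X1 (Q c2 x) = ad (Q c2 X1) x" by (rule Der_ad_commute[OF q(2) 1(1) True])
    have d1: "D1 y = ad X1 y + Q c1 y" for y unfolding 1(2) by (rule plus_fun_apply)
    have d2: "D2 y = ad X2 y + Q c2 y" for y unfolding 2(2) by (rule plus_fun_apply)
    have "D1 (D2 x) = D1 (ad X2 x) + D1 (Q c2 x)"
      unfolding d2 by (rule Der_add[OF D1 l(1,2)])
    moreover have "D1 (Q c2 x) = ad X1 (Q c2 x) + Q c1 (Q c2 x)" by (rule d1)
    moreover have "D2 (D1 x) = ad X2 (D1 x) + Q c2 (D1 x)" by (rule d2)
    moreover have "Q c2 (D1 x) = Q c2 (ad X1 x) + Q c2 (Q c1 x)"
      unfolding d1 by (rule Der_add[OF q(2) l(3,4)])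
    moreover have "Q c2 (Q c1 x) = Q c1 (Q c2 x)" by (rule Q_commute[OF True])
    ultimately have "D1 (D2 x) - D2 (D1 x) = ad (D1 X2) x - ad (Q c2 X1) x"
      unfolding a[symmetric] b[symmetric] by (simp only: algebra_simps) 
    also have "\<dots> = ad ?X x" using True D1 1(1) 2(1) q by (simp add: ad_apply br_diff)
    finally show ?thesis .
  next
    case False
    then show ?thesis using D1 D2 by (simp add: Der_out ad_def)
  qed
  then show ?thesis unfolding adW_eq using XL by blast
qed

text \<open>This makes a basis of the inner derivations finite, so that its cardinality can be added
  to that of the outer part.\<close>

lemma ad_span_finite: "\<exists>S. finite S \<and> adW p m n t \<subseteq> es.span S"
proof (intro exI conjI)
  let ?S = "(\<lambda>((\<alpha>, u), r). ad (M \<alpha> u r)) ` (B \<times> Y)"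
  show "finite ?S" by simp
  have "ad X \<in> es.span ?S" if X: "X \<in> L" for X
  proof (rule L_induct[where P = "\<lambda>X. ad X \<in> es.span ?S", OF X])
    have "ad 0 = 0" by (rule ext) (simp add: ad_def pointwise)
    then show "ad 0 \<in> es.span ?S" by (simp add: es.span_zero)
  next
    fix \<alpha> u r assume "vld \<alpha> u r"
    then have "((\<alpha>, u), r) \<in> B \<times> Y" by (simp add: vld_def)
    then have "ad (M \<alpha> u r) \<in> ?S" by force
    then show "ad (M \<alpha> u r) \<in> es.span ?S" by (rule es.span_base)
  next
    fix U V assume "U \<in> L" "V \<in> L" "ad U \<in> es.span ?S" "ad V \<in> es.span ?S"
    then show "ad (U + V) \<in> es.span ?S" by (simp add: ad_plus[symmetric] es.span_add)
  next
    fix c U assume "U \<in> L" "ad U \<in> es.span ?S"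
    then show "ad (wsmul c U) \<in> es.span ?S" by (simp add: ad_wsmul es.span_scale)
  qed
  then show "adW p m n t \<subseteq> es.span ?S" unfolding adW_eq by blast
qed

text \<open>A basis of the inner derivations is completed by the powers \<open>P k e\<close>:
  \<open>Der_decomp\<close> gives spanning and \<open>Q_eq_ad\<close> independence.\<close>

lemma dim_Der: "es.dim Der = es.dim (adW p m n t) + card Ix"
proof -
  obtain Ba where Ba: "Ba \<subseteq> adW p m n t" "es.independent Ba" "adW p m n t \<subseteq> es.span Ba" "card Ba = es.dim (adW p m n t)"
    using es.basis_exists by blast
  obtain S where S: "finite S" "adW p m n t \<subseteq> es.span S" using ad_span_finite by blast
  have fBa: "finite Ba" using es.independent_span_bound[OF S(1) Ba(2)] Ba(1) S(2) by blast
  let ?P = "\<lambda>i. P (fst i) (snd i)"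
  define C where "C = ?P ` Ix"
  \<comment> \<open>Writing a single power as a \<open>Q\<close> makes \<open>Q_sn\<close> and
    \<open>Q_eq_ad\<close> applicable to it.\<close>
  have delta: "Q (\<lambda>j. if j = i then 1 else 0) = ?P i" if i: "i \<in> Ix" for i
  proof -
    have "Q (\<lambda>j. if j = i then 1 else 0) = (\<Sum>j\<in>Ix. if j = i then ?P j else 0)"
      unfolding Q_def by (rule sum.cong) auto
    then show ?thesis using i by simp
  qed
  have inj: "inj_on ?P Ix"
  proof (rule inj_onI, rule ccontr)
    fix i j assume ij: "i \<in> Ix" "j \<in> Ix" "?P i = ?P j" "i \<noteq> j"
    obtain k e where ke: "i = (k, e)" by (cases i)
    have I: "(k, e) \<in> Ix" using ij ke by simp
    then have k: "k \<in> E" by (simp add: Ix_def)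
    have "Q (\<lambda>l. if l = i then 1 else 0) = Q (\<lambda>l. if l = j then 1 else 0)"
      using delta[OF ij(1)] delta[OF ij(2)] ij(3) by simp
    then show False using Q_sn[OF I k, of "\<lambda>l. if l = i then 1 else 0"] Q_sn[OF I k, of "\<lambda>l. if l = j then 1 else 0"] ij(4) ke by simp
  qed
  have disj: "Ba \<inter> C = {}"
  proof (rule ccontr)
    assume "Ba \<inter> C \<noteq> {}"
    then obtain i where i: "i \<in> Ix" "?P i \<in> ad ` L" using Ba(1) unfolding C_def adW_eq by blast
    then obtain X where "X \<in> L" "Q (\<lambda>j. if j = i then 1 else 0) = ad X" using delta by auto
    from Q_eq_ad[OF this i(1)] show False by simp
  qed
  have fC: "finite C" by (simp add: C_def)
  have ind: "es.independent (Ba \<union> C)"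
  proof
    assume "es.dependent (Ba \<union> C)"
    then have "\<exists>u. (\<exists>v\<in>Ba \<union> C. u v \<noteq> 0) \<and> (\<Sum>v\<in>Ba \<union> C. escale (u v) v) = 0"
      unfolding es.dependent_finite[OF finite_UnI[OF fBa fC]] .
    then obtain u where u: "\<exists>v\<in>Ba \<union> C. u v \<noteq> 0" "(\<Sum>v\<in>Ba \<union> C. escale (u v) v) = 0" by (elim exE conjE)
    let ?c = "\<lambda>i. u (?P i)"
    have sC: "(\<Sum>v\<in>C. escale (u v) v) = Q ?c"
      unfolding C_def Q_def by (subst sum.reindex[OF inj]) simp
    have "(\<Sum>v\<in>Ba. escale (u v) v) + Q ?c = 0"
      using u(2) sum.union_disjoint[OF fBa fC disj, of "\<lambda>v. escale (u v) v"] sC by simp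
    then have "Q ?c = escale (- 1) (\<Sum>v\<in>Ba. escale (u v) v)"
      by (simp only: es.scale_minus_left es.scale_one add_eq_0_iff)
    moreover have "escale (- 1) (\<Sum>v\<in>Ba. escale (u v) v) \<in> adW p m n t"
      using subspace_ad Ba(1) by (meson es.subspace_scale es.subspace_sum subsetD)
    ultimately obtain X where "X \<in> L" "Q ?c = ad X" unfolding adW_eq by auto
    then have c0: "?c i = 0" if "i \<in> Ix" for i using Q_eq_ad that by blast
    then have "Q ?c = 0" unfolding Q_def by (intro sum.neutral) simp
    then have s0: "(\<Sum>v\<in>Ba. escale (u v) v) = 0" using \<open>(\<Sum>v\<in>Ba. escale (u v) v) + Q ?c = 0\<close> by simp
    have "\<forall>v\<in>Ba. u v = 0"
    proof (rule ccontr)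
      assume "\<not> (\<forall>v\<in>Ba. u v = 0)"
      then have "\<exists>v\<in>Ba. u v \<noteq> 0" by blast
      then have "es.dependent Ba" unfolding es.dependent_finite[OF fBa] using s0 by (intro exI[of _ u] conjI)
      with Ba(2) show False by (rule notE)
    qed
    then show False using u(1) c0 unfolding C_def by auto
  qed
  have "Ba \<union> C \<subseteq> Der" using Ba(1) ad_in_Der P_Der unfolding C_def by (auto simp: Ix_def)
  then have sp1: "es.span (Ba \<union> C) \<subseteq> es.span Der" by (rule es.span_mono)
  have "Der \<subseteq> es.span (Ba \<union> C)"
  proof
    fix \<phi> assume "\<phi> \<in> Der"
    then obtain X c where X: "X \<in> L" "\<phi> = ad X + Q c" by (rule Der_decomp)
    have "ad X \<in> es.span (Ba \<union> C)" using X(1) Ba(3) es.span_mono[of Ba "Ba \<union> C"] unfolding adW_eq by blast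
    moreover have "Q c \<in> es.span (Ba \<union> C)"
      unfolding Q_def by (intro es.span_sum es.span_scale es.span_base) (auto simp: C_def)
    ultimately show "\<phi> \<in> es.span (Ba \<union> C)" unfolding X(2) by (rule es.span_add)
  qed
  then have "es.span Der \<subseteq> es.span (Ba \<union> C)" by (rule es.span_minimal) (rule es.subspace_span)
  then have "es.dim Der = card (Ba \<union> C)" using es.dim_eq_card[OF _ ind, of Der] sp1 by blast
  also have "\<dots> = card Ba + card C" by (rule card_Un_disjoint[OF fBa fC disj])
  also have "card C = card Ix" unfolding C_def by (rule card_image[OF inj])
  finally show ?thesis using Ba(4) by simp
qed

lemma card_Ix: "card Ix = (\<Sum>i = 1..m. t i) - m"
proof -
  have "card Ix = (\<Sum>i\<in>{1..m}. t i - 1)" by (simp add: Ix_Sigma Y0_def)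
  also have "\<dots> = (\<Sum>i\<in>{1..m}. t i) - (\<Sum>i\<in>{1..m}. 1)"
    by (rule sum_subtractf_nat) (use t_ge in auto)
  finally show ?thesis by simp
qed

end

theorem theorem5p1p2:
  fixes p m n :: nat and t :: "nat \<Rightarrow> nat"
  assumes "CHAR('a::field) = p" and "prime p" and "p > 3"
    and "m \<ge> 3" and "n \<ge> 3"
    and "\<forall>i \<in> {1..m}. t i \<ge> 1"
  shows "adW p m n t \<subseteq> (DerW p m n t :: ('a welem \<Rightarrow> 'a welem) set)
    \<and> (\<forall>D1 \<in> DerW p m n t. \<forall>D2 \<in> DerW p m n t.
          (\<lambda>x. D1 (D2 x) - D2 (D1 x)) \<in> (adW p m n t :: ('a welem \<Rightarrow> 'a welem) set))
    \<and> vector_space.dim escale (DerW p m n t :: ('a welem \<Rightarrow> 'a welem) set)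
        = vector_space.dim escale (adW p m n t :: ('a welem \<Rightarrow> 'a welem) set)
          + ((\<Sum>i = 1..m. t i) - m)"
proof -
  interpret even_W p m n t "TYPE('a)"
    using assms by unfold_locales auto
  show ?thesis using ad_in_Der commutator_inner dim_Der card_Ix by simp
qed

end
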